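(* Let $\alpha>0$ and $u\in C(\mathbb{T},\mathbb{R})$, and assume that $\omega_1(\delta,u)\ge C_1\delta^{2\alpha+3}$ for all $\delta\in(0,1)$, where $C_1$ is a positive constant. Then there exist positive constants $\varepsilon,C$ (independent of $\nu$, $k$, $t$) such that for every $\nu>0$ and every integer $k\ne 0$ satisfying $\nu|k|^{-1}\le 1/2$, $$\|S_\nu(t)P_k\|_{L^2\to L^2}\le Ce^{-\varepsilon\widetilde{\lambda}_{\nu,k}t},\qquad \|R_\nu(t)P_k\|_{L^2\to L^2}\le Ce^{-\varepsilon\widetilde{\lambda}_{\nu,k}t},\qquad \forall\, t\ge 0,$$ where $\widetilde{\lambda}_{\nu,k}=\nu^{\frac{\alpha}{\alpha+2}}|k|^{\frac{2}{\alpha+2}}$.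
   Context: $\mathbb{T}=\mathbb{R}/2\pi\mathbb{Z}$; functions on $\mathbb{T}$ are identified with $2\pi$-periodic functions on $\mathbb{R}$. For $u\in C(\mathbb{T},\mathbb{R})$ let $\psi:\mathbb{R}\to\mathbb{R}$ be a primitive of $u$, $\psi'=u$ ($\psi$ need not be periodic), and for $\delta>0$ set $$\omega_1(\delta,u)=\inf_{x,c_1,c_2\in\mathbb{R}}\int_{x-\delta}^{x+\delta}|\psi(y)-c_1-c_2y|^2\,dy,$$ which does not depend on the choice of the primitive. For $\nu>0$, $S_\nu(t):L^2(\mathbb{T}^2)\to L^2(\mathbb{T}^2)$, $t\ge0$, is the linear evolution semigroup generated by the drift-diffusion equation $\partial_tf-\nu\Delta f+u(y)\partial_xf=0$, $(x,y)\in\mathbb{T}^2$, $t>0$ (so $S_\nu(t)f_0$ is the solution at time $t$ with initial datum $f_0$), and $R_\nu(t):L^2(\mathbb{T}^2)\to L^2(\mathbb{T}^2)$ is the semigroup generated by $\partial_tf-\nu\partial_y^2f+u(y)\partial_xf=0$. $P_k$ denotes the projection onto the $k$-th Fourier mode in $x$. On the $k$-th mode, $S_\nu(t)P_k$ and $R_\nu(t)P_k$ correspond to the semigroups $e^{-tL_{k,\nu}}$ and $e^{-tR_{k,\nu}}$ on $L^2(\mathbb{T})$ (in $y$), with $L_{k,\nu}=iku-\nu(\partial_y^2-|k|^2)$ and $R_{k,\nu}=iku-\nu\partial_y^2$, both with domain $H^2(\mathbb{T})$. *)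

theory Defs
  imports "HOL-Analysis.Analysis"
begin

text \<open>
  The torus is the fundamental square \<open>[0, 2\<pi>) \<times> [0, 2\<pi>)\<close> with Lebesgue measure. Elements of
  \<open>l2_torus\<close> are classes of complex functions modulo equality almost everywhere in that square;
  the values of a representative outside the square are irrelevant.
\<close>

definition circle_measure :: "real measure" where
  "circle_measure = restrict_space lborel {0..<2*pi}"

definition torus_measure :: "(real \<times> real) measure" where
  "torus_measure = circle_measure \<Otimes>\<^sub>M circle_measure"

definition sq_integrable :: "(real \<times> real \<Rightarrow> complex) \<Rightarrow> bool" where
  "sq_integrable f \<longleftrightarrow> f \<in> borel_measurable torus_measure \<and>
     integrable torus_measure (\<lambda>z. (cmod (f z))\<^sup>2)"

lemma sq_integrable_zero: "sq_integrable (\<lambda>_. 0)"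
  by (simp add: sq_integrable_def)

lemma sq_integrable_scaleR:
  assumes "sq_integrable f"
  shows "sq_integrable (\<lambda>z. c *\<^sub>R f z)"
  using assms by (auto simp: sq_integrable_def power_mult_distrib)

lemma sq_integrable_add:
  assumes "sq_integrable f" "sq_integrable g"
  shows "sq_integrable (\<lambda>z. f z + g z)"
  unfolding sq_integrable_def
proof
  show m: "(\<lambda>z. f z + g z) \<in> borel_measurable torus_measure"
    using assms by (auto simp: sq_integrable_def)
  have i: "integrable torus_measure (\<lambda>z. 2 * (cmod (f z))\<^sup>2 + 2 * (cmod (g z))\<^sup>2)"
    using assms by (auto simp: sq_integrable_def)
  have b: "(cmod (f z + g z))\<^sup>2 \<le> 2 * (cmod (f z))\<^sup>2 + 2 * (cmod (g z))\<^sup>2" for z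
  proof -
    have "(cmod (f z + g z))\<^sup>2 \<le> (cmod (f z) + cmod (g z))\<^sup>2"
      by (intro power_mono norm_triangle_ineq) simp
    also have "\<dots> \<le> 2 * (cmod (f z))\<^sup>2 + 2 * (cmod (g z))\<^sup>2"
      using sum_squares_bound[of "cmod (f z)" "cmod (g z)"] by (simp add: power2_sum)
    finally show ?thesis .
  qed
  show "integrable torus_measure (\<lambda>z. (cmod (f z + g z))\<^sup>2)"
    by (rule Bochner_Integration.integrable_bound[OF i]) (use m b in auto)
qed

lemma integrable_inner_sq_integrable:
  assumes "sq_integrable f" "sq_integrable g"
  shows "integrable torus_measure (\<lambda>z. f z \<bullet> g z)"
proof -
  have i: "integrable torus_measure (\<lambda>z. (cmod (f z))\<^sup>2 + (cmod (g z))\<^sup>2)"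
    using assms by (auto simp: sq_integrable_def)
  have b: "\<bar>f z \<bullet> g z\<bar> \<le> (cmod (f z))\<^sup>2 + (cmod (g z))\<^sup>2" for z
  proof -
    have "\<bar>f z \<bullet> g z\<bar> \<le> cmod (f z) * cmod (g z)" by (rule Cauchy_Schwarz_ineq2)
    also have "\<dots> \<le> (cmod (f z))\<^sup>2 + (cmod (g z))\<^sup>2"
      using sum_squares_bound[of "cmod (f z)" "cmod (g z)"]
        mult_nonneg_nonneg[of "cmod (f z)" "cmod (g z)", OF norm_ge_zero norm_ge_zero] by linarith
    finally show ?thesis .
  qed
  show ?thesis
    by (rule Bochner_Integration.integrable_bound[OF i])
       (use assms b in \<open>auto simp: sq_integrable_def\<close>)
qed

quotient_type l2_torus = "real \<times> real \<Rightarrow> complex" / partial: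
  "\<lambda>f g. sq_integrable f \<and> sq_integrable g \<and> (AE z in torus_measure. f z = g z)"
proof (rule part_equivpI)
  show "\<exists>f. sq_integrable f \<and> sq_integrable f \<and> (AE z in torus_measure. f z = f z)"
    using sq_integrable_zero by auto
  show "symp (\<lambda>f g. sq_integrable f \<and> sq_integrable g \<and> (AE z in torus_measure. f z = g z))"
    by (rule sympI) (auto elim: eventually_mono)
  show "transp (\<lambda>f g. sq_integrable f \<and> sq_integrable g \<and> (AE z in torus_measure. f z = g z))"
    by (rule transpI) (auto elim: eventually_elim2)
qed

instantiation l2_torus :: real_vector
begin

lift_definition zero_l2_torus :: l2_torus is "\<lambda>_. 0"
  by (simp add: sq_integrable_zero)

lift_definition plus_l2_torus :: "l2_torus \<Rightarrow> l2_torus \<Rightarrow> l2_torus" is "\<lambda>f g z. f z + g z"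
  by (auto intro: sq_integrable_add elim: eventually_elim2)

lift_definition scaleR_l2_torus :: "real \<Rightarrow> l2_torus \<Rightarrow> l2_torus" is "\<lambda>c f z. c *\<^sub>R f z"
  by (auto intro: sq_integrable_scaleR elim: eventually_mono)

definition uminus_l2_torus :: "l2_torus \<Rightarrow> l2_torus" where "uminus_l2_torus f = (-1) *\<^sub>R f"

definition minus_l2_torus :: "l2_torus \<Rightarrow> l2_torus \<Rightarrow> l2_torus" where
  "minus_l2_torus f g = f + (- g)"

instance
proof
  fix f g h :: l2_torus and a b :: real
  show "f + g + h = f + (g + h)"
    by transfer (simp add: add.assoc sq_integrable_add)
  show "f + g = g + f"
    by transfer (simp add: add.commute sq_integrable_add)
  show "0 + f = f"
    by transfer (simp add: sq_integrable_add)
  show "- f + f = 0"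
    unfolding uminus_l2_torus_def
    by transfer (auto intro: sq_integrable_add sq_integrable_scaleR sq_integrable_zero)
  show "f - g = f + - g"
    by (simp add: minus_l2_torus_def)
  show "a *\<^sub>R (f + g) = a *\<^sub>R f + a *\<^sub>R g"
    by transfer (auto simp: scaleR_add_right intro!: sq_integrable_add sq_integrable_scaleR)
  show "(a + b) *\<^sub>R f = a *\<^sub>R f + b *\<^sub>R f"
    by transfer (auto simp: scaleR_add_left intro!: sq_integrable_add sq_integrable_scaleR)
  show "a *\<^sub>R b *\<^sub>R f = (a * b) *\<^sub>R f"
    by transfer (auto intro: sq_integrable_scaleR)
  show "1 *\<^sub>R f = f"
    by transfer simp
qed

end

instantiation l2_torus :: real_inner
begin

text \<open>The real inner product is the real part of the Hermitian one, so it induces the usual norm.\<close>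

lift_definition inner_l2_torus :: "l2_torus \<Rightarrow> l2_torus \<Rightarrow> real" is
  "\<lambda>f g. \<integral>z. f z \<bullet> g z \<partial>torus_measure"
  by (rule integral_cong_AE) (auto simp: sq_integrable_def)

lift_definition norm_l2_torus :: "l2_torus \<Rightarrow> real" is
  "\<lambda>f. sqrt (\<integral>z. (cmod (f z))\<^sup>2 \<partial>torus_measure)"
  by (rule arg_cong[where f = sqrt], rule integral_cong_AE) (auto simp: sq_integrable_def)

definition sgn_l2_torus :: "l2_torus \<Rightarrow> l2_torus" where
  "sgn_l2_torus f = f /\<^sub>R norm f"

definition dist_l2_torus :: "l2_torus \<Rightarrow> l2_torus \<Rightarrow> real" where
  "dist_l2_torus f g = norm (f - g)"

definition uniformity_l2_torus :: "(l2_torus \<times> l2_torus) filter" where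
  "uniformity_l2_torus = (INF e\<in>{0<..}. principal {(f, g). dist f g < e})"

definition open_l2_torus :: "l2_torus set \<Rightarrow> bool" where
  "open_l2_torus U \<longleftrightarrow> (\<forall>x\<in>U. eventually (\<lambda>(x', y). x' = x \<longrightarrow> y \<in> U) uniformity)"

instance
proof
  fix f g h :: l2_torus and r :: real and U :: "l2_torus set"
  show "sgn f = f /\<^sub>R norm f" by (rule sgn_l2_torus_def)
  show "dist f g = norm (f - g)" by (rule dist_l2_torus_def)
  show "uniformity = (INF e\<in>{0<..}. principal {(f, g :: l2_torus). dist f g < e})"
    by (rule uniformity_l2_torus_def)
  show "open U \<longleftrightarrow> (\<forall>x\<in>U. eventually (\<lambda>(x', y). x' = x \<longrightarrow> y \<in> U) uniformity)"
    by (rule open_l2_torus_def)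
  show "f \<bullet> g = g \<bullet> f"
    by transfer (simp add: inner_commute)
  show "(f + g) \<bullet> h = f \<bullet> h + g \<bullet> h"
    by transfer (simp add: inner_add_left integrable_inner_sq_integrable)
  show "(r *\<^sub>R f) \<bullet> g = r * (f \<bullet> g)"
    by transfer simp
  show "0 \<le> f \<bullet> f"
    by transfer simp
  show "f \<bullet> f = 0 \<longleftrightarrow> f = 0"
  proof transfer
    fix f :: "real \<times> real \<Rightarrow> complex"
    assume "sq_integrable f \<and> sq_integrable f \<and> (AE z in torus_measure. f z = f z)"
    then have f: "sq_integrable f" by simp
    have "(\<integral>z. f z \<bullet> f z \<partial>torus_measure) = 0 \<longleftrightarrow> (AE z in torus_measure. f z \<bullet> f z = 0)"
      by (rule integral_nonneg_eq_0_iff_AE) (auto intro: integrable_inner_sq_integrable f)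
    then show "(\<integral>z. f z \<bullet> f z \<partial>torus_measure) = 0 \<longleftrightarrow>
        sq_integrable f \<and> sq_integrable (\<lambda>_. 0) \<and> (AE z in torus_measure. f z = 0)"
      using f sq_integrable_zero by simp
  qed
  show "norm f = sqrt (f \<bullet> f)"
    by transfer (simp add: power2_norm_eq_inner)
qed

end

definition mode_proj :: "int \<Rightarrow> (real \<times> real \<Rightarrow> complex) \<Rightarrow> real \<times> real \<Rightarrow> complex" where
  "mode_proj k f = (\<lambda>(x, y).
     cis (of_int k * x) * (1 / (2 * pi)) * (\<integral>s. f (s, y) * cis (- of_int k * s) \<partial>circle_measure))"

interpretation circle: finite_measure circle_measure
  by (rule finite_measureI) (simp add: circle_measure_def space_restrict_space emeasure_restrict_space)

interpretation torus: pair_sigma_finite circle_measure circle_measure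
  by (simp add: pair_sigma_finite_def circle.sigma_finite_measure_axioms)

lemma emeasure_circle_space: "emeasure circle_measure (space circle_measure) = ennreal (2 * pi)"
  by (simp add: circle_measure_def space_restrict_space emeasure_restrict_space)

lemma cis_measurable_circle [measurable]: "(\<lambda>s. cis (c * s)) \<in> borel_measurable circle_measure"
  unfolding circle_measure_def
  by (intro measurable_restrict_space1) (auto intro!: borel_measurable_continuous_onI continuous_intros)

lemma sq_integrable_mode_proj:
  assumes f: "sq_integrable f"
  shows "sq_integrable (mode_proj k f)"
proof -
  have m [measurable]: "f \<in> borel_measurable (circle_measure \<Otimes>\<^sub>M circle_measure)"
    using f by (simp add: sq_integrable_def torus_measure_def)
  have meas [measurable]: "mode_proj k f \<in> borel_measurable (circle_measure \<Otimes>\<^sub>M circle_measure)"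
    unfolding mode_proj_def by measurable
  have bound: "ennreal ((cmod (mode_proj k f (x, y)))\<^sup>2)
      \<le> \<integral>\<^sup>+ s. ennreal ((cmod (f (s, y)))\<^sup>2) \<partial>circle_measure" if y: "y \<in> space circle_measure" for x y
  proof -
    let ?I = "\<integral>s. f (s, y) * cis (- of_int k * s) \<partial>circle_measure"
    have fy [measurable]: "(\<lambda>s. f (s, y)) \<in> borel_measurable circle_measure"
      using y by measurable
    have "cmod (mode_proj k f (x, y)) = cmod ?I / (2 * pi)"
      by (simp add: mode_proj_def norm_mult norm_divide)
    then have c: "ennreal ((cmod (mode_proj k f (x, y)))\<^sup>2) = ennreal ((1 / (2 * pi))\<^sup>2) * (ennreal (cmod ?I))\<^sup>2"
      by (simp add: ennreal_power power_divide flip: ennreal_mult)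
    have "ennreal (cmod ?I) \<le> \<integral>\<^sup>+ s. ennreal (cmod (f (s, y) * cis (- of_int k * s))) \<partial>circle_measure"
    proof (cases "integrable circle_measure (\<lambda>s. f (s, y) * cis (- of_int k * s))")
      case True
      then show ?thesis by (rule integral_norm_bound_ennreal)
    next
      case False
      then show ?thesis by (simp add: not_integrable_integral_eq)
    qed
    also have "\<dots> = (\<integral>\<^sup>+ s. ennreal (cmod (f (s, y))) * 1 \<partial>circle_measure)"
      by (simp add: norm_mult)
    finally have "(ennreal (cmod ?I))\<^sup>2 \<le> (\<integral>\<^sup>+ s. ennreal (cmod (f (s, y))) * 1 \<partial>circle_measure)\<^sup>2"
      by (rule power_mono) simp
    also have "\<dots> \<le> (\<integral>\<^sup>+ s. (ennreal (cmod (f (s, y))))\<^sup>2 \<partial>circle_measure) * (\<integral>\<^sup>+ s. 1\<^sup>2 \<partial>circle_measure)"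
      by (rule Cauchy_Schwarz_nn_integral) measurable
    also have "\<dots> = (\<integral>\<^sup>+ s. ennreal ((cmod (f (s, y)))\<^sup>2) \<partial>circle_measure) * ennreal (2 * pi)"
      by (simp add: emeasure_circle_space ennreal_power)
    finally have "ennreal ((1 / (2 * pi))\<^sup>2) * (ennreal (cmod ?I))\<^sup>2
        \<le> ennreal ((1 / (2 * pi))\<^sup>2) *
          ((\<integral>\<^sup>+ s. ennreal ((cmod (f (s, y)))\<^sup>2) \<partial>circle_measure) * ennreal (2 * pi))"
      by (rule mult_left_mono) simp
    also have "\<dots> = ennreal (1 / (2 * pi)) * (\<integral>\<^sup>+ s. ennreal ((cmod (f (s, y)))\<^sup>2) \<partial>circle_measure)"
      by (simp add: mult.commute[of _ "ennreal (2 * pi)"] mult.assoc[symmetric] power2_eq_square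
          flip: ennreal_mult)
    also have "\<dots> \<le> 1 * (\<integral>\<^sup>+ s. ennreal ((cmod (f (s, y)))\<^sup>2) \<partial>circle_measure)"
      using pi_gt3 by (intro mult_right_mono) (auto simp: divide_le_eq)
    finally show ?thesis using c by simp
  qed
  have "(\<integral>\<^sup>+ z. ennreal ((cmod (mode_proj k f z))\<^sup>2) \<partial>torus_measure)
      = (\<integral>\<^sup>+ y. (\<integral>\<^sup>+ x. ennreal ((cmod (mode_proj k f (x, y)))\<^sup>2) \<partial>circle_measure) \<partial>circle_measure)"
    unfolding torus_measure_def
    by (rule torus.nn_integral_snd[symmetric]) measurable
  also have "\<dots> \<le> (\<integral>\<^sup>+ y. (\<integral>\<^sup>+ x. (\<integral>\<^sup>+ s. ennreal ((cmod (f (s, y)))\<^sup>2) \<partial>circle_measure)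
      \<partial>circle_measure) \<partial>circle_measure)"
    by (intro nn_integral_mono bound)
  also have "\<dots> = ennreal (2 * pi) *
      (\<integral>\<^sup>+ y. (\<integral>\<^sup>+ s. ennreal ((cmod (f (s, y)))\<^sup>2) \<partial>circle_measure) \<partial>circle_measure)"
    by (simp add: emeasure_circle_space mult.commute[of _ "ennreal (2 * pi)"] nn_integral_cmult
        del: ennreal_mult)
  also have "\<dots> = ennreal (2 * pi) * (\<integral>\<^sup>+ z. ennreal ((cmod (f z))\<^sup>2) \<partial>torus_measure)"
    unfolding torus_measure_def by (subst torus.nn_integral_snd) measurable
  also have "\<dots> < \<infinity>"
    using f by (auto simp: sq_integrable_def integrable_iff_bounded ennreal_mult_less_top)
  finally have "integrable torus_measure (\<lambda>z. (cmod (mode_proj k f z))\<^sup>2)"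
    using meas by (intro integrableI_bounded) (auto simp: torus_measure_def)
  then show ?thesis
    using meas by (simp add: sq_integrable_def torus_measure_def)
qed

lemma mode_proj_cong_AE:
  assumes f: "sq_integrable f" and g: "sq_integrable g" and eq: "AE z in torus_measure. f z = g z"
  shows "AE z in torus_measure. mode_proj k f z = mode_proj k g z"
proof -
  have [measurable]: "f \<in> borel_measurable (circle_measure \<Otimes>\<^sub>M circle_measure)"
      "g \<in> borel_measurable (circle_measure \<Otimes>\<^sub>M circle_measure)"
    using f g by (simp_all add: sq_integrable_def torus_measure_def)
  have set: "{p \<in> space (circle_measure \<Otimes>\<^sub>M circle_measure). f (fst p, snd p) = g (fst p, snd p)}
      \<in> sets (circle_measure \<Otimes>\<^sub>M circle_measure)"
    by measurable
  have "AE x in circle_measure. AE y in circle_measure. f (x, y) = g (x, y)"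
    using torus.AE_pair[OF eq[unfolded torus_measure_def]] by simp
  then have "AE y in circle_measure. AE x in circle_measure. f (x, y) = g (x, y)"
    using torus.AE_commute[of "\<lambda>x y. f (x, y) = g (x, y)"] set by simp
  then have ae: "AE y in circle_measure. \<forall>x. mode_proj k f (x, y) = mode_proj k g (x, y)"
  proof (rule AE_mp, intro AE_I2 impI allI)
    fix x y
    assume [measurable]: "y \<in> space circle_measure"
      and *: "AE s in circle_measure. f (s, y) = g (s, y)"
    have "(\<integral>s. f (s, y) * cis (- of_int k * s) \<partial>circle_measure)
        = (\<integral>s. g (s, y) * cis (- of_int k * s) \<partial>circle_measure)"
    proof (rule integral_cong_AE)
      show "AE s in circle_measure. f (s, y) * cis (- of_int k * s) = g (s, y) * cis (- of_int k * s)"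
        using * by eventually_elim simp
    qed measurable
    then show "mode_proj k f (x, y) = mode_proj k g (x, y)"
      by (simp add: mode_proj_def)
  qed
  have [measurable]: "mode_proj k f \<in> borel_measurable (circle_measure \<Otimes>\<^sub>M circle_measure)"
      "mode_proj k g \<in> borel_measurable (circle_measure \<Otimes>\<^sub>M circle_measure)"
    using sq_integrable_mode_proj[OF f] sq_integrable_mode_proj[OF g]
    by (simp_all add: sq_integrable_def torus_measure_def)
  show ?thesis
    unfolding torus_measure_def
  proof (rule torus.AE_pair_measure)
    show "{z \<in> space (circle_measure \<Otimes>\<^sub>M circle_measure). mode_proj k f z = mode_proj k g z}
        \<in> sets (circle_measure \<Otimes>\<^sub>M circle_measure)"
      by measurable
    show "AE x in circle_measure. AE y in circle_measure. mode_proj k f (x, y) = mode_proj k g (x, y)"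
      by (rule AE_I2, rule eventually_mono[OF ae]) blast
  qed
qed

lift_definition fourier_proj :: "int \<Rightarrow> l2_torus \<Rightarrow> l2_torus" is mode_proj
  using sq_integrable_mode_proj mode_proj_cong_AE by blast

text \<open>A semigroup is a family indexed by the reals of which only the values \<open>S t\<close> for \<open>t \<ge> 0\<close> matter.\<close>

definition C0_semigroup :: "(real \<Rightarrow> 'a \<Rightarrow> 'a :: real_normed_vector) \<Rightarrow> bool" where
  "C0_semigroup S \<longleftrightarrow>
     (\<forall>t\<ge>0. bounded_linear (S t)) \<and>
     S 0 = id \<and>
     (\<forall>s\<ge>0. \<forall>t\<ge>0. S (s + t) = S s \<circ> S t) \<and>
     (\<forall>f. ((\<lambda>t. S t f) \<longlongrightarrow> f) (at_right 0))"

definition generator :: "(real \<Rightarrow> 'a \<Rightarrow> 'a :: real_normed_vector) \<Rightarrow> ('a \<times> 'a) set" where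
  "generator S = {(f, g). ((\<lambda>h. (S h f - f) /\<^sub>R h) \<longlongrightarrow> g) (at_right 0)}"

definition partial_x :: "(real \<times> real \<Rightarrow> complex) \<Rightarrow> real \<times> real \<Rightarrow> complex" where
  "partial_x \<phi> = (\<lambda>(x, y). vector_derivative (\<lambda>s. \<phi> (s, y)) (at x))"

definition partial_y :: "(real \<times> real \<Rightarrow> complex) \<Rightarrow> real \<times> real \<Rightarrow> complex" where
  "partial_y \<phi> = (\<lambda>(x, y). vector_derivative (\<lambda>s. \<phi> (x, s)) (at y))"

primrec Ck :: "nat \<Rightarrow> (real \<times> real \<Rightarrow> complex) \<Rightarrow> bool" where
  "Ck 0 = (\<lambda>\<phi>. continuous_on UNIV \<phi>)"
| "Ck (Suc n) = (\<lambda>\<phi>. continuous_on UNIV \<phi> \<and>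
     (\<forall>x y. (\<lambda>s. \<phi> (s, y)) differentiable at x \<and> (\<lambda>s. \<phi> (x, s)) differentiable at y) \<and>
     Ck n (partial_x \<phi>) \<and> Ck n (partial_y \<phi>))"

definition torus_test_function :: "(real \<times> real \<Rightarrow> complex) \<Rightarrow> bool" where
  "torus_test_function \<phi> \<longleftrightarrow> (\<forall>n. Ck n \<phi>) \<and>
     (\<forall>x y. \<phi> (x + 2 * pi, y) = \<phi> (x, y) \<and> \<phi> (x, y + 2 * pi) = \<phi> (x, y))"

text \<open>
  The graph of \<open>f \<mapsto> a \<partial>\<^sub>x\<^sub>x f + b \<partial>\<^sub>y\<^sub>y f - u(y) \<partial>\<^sub>x f\<close> as an unbounded operator with its maximal
  domain: all square integrable \<open>f\<close> for which this expression, taken in the sense of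
  distributions on the torus, is a square integrable function \<open>g\<close>. Since \<open>u\<close> depends on \<open>y\<close>
  only, integrating by parts moves the drift onto the test function as \<open>+ u(y) \<partial>\<^sub>x \<phi>\<close>.
  For \<open>a, b > 0\<close> and bounded \<open>u\<close> this domain is \<open>H\<^sup>2\<close> of the torus; for \<open>a = 0 < b\<close> each
  Fourier mode in \<open>x\<close> of a function in the domain is \<open>H\<^sup>2\<close> in \<open>y\<close>.
\<close>

definition drift_diffusion :: "real \<Rightarrow> real \<Rightarrow> (real \<Rightarrow> real) \<Rightarrow> (l2_torus \<times> l2_torus) set" where
  "drift_diffusion a b u = {(f, g). \<forall>\<phi>. torus_test_function \<phi> \<longrightarrow>
     (\<integral>z. rep_l2_torus g z * \<phi> z \<partial>torus_measure) =
     (\<integral>z. rep_l2_torus f z *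
        (of_real a * partial_x (partial_x \<phi>) z + of_real b * partial_y (partial_y \<phi>) z + of_real (u (snd z)) * partial_x \<phi> z)
      \<partial>torus_measure)}"

definition full_diffusion_semigroup ::
    "real \<Rightarrow> (real \<Rightarrow> real) \<Rightarrow> (real \<Rightarrow> l2_torus \<Rightarrow> l2_torus) \<Rightarrow> bool" where
  "full_diffusion_semigroup \<nu> u S \<longleftrightarrow> C0_semigroup S \<and> generator S = drift_diffusion \<nu> \<nu> u"

definition y_diffusion_semigroup ::
    "real \<Rightarrow> (real \<Rightarrow> real) \<Rightarrow> (real \<Rightarrow> l2_torus \<Rightarrow> l2_torus) \<Rightarrow> bool" where
  "y_diffusion_semigroup \<nu> u R \<longleftrightarrow> C0_semigroup R \<and> generator R = drift_diffusion 0 \<nu> u"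

definition primitive :: "(real \<Rightarrow> real) \<Rightarrow> real \<Rightarrow> real" where
  "primitive u = (SOME \<psi>. \<forall>y. (\<psi> has_real_derivative u y) (at y))"

definition omega1 :: "real \<Rightarrow> (real \<Rightarrow> real) \<Rightarrow> real" where
  "omega1 \<delta> u = (INF (x, c1, c2) \<in> UNIV.
     integral {x - \<delta>..x + \<delta>} (\<lambda>y. \<bar>primitive u y - c1 - c2 * y\<bar>\<^sup>2))"

text \<open>The choice of the primitive is immaterial.\<close>

lemma omega1_eq:
  assumes "\<forall>y. (\<psi> has_real_derivative u y) (at y)"
  shows "omega1 \<delta> u = (INF (x, c1, c2) \<in> UNIV.
     integral {x - \<delta>..x + \<delta>} (\<lambda>y. \<bar>\<psi> y - c1 - c2 * y\<bar>\<^sup>2))"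
proof -
  have p: "\<forall>y. (primitive u has_real_derivative u y) (at y)"
    unfolding primitive_def by (rule someI[of _ \<psi>]) (rule assms)
  have "((\<lambda>y. primitive u y - \<psi> y) has_real_derivative 0) (at y)" for y
    using DERIV_diff[OF p[rule_format, of y] assms[rule_format, of y]] by simp
  then have "\<exists>c. \<forall>y. primitive u y - \<psi> y = c"
    by (metis DERIV_isconst_all)
  then obtain c where "\<forall>y. primitive u y - \<psi> y = c" ..
  then have c: "primitive u y = \<psi> y + c" for y
    by (simp add: algebra_simps)
  define F where "F = (\<lambda>(x, c1, c2). integral {x - \<delta>..x + \<delta>} (\<lambda>y. \<bar>\<psi> y - c1 - c2 * y\<bar>\<^sup>2))"
  define T where "T = (\<lambda>(x :: real, c1, c2 :: real). (x, c1 - c, c2))"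
  have surj: "range T = UNIV"
    by (rule surjI[of _ "\<lambda>(x, c1, c2). (x, c1 + c, c2)"]) (auto simp: T_def)
  have "(case z of (x, c1, c2) \<Rightarrow> integral {x - \<delta>..x + \<delta>} (\<lambda>y. \<bar>primitive u y - c1 - c2 * y\<bar>\<^sup>2)) = F (T z)" for z
    by (simp add: F_def T_def c split_beta algebra_simps)
  then have "omega1 \<delta> u = Inf (range (\<lambda>z. F (T z)))"
    unfolding omega1_def by simp
  also have "range (\<lambda>z. F (T z)) = F ` range T"
    by (simp only: image_image)
  finally show ?thesis by (simp only: surj F_def)
qed

end

(*
  Fix a Fourier mode k. The operator is accretive, and the semigroup decays at rate Psi as soon as
  |(z + L) W| >= Psi |W| whenever Re z >= 0 (Gearhart-Pruess). For the resolvent bound let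
  R = i (k u + s) W - nu W'' with s real, let Phi be a primitive of k u + s with mean zero on an
  interval I of length 2 delta, and put G = Phi W + i nu W'. Then G' = - i R + Phi W', so G is almost
  constant on I, and so is Phi W(x) for every x in I. As the L2 norm of Phi on I is at least
  |k| omega1(delta)^(1/2), this bounds W on I by R and W'. With delta^(alpha + 2) = nu / |k| the
  energy identity nu |W'|^2 <= |R| |W| closes the estimate with Psi proportional to lam.

  The passage from the resolvent to the semigroup replaces the Fourier transform in time by the
  discrete one: the cut-off orbit at the times n h solves the implicit Euler scheme with a small
  error, its symbol (1 - w) / h has nonnegative real part, and Parseval on Z/N suffices.
*)

theory Submission
  imports Defs
begin

section \<open>Local resolvent estimate\<close>

text \<open>The semigroups are given only through their generators, distributional operators with
  maximal domain. The estimate for smooth \<open>W\<close> must therefore be carried over to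
  abstract pairs in the graph: the Fourier series in \<open>y\<close> is truncated, and the
  commutator of the truncation with \<open>u\<close> vanishes in the limit. This is what the density
  of trigonometric polynomials is for. Completeness of \<open>l2_torus\<close> enters through
  uniform boundedness, because a \<open>C0_semigroup\<close> is not assumed bounded near time 0. The
  resulting bound serves only to differentiate orbits and never reaches the final constants; these
  are uniform in \<open>\<nu>\<close> and \<open>k\<close> because the norm of each Fourier mode is
  nonincreasing in time. The scale \<open>\<delta>\<close> is the one at which diffusion and mixing
  act at the same rate: \<open>lam\<close> equals both \<open>\<nu> / \<delta>\<^sup>2\<close> and
  \<open>\<bar>\<kappa>\<bar> * \<delta> powr \<alpha>\<close>. The condition on
  \<open>\<nu> / \<bar>\<kappa>\<bar>\<close> keeps \<open>\<delta>\<close> below 1. Discrete time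
  has the advantage that the transform is a finite sum, so it maps the graph of the generator into
  itself by linearity alone.\<close>

lemma integral_Cauchy_Schwarz:
  fixes f g :: "real \<Rightarrow> real"
  assumes f: "continuous_on {a..b} f" and g: "continuous_on {a..b} g"
  shows "(integral {a..b} (\<lambda>x. f x * g x))\<^sup>2 \<le> integral {a..b} (\<lambda>x. (f x)\<^sup>2) * integral {a..b} (\<lambda>x. (g x)\<^sup>2)"
proof -
  define A B C where "A = integral {a..b} (\<lambda>x. (f x)\<^sup>2)" and "B = integral {a..b} (\<lambda>x. f x * g x)"
    and "C = integral {a..b} (\<lambda>x. (g x)\<^sup>2)"
  have q: "0 \<le> s\<^sup>2 * A - 2 * s * t * B + t\<^sup>2 * C" for s t
  proof -
    have "((\<lambda>x. s\<^sup>2 * (f x)\<^sup>2 - 2 * s * t * (f x * g x) + t\<^sup>2 * (g x)\<^sup>2) has_integral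
        (s\<^sup>2 * A - 2 * s * t * B + t\<^sup>2 * C)) {a..b}"
      unfolding A_def B_def C_def
      by (intro has_integral_add has_integral_diff has_integral_mult_right integrable_integral
          integrable_continuous_interval continuous_intros f g)
    then show ?thesis
    proof (rule has_integral_nonneg)
      fix x
      have "s\<^sup>2 * (f x)\<^sup>2 - 2 * s * t * (f x * g x) + t\<^sup>2 * (g x)\<^sup>2 = (s * f x - t * g x)\<^sup>2"
        by (simp add: power2_eq_square algebra_simps)
      then show "0 \<le> s\<^sup>2 * (f x)\<^sup>2 - 2 * s * t * (f x * g x) + t\<^sup>2 * (g x)\<^sup>2" by simp
    qed
  qed
  have C0: "C \<ge> 0"
    unfolding C_def by (intro integral_nonneg integrable_continuous_interval continuous_intros g) auto
  show ?thesis
  proof (cases "C = 0")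
    case True
    have "B = 0"
    proof (rule ccontr)
      assume "B \<noteq> 0"
      \<comment> \<open>With \<open>C = 0\<close> and \<open>s = 1\<close> the form is
        \<open>A - 2 * t * B\<close>; this \<open>t\<close> makes it equal to -1.\<close>
      then show False using q[of 1 "(A + 1) / (2 * B)"] True by (simp add: field_simps)
    qed
    then show ?thesis using True A_def B_def C_def by simp
  next
    case False
    have "0 \<le> C * (A * C - B\<^sup>2)"
      using q[of C B] by (simp add: power2_eq_square algebra_simps)
    then show ?thesis using False C0 by (simp add: zero_le_mult_iff A_def B_def C_def)
  qed
qed

lemma norm_diff_le_integral_norm_derivative:
  fixes G :: "real \<Rightarrow> 'a :: banach"
  assumes d: "\<And>y. y \<in> {a..b} \<Longrightarrow> (G has_vector_derivative G' y) (at y)"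
    and c: "continuous_on {a..b} G'" and x: "x \<in> {a..b}" and y: "y \<in> {a..b}"
  shows "norm (G y - G x) \<le> integral {a..b} (\<lambda>s. norm (G' s))"
proof -
  have le: "norm (G t - G s) \<le> integral {a..b} (\<lambda>s. norm (G' s))"
    if "s \<in> {a..b}" "t \<in> {a..b}" "s \<le> t" for s t
  proof -
    have sub: "{s..t} \<subseteq> {a..b}" using that by auto
    have i: "(G' has_integral (G t - G s)) {s..t}"
      by (rule fundamental_theorem_of_calculus[OF \<open>s \<le> t\<close>])
        (blast intro: has_vector_derivative_at_within[OF d] subsetD[OF sub])
    have "norm (integral {s..t} G') \<le> integral {s..t} (\<lambda>s. norm (G' s))"
      by (rule integral_norm_bound_integral)
        (auto intro!: integrable_continuous_interval continuous_intros continuous_on_subset[OF c sub])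
    also have "\<dots> \<le> integral {a..b} (\<lambda>s. norm (G' s))"
      by (rule integral_subset_le[OF sub])
        (auto intro!: integrable_continuous_interval continuous_intros continuous_on_subset[OF c sub] c)
    finally show ?thesis using integral_unique[OF i] by simp
  qed
  show ?thesis
  proof (cases "x \<le> y")
    case True
    then show ?thesis using le x y by blast
  next
    case False
    then show ?thesis using le[OF y x] by (simp add: norm_minus_commute)
  qed
qed

lemma cauchy_schwarz_norm:
  fixes f :: "real \<Rightarrow> 'a :: real_normed_vector"
  assumes "continuous_on {a..b} f" and "a \<le> b"
  shows "(integral {a..b} (\<lambda>y. norm (f y)))\<^sup>2 \<le> (b - a) * integral {a..b} (\<lambda>y. (norm (f y))\<^sup>2)"
  using integral_Cauchy_Schwarz[of a b "\<lambda>_. 1" "\<lambda>y. norm (f y)"] assms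
  by (simp add: continuous_intros)

lemma sum3_square_le: "(norm (x + y + z :: 'a :: real_normed_vector))\<^sup>2 \<le> 3 * ((norm x)\<^sup>2 + (norm y)\<^sup>2 + (norm z)\<^sup>2)"
proof -
  have "norm (x + y + z) \<le> norm x + norm y + norm z"
    by (metis norm_triangle_mono norm_triangle_ineq order_refl)
  then have "(norm (x + y + z))\<^sup>2 \<le> (norm x + norm y + norm z)\<^sup>2"
    by (simp add: power_mono)
  also have "\<dots> \<le> 3 * ((norm x)\<^sup>2 + (norm y)\<^sup>2 + (norm z)\<^sup>2)"
    using sum_squares_bound[of "norm x" "norm y"] sum_squares_bound[of "norm x" "norm z"]
      sum_squares_bound[of "norm y" "norm z"]
    by (simp add: power2_eq_square algebra_simps)
  finally show ?thesis .
qed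

text \<open>Mean zero makes \<open>\<Phi>\<close> orthogonal to constants. With
  \<open>w = W x\<close> and \<open>g = G x\<close>, the squared norm of
  \<open>\<Phi> * w - g\<close> on the interval is therefore
  \<open>M * (cmod w)\<^sup>2 + (b - a) * (cmod g)\<^sup>2\<close>, and \<open>w\<close> is
  controlled although nothing is known about the size of \<open>g\<close>.\<close>

lemma local_resolvent_estimate:
  fixes W W' W'' R :: "real \<Rightarrow> complex" and \<Phi> q :: "real \<Rightarrow> real"
  assumes W: "\<And>y. (W has_vector_derivative W' y) (at y)"
    and W': "\<And>y. (W' has_vector_derivative W'' y) (at y)"
    and cW'': "continuous_on UNIV W''"
    and \<Phi>: "\<And>y. (\<Phi> has_real_derivative q y) (at y)" and cq: "continuous_on UNIV q"
    and R: "\<And>y. R y = \<i> * of_real (q y) * W y - of_real \<nu> * W'' y"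
    and ab: "a \<le> b" and mean: "integral {a..b} \<Phi> = 0" and x: "x \<in> {a..b}"
  defines "M \<equiv> integral {a..b} (\<lambda>y. (\<Phi> y)\<^sup>2)" and "D \<equiv> integral {a..b} (\<lambda>y. (cmod (W' y))\<^sup>2)"
    and "E \<equiv> integral {a..b} (\<lambda>y. (cmod (R y))\<^sup>2)"
  shows "M * (cmod (W x))\<^sup>2 \<le> 6 * (b - a)\<^sup>2 * E + (9 * (b - a) * M + 3 * \<nu>\<^sup>2) * D"
proof -
  define l where "l = b - a"
  have l: "l \<ge> 0" using ab by (simp add: l_def)
  have cW: "continuous_on T W" and cW': "continuous_on T W'" and c\<Phi>: "continuous_on T \<Phi>" for T
    by (rule continuous_at_imp_continuous_on, blast intro: has_vector_derivative_continuous DERIV_isCont W W' \<Phi>)+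
  have cW''2: "continuous_on T W''" and cq2: "continuous_on T q" for T
    using cW'' cq continuous_on_subset by blast+
  have cR: "continuous_on T R" for T
    unfolding R by (intro continuous_intros cW cW''2 cq2)
  note c = cW cW' cW''2 c\<Phi> cq2 cR
  define G where "G y = of_real (\<Phi> y) * W y + \<i> * of_real \<nu> * W' y" for y
  define G' where "G' y = - \<i> * R y + of_real (\<Phi> y) * W' y" for y
  have G: "(G has_vector_derivative G' y) (at y)" for y
  proof -
    have "((\<lambda>y. of_real (\<Phi> y) :: complex) has_vector_derivative of_real (q y)) (at y)"
      using \<Phi> by (simp add: has_real_derivative_iff_has_vector_derivative has_vector_derivative_of_real)
    from has_vector_derivative_add[OF has_vector_derivative_mult[OF this W]
        has_vector_derivative_mult_right[OF W', of "\<i> * of_real \<nu>"]]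
    have "(G has_vector_derivative (of_real (\<Phi> y) * W' y + of_real (q y) * W y + \<i> * of_real \<nu> * W'' y)) (at y)"
      unfolding G_def[abs_def] by simp
    also have "of_real (\<Phi> y) * W' y + of_real (q y) * W y + \<i> * of_real \<nu> * W'' y = G' y"
      by (simp add: G'_def R algebra_simps)
    finally show ?thesis .
  qed
  have cG': "continuous_on T G'" for T unfolding G'_def by (intro continuous_intros c)
  have nn: "M \<ge> 0" "D \<ge> 0" "E \<ge> 0"
    unfolding M_def D_def E_def by (auto intro!: integral_nonneg integrable_continuous_interval continuous_intros c)
  have A: "(cmod (G y - G x))\<^sup>2 \<le> 2 * (l * E + M * D)" if y: "y \<in> {a..b}" for y
  proof -
    have "cmod (G y - G x) \<le> integral {a..b} (\<lambda>s. cmod (G' s))"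
      by (rule norm_diff_le_integral_norm_derivative[OF G cG' x y])
    also have "\<dots> \<le> integral {a..b} (\<lambda>s. cmod (R s) + \<bar>\<Phi> s\<bar> * cmod (W' s))"
    proof (rule integral_le)
      show "cmod (G' s) \<le> cmod (R s) + \<bar>\<Phi> s\<bar> * cmod (W' s)" for s
        unfolding G'_def by (rule order_trans[OF norm_triangle_ineq]) (simp add: norm_mult)
    qed (auto intro!: integrable_continuous_interval continuous_intros c cG')
    also have "\<dots> = integral {a..b} (\<lambda>s. cmod (R s)) + integral {a..b} (\<lambda>s. \<bar>\<Phi> s\<bar> * cmod (W' s))"
      by (rule integral_add) (auto intro!: integrable_continuous_interval continuous_intros c)
    finally have "cmod (G y - G x) \<le> integral {a..b} (\<lambda>s. cmod (R s)) + integral {a..b} (\<lambda>s. \<bar>\<Phi> s\<bar> * cmod (W' s))" .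
    then have "(cmod (G y - G x))\<^sup>2 \<le> (integral {a..b} (\<lambda>s. cmod (R s)) + integral {a..b} (\<lambda>s. \<bar>\<Phi> s\<bar> * cmod (W' s)))\<^sup>2"
      by (simp add: power_mono)
    also have "\<dots> \<le> 2 * ((integral {a..b} (\<lambda>s. cmod (R s)))\<^sup>2 + (integral {a..b} (\<lambda>s. \<bar>\<Phi> s\<bar> * cmod (W' s)))\<^sup>2)"
      using sum_squares_bound[of "integral {a..b} (\<lambda>s. cmod (R s))" "integral {a..b} (\<lambda>s. \<bar>\<Phi> s\<bar> * cmod (W' s))"]
      by (simp add: power2_eq_square algebra_simps)
    also have "(integral {a..b} (\<lambda>s. cmod (R s)))\<^sup>2 \<le> l * E"
      unfolding l_def E_def by (rule cauchy_schwarz_norm[OF c(6) ab])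
    also have "(integral {a..b} (\<lambda>s. \<bar>\<Phi> s\<bar> * cmod (W' s)))\<^sup>2 \<le> M * D"
      using integral_Cauchy_Schwarz[of a b "\<lambda>s. \<bar>\<Phi> s\<bar>" "\<lambda>s. cmod (W' s)"]
      unfolding M_def D_def by (simp add: continuous_intros c)
    finally show ?thesis by simp
  qed
  have B: "(cmod (W y - W x))\<^sup>2 \<le> l * D" if y: "y \<in> {a..b}" for y
  proof -
    have "(cmod (W y - W x))\<^sup>2 \<le> (integral {a..b} (\<lambda>s. cmod (W' s)))\<^sup>2"
      using norm_diff_le_integral_norm_derivative[OF W c(2) x y] by (simp add: power_mono)
    also have "\<dots> \<le> l * D" unfolding l_def D_def by (rule cauchy_schwarz_norm[OF c(2) ab])
    finally show ?thesis .
  qed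
  define g where "g = G x"
  define w where "w = W x"
  have up: "(cmod (of_real (\<Phi> y) * w - g))\<^sup>2 \<le> 6 * (l * E + M * D) + 3 * l * D * (\<Phi> y)\<^sup>2 + 3 * \<nu>\<^sup>2 * (cmod (W' y))\<^sup>2"
    if y: "y \<in> {a..b}" for y
  proof -
    \<comment> \<open>Three errors: the oscillation of \<open>G\<close>, the oscillation of
      \<open>W\<close>, and the diffusive part of \<open>G\<close>. The 3 of
      \<open>sum3_square_le\<close> times the 2 in \<open>A\<close> gives the 6 of the
      statement.\<close>
    have eq: "of_real (\<Phi> y) * w - g = (G y - G x) + (- (of_real (\<Phi> y) * (W y - W x))) + (- (\<i> * of_real \<nu> * W' y))"
      by (simp add: G_def g_def w_def algebra_simps)
    have "(cmod (of_real (\<Phi> y) * w - g))\<^sup>2 \<le> 3 * ((cmod (G y - G x))\<^sup>2 + (\<Phi> y)\<^sup>2 * (cmod (W y - W x))\<^sup>2 + \<nu>\<^sup>2 * (cmod (W' y))\<^sup>2)"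
      unfolding eq by (rule order_trans[OF sum3_square_le]) (simp add: norm_mult power_mult_distrib)
    also have "\<dots> \<le> 3 * (2 * (l * E + M * D) + (\<Phi> y)\<^sup>2 * (l * D) + \<nu>\<^sup>2 * (cmod (W' y))\<^sup>2)"
      using A[OF y] mult_left_mono[OF B[OF y], of "(\<Phi> y)\<^sup>2"] by simp
    finally show ?thesis by (simp add: algebra_simps)
  qed
  have expand: "(cmod (of_real (\<Phi> y) * w - g))\<^sup>2 = (cmod w)\<^sup>2 * (\<Phi> y)\<^sup>2 - 2 * (w \<bullet> g) * \<Phi> y + (cmod g)\<^sup>2" for y
    unfolding cmod_power2 inner_complex_def by (simp add: power2_eq_square algebra_simps)
  have I1: "((\<lambda>y. (cmod (of_real (\<Phi> y) * w - g))\<^sup>2) has_integral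
      ((cmod w)\<^sup>2 * M - 2 * (w \<bullet> g) * 0 + l * (cmod g)\<^sup>2)) {a..b}"
    unfolding expand
    using has_integral_const_real[of "(cmod g)\<^sup>2" a b] ab
    unfolding M_def mean[symmetric] l_def
    by (intro has_integral_add has_integral_diff has_integral_mult_right integrable_integral
          integrable_continuous_interval continuous_intros c) (simp add: content_real)
  have I2: "((\<lambda>y. 6 * (l * E + M * D) + 3 * l * D * (\<Phi> y)\<^sup>2 + 3 * \<nu>\<^sup>2 * (cmod (W' y))\<^sup>2) has_integral
      (l * (6 * (l * E + M * D)) + 3 * l * D * M + 3 * \<nu>\<^sup>2 * D)) {a..b}"
    using has_integral_const_real[of "6 * (l * E + M * D)" a b] ab
    by (intro has_integral_add has_integral_diff has_integral_mult_right)
      (auto simp: content_real M_def D_def l_def intro!: integrable_integral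
          integrable_continuous_interval continuous_intros c)
  have "(cmod w)\<^sup>2 * M + l * (cmod g)\<^sup>2 \<le> l * (6 * (l * E + M * D)) + 3 * l * D * M + 3 * \<nu>\<^sup>2 * D"
    using has_integral_le[OF I1 I2] up by simp
  moreover have "l * (cmod g)\<^sup>2 \<ge> 0" using l by simp
  ultimately have "(cmod w)\<^sup>2 * M \<le> l * (6 * (l * E + M * D)) + 3 * l * D * M + 3 * \<nu>\<^sup>2 * D" by linarith
  then show ?thesis
    by (simp add: w_def l_def[symmetric] power2_eq_square algebra_simps)
qed

section \<open>Resolvent estimate on the circle\<close>

text \<open>Windows of length \<open>l\<close> are laid side by side until they cover a period. As
  \<open>l\<close> need not divide \<open>p\<close>, the last one overshoots, but by no more than
  one period; periodicity of \<open>h\<close> turns this into the factor 2.\<close>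

lemma integral_periodic_cover:
  fixes f h :: "real \<Rightarrow> real"
  assumes f: "continuous_on UNIV f" "\<And>y. f y \<ge> 0" and h: "continuous_on UNIV h" "\<And>y. h y \<ge> 0"
    and per: "\<And>y. h (y + p) = h y" and l: "0 < l" "l \<le> p"
    and loc: "\<And>a. integral {a..a + l} f \<le> integral {a..a + l} h"
  shows "integral {0..p} f \<le> 2 * integral {0..p} h"
proof -
  have int: "f integrable_on {a..b}" "h integrable_on {a..b}" for a b
    using continuous_on_subset[OF f(1)] continuous_on_subset[OF h(1)]
    by (auto intro!: integrable_continuous_interval)
  have iter: "integral {0..real n * l} f \<le> integral {0..real n * l} h" for n
  proof (induction n)
    case (Suc n)
    have "integral {0..real n * l} g + integral {real n * l..real n * l + l} g = integral {0..real (Suc n) * l} g"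
      if "\<And>a b. g integrable_on {a..b}" for g :: "real \<Rightarrow> real"
      using Henstock_Kurzweil_Integration.integral_combine[of 0 "real n * l" "real n * l + l" g] that l
      by (simp add: algebra_simps)
    from this[OF int(1)] this[OF int(2)] Suc loc[of "real n * l"] show ?case by linarith
  qed simp
  define n where "n = nat \<lceil>p / l\<rceil>"
  have "p / l \<ge> 0" using l by simp
  then have "p / l \<le> real n" "real n < p / l + 1" unfolding n_def by linarith+
  then have n: "p \<le> real n * l" "real n * l \<le> 2 * p"
    using l by (simp_all add: field_simps)
  have "integral {0..p} f \<le> integral {0..real n * l} f"
    by (rule integral_subset_le) (use n int f in auto)
  also have "\<dots> \<le> integral {0..real n * l} h" by (rule iter)
  also have "\<dots> \<le> integral {0..2 * p} h"
    by (rule integral_subset_le) (use n int h in auto)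
  also have "\<dots> = integral {0..p} h + integral {p..2 * p} h"
    using Henstock_Kurzweil_Integration.integral_combine[of 0 p "2 * p" h] l int by simp
  also have "integral {p..2 * p} h = integral {0..p} h"
    using integral_shift[of 0 p p h] continuous_on_subset[OF h(1)] per by (simp add: o_def)
  finally show ?thesis by simp
qed

text \<open>The derivative of \<open>W' \<bullet> W\<close> integrates to zero over a period. The
  drift drops out because \<open>\<i> * q * W\<close> is pointwise orthogonal to \<open>W\<close> in
  the real inner product.\<close>

lemma periodic_energy_identity:
  fixes W W' W'' :: "real \<Rightarrow> complex" and q :: "real \<Rightarrow> real"
  assumes W: "\<And>y. (W has_vector_derivative W' y) (at y)"
    and W': "\<And>y. (W' has_vector_derivative W'' y) (at y)"
    and cW'': "continuous_on UNIV W''" and cq: "continuous_on UNIV q"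
    and per: "W b = W a" "W' b = W' a" and ab: "a \<le> b"
  shows "integral {a..b} (\<lambda>y. (\<i> * of_real (q y) * W y - of_real \<nu> * W'' y) \<bullet> W y)
    = \<nu> * integral {a..b} (\<lambda>y. (cmod (W' y))\<^sup>2)"
proof -
  have cW: "continuous_on T W" and cW': "continuous_on T W'" for T
    by (rule continuous_at_imp_continuous_on, blast intro: has_vector_derivative_continuous W W')+
  have cW''2: "continuous_on T W''" for T
    using cW'' continuous_on_subset by blast
  have "((\<lambda>y. W' y \<bullet> W y) has_vector_derivative (W' y \<bullet> W' y + W'' y \<bullet> W y)) (at y)" for y
    by (rule bounded_bilinear.has_vector_derivative[OF bounded_bilinear_inner W' W])
  then have "((\<lambda>y. W' y \<bullet> W' y + W'' y \<bullet> W y) has_integral (W' b \<bullet> W b - W' a \<bullet> W a)) {a..b}"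
    by (intro fundamental_theorem_of_calculus ab) (blast intro: has_vector_derivative_at_within)
  then have I: "((\<lambda>y. W' y \<bullet> W' y + W'' y \<bullet> W y) has_integral 0) {a..b}" using per by simp
  have I2: "((\<lambda>y. \<nu> * (W' y \<bullet> W' y)) has_integral (\<nu> * integral {a..b} (\<lambda>y. (cmod (W' y))\<^sup>2))) {a..b}"
    unfolding power2_norm_eq_inner
    by (intro has_integral_mult_right integrable_integral integrable_continuous_interval continuous_intros cW')
  have "(\<i> * of_real (q y) * W y - of_real \<nu> * W'' y) \<bullet> W y
      = \<nu> * (W' y \<bullet> W' y) - \<nu> * (W' y \<bullet> W' y + W'' y \<bullet> W y)" for y
    by (simp add: inner_complex_def algebra_simps)
  then show ?thesis
    using has_integral_diff[OF I2 has_integral_mult_right[OF I, of \<nu>]] by (simp add: integral_unique)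
qed

lemma exists_primitive:
  assumes "continuous_on UNIV (u :: real \<Rightarrow> real)"
  shows "\<exists>\<psi>. \<forall>y. (\<psi> has_real_derivative u y) (at y)"
  using einterval_antiderivative[of "-\<infinity>" "\<infinity>" u] assms
  by (auto simp: has_real_derivative_iff_has_vector_derivative continuous_on_eq_continuous_at)

lemma omega1_le:
  assumes "\<And>y. (\<psi> has_real_derivative u y) (at y)"
  shows "omega1 \<delta> u \<le> integral {x - \<delta>..x + \<delta>} (\<lambda>y. (\<psi> y - c1 - c2 * y)\<^sup>2)"
proof -
  have "omega1 \<delta> u \<le> (case (x, c1, c2) of (x, c1, c2) \<Rightarrow> integral {x - \<delta>..x + \<delta>} (\<lambda>y. \<bar>\<psi> y - c1 - c2 * y\<bar>\<^sup>2))"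
    unfolding omega1_eq[of \<psi> u, OF allI[OF assms]]
  proof (rule cINF_lower)
    have c: "continuous_on T \<psi>" for T
      by (rule continuous_at_imp_continuous_on, blast intro: DERIV_isCont assms)
    have "0 \<le> integral {x - \<delta>..x + \<delta>} (\<lambda>y. \<bar>\<psi> y - c1 - c2 * y\<bar>\<^sup>2)" for x c1 c2
      by (rule integral_nonneg) (auto intro!: integrable_continuous_interval continuous_intros c)
    then show "bdd_below (range (\<lambda>(x, c1, c2). integral {x - \<delta>..x + \<delta>} (\<lambda>y. \<bar>\<psi> y - c1 - c2 * y\<bar>\<^sup>2)))"
      by (intro bdd_belowI2[of _ 0]) auto
  qed simp
  then show ?thesis by simp
qed

text \<open>The derivatives are arguments so that trigonometric polynomials can supply them
  explicitly. Periodicity of \<open>W''\<close> is included because it enters the residual, which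
  must be periodic for \<open>integral_periodic_cover\<close>.\<close>

definition C2_periodic :: "(real \<Rightarrow> complex) \<Rightarrow> (real \<Rightarrow> complex) \<Rightarrow> (real \<Rightarrow> complex) \<Rightarrow> bool" where
  "C2_periodic W W' W'' \<longleftrightarrow> (\<forall>y. (W has_vector_derivative W' y) (at y)) \<and>
     (\<forall>y. (W' has_vector_derivative W'' y) (at y)) \<and> continuous_on UNIV W'' \<and>
     (\<forall>y. W (y + 2 * pi) = W y) \<and> (\<forall>y. W' (y + 2 * pi) = W' y) \<and> (\<forall>y. W'' (y + 2 * pi) = W'' y)"

abbreviation l2sq :: "(real \<Rightarrow> complex) \<Rightarrow> real" where
  "l2sq f \<equiv> integral {0..2*pi} (\<lambda>y. (cmod (f y))\<^sup>2)"

text \<open>With \<open>\<kappa> = k\<close> this is \<open>z + R_{k,\<nu>}\<close> of the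
  statement, the second derivative being passed in; \<open>L_{k,\<nu>}\<close> has the same form
  with \<open>\<nu> * k\<^sup>2\<close> added to \<open>z\<close>.\<close>

abbreviation mode_op :: "real \<Rightarrow> (real \<Rightarrow> real) \<Rightarrow> real \<Rightarrow> complex \<Rightarrow> (real \<Rightarrow> complex) \<Rightarrow> (real \<Rightarrow> complex) \<Rightarrow> real \<Rightarrow> complex" where
  "mode_op \<kappa> u \<nu> z W W'' \<equiv> \<lambda>y. \<i> * of_real (\<kappa> * u y) * W y + z * W y - of_real \<nu> * W'' y"

text \<open>A whole half plane of \<open>z\<close> is demanded because both the diffusion in
  \<open>x\<close> and the symbol of the discrete time derivative will be put into
  \<open>z\<close>.\<close>

definition resolvent_bound :: "(real \<Rightarrow> real) \<Rightarrow> real \<Rightarrow> real \<Rightarrow> real \<Rightarrow> bool" where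
  "resolvent_bound u \<kappa> \<nu> \<Psi> \<longleftrightarrow> (\<forall>W W' W'' z. C2_periodic W W' W'' \<longrightarrow> 0 \<le> Re z \<longrightarrow>
     \<Psi>\<^sup>2 * l2sq W \<le> l2sq (mode_op \<kappa> u \<nu> z W W''))"

abbreviation (input) decay_rate :: "real \<Rightarrow> real \<Rightarrow> real \<Rightarrow> real" where
  "decay_rate \<alpha> \<nu> \<kappa> \<equiv> \<nu> powr (\<alpha> / (\<alpha> + 2)) * \<bar>\<kappa>\<bar> powr (2 / (\<alpha> + 2))"

text \<open>On windows of length \<open>2 * \<delta>\<close> the local estimate bounds
  \<open>W\<close> by \<open>R / lam\<close> and \<open>\<delta> * W'\<close> in mean square. Since
  \<open>\<delta>\<^sup>2 = \<nu> / lam\<close>, the gradient term is the dissipation divided by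
  \<open>lam\<close>, to which the energy identity applies.\<close>

lemma resolvent_estimate:
  assumes \<alpha>: "\<alpha> > 0" and u: "continuous_on UNIV u" and per: "\<And>y. u (y + 2 * pi) = u y"
    and C1: "C\<^sub>1 > 0"
    and om: "\<And>\<delta>. 0 < \<delta> \<Longrightarrow> \<delta> < 1 \<Longrightarrow> omega1 \<delta> u \<ge> C\<^sub>1 * \<delta> powr (2 * \<alpha> + 3)"
  shows "\<exists>\<epsilon>>0. \<forall>\<nu> \<kappa>. \<nu> > 0 \<longrightarrow> \<kappa> \<noteq> 0 \<longrightarrow> \<nu> / \<bar>\<kappa>\<bar> \<le> 1 / 2 \<longrightarrow>
    resolvent_bound u \<kappa> \<nu> (\<epsilon> * decay_rate \<alpha> \<nu> \<kappa>)"
proof -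
  obtain \<psi> where \<psi>: "\<And>y. (\<psi> has_real_derivative u y) (at y)"
    using exists_primitive[OF u] by blast
  \<comment> \<open>Dominates both coefficients of \<open>h\<close> below, apart from their powers
    of \<open>lam\<close> and \<open>\<delta>\<close>, after the doubling by
    \<open>integral_periodic_cover\<close>: these are \<open>96 / C\<^sub>1\<close> and
    \<open>72 + 12 / C\<^sub>1\<close>.\<close>
  define K where "K = 96 / C\<^sub>1 + 72"
  have K: "K > 0" using C1 by (simp add: K_def add_pos_pos)
  \<comment> \<open>Normalises the final inequality
    \<open>P\<^sup>2 \<le> (2 * K + K\<^sup>2) * Q\<^sup>2\<close>.\<close>
  define \<epsilon> where "\<epsilon> = 1 / sqrt (2 * K + K\<^sup>2)"
  define K' where "K' = 2 * K + K\<^sup>2"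
  have "K' > 0" using K by (simp add: K'_def add_pos_pos)
  then have \<epsilon>: "\<epsilon> > 0" and \<epsilon>2: "\<epsilon>\<^sup>2 * (2 * K + K\<^sup>2) = 1"
    by (simp_all add: \<epsilon>_def K'_def[symmetric] power_divide)
  show ?thesis
  proof (rule exI[of _ \<epsilon>], unfold resolvent_bound_def, intro conjI \<epsilon> allI impI)
    fix \<nu> \<kappa> :: real and W W' W'' :: "real \<Rightarrow> complex" and z :: complex
    assume \<nu>: "\<nu> > 0" and \<kappa>: "\<kappa> \<noteq> 0" and \<nu>\<kappa>: "\<nu> / \<bar>\<kappa>\<bar> \<le> 1 / 2"
      and per2: "C2_periodic W W' W''" and z: "0 \<le> Re z"
    from per2 have W: "\<forall>y. (W has_vector_derivative W' y) (at y)"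
      and W': "\<forall>y. (W' has_vector_derivative W'' y) (at y)"
      and cW'': "continuous_on UNIV W''"
      and pW: "\<forall>y. W (y + 2 * pi) = W y" and pW': "\<forall>y. W' (y + 2 * pi) = W' y"
      and pW'': "\<forall>y. W'' (y + 2 * pi) = W'' y"
      by (simp_all add: C2_periodic_def)
    define lam where "lam = decay_rate \<alpha> \<nu> \<kappa>"
    define \<delta> where "\<delta> = (\<nu> / \<bar>\<kappa>\<bar>) powr (1 / (\<alpha> + 2))"
    have lam: "lam > 0" using \<nu> \<kappa> by (simp add: lam_def)
    have \<delta>0: "\<delta> > 0" using \<nu> \<kappa> by (simp add: \<delta>_def)
    have \<delta>1: "\<delta> < 1"
      unfolding \<delta>_def using powr_less_mono2[of "1 / (\<alpha> + 2)" "\<nu> / \<bar>\<kappa>\<bar>" 1] \<alpha> \<nu> \<nu>\<kappa> by simp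
    have lnd: "ln \<delta> = (ln \<nu> - ln \<bar>\<kappa>\<bar>) / (\<alpha> + 2)"
      using \<nu> \<kappa> by (simp add: \<delta>_def ln_div ln_powr)
    have lnl: "ln lam = (\<alpha> * ln \<nu> + 2 * ln \<bar>\<kappa>\<bar>) / (\<alpha> + 2)"
      using \<nu> \<kappa> by (simp add: lam_def ln_mult ln_powr add_divide_distrib)
    \<comment> \<open>Logarithms make the real exponents linear, and multiplying by
      \<open>\<alpha> + 2\<close> clears the fractions.\<close>
    have lnn: "ln \<nu> = ln lam + 2 * ln \<delta>" and lnk: "ln \<bar>\<kappa>\<bar> = ln lam - \<alpha> * ln \<delta>"
    proof -
      have s: "(\<alpha> + 2) * ln \<delta> = ln \<nu> - ln \<bar>\<kappa>\<bar>" "(\<alpha> + 2) * ln lam = \<alpha> * ln \<nu> + 2 * ln \<bar>\<kappa>\<bar>"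
        unfolding lnd lnl using \<alpha> by simp_all
      have "(\<alpha> + 2) * ln \<nu> = (\<alpha> + 2) * ln lam + 2 * ((\<alpha> + 2) * ln \<delta>)"
        unfolding s by (simp add: algebra_simps)
      then have "(\<alpha> + 2) * ln \<nu> = (\<alpha> + 2) * (ln lam + 2 * ln \<delta>)" by (simp add: algebra_simps)
      then show "ln \<nu> = ln lam + 2 * ln \<delta>" using \<alpha> by (simp only: mult_left_cancel)
      have "(\<alpha> + 2) * ln \<bar>\<kappa>\<bar> = (\<alpha> + 2) * ln lam - \<alpha> * ((\<alpha> + 2) * ln \<delta>)"
        unfolding s by (simp add: algebra_simps)
      then have "(\<alpha> + 2) * ln \<bar>\<kappa>\<bar> = (\<alpha> + 2) * (ln lam - \<alpha> * ln \<delta>)" by (simp add: algebra_simps)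
      then show "ln \<bar>\<kappa>\<bar> = ln lam - \<alpha> * ln \<delta>" using \<alpha> by (simp only: mult_left_cancel)
    qed
    have nu_eq: "\<nu> = lam * \<delta>\<^sup>2"
      using lnn \<nu> lam \<delta>0 by (subst ln_inj_iff[symmetric]) (auto simp: ln_mult ln_realpow)
    have kap_eq: "\<kappa>\<^sup>2 * \<delta> powr (2 * \<alpha> + 3) = lam\<^sup>2 * \<delta> ^ 3"
    proof (subst ln_inj_iff[symmetric])
      have "ln (\<kappa>\<^sup>2 * \<delta> powr (2 * \<alpha> + 3)) = 2 * ln \<bar>\<kappa>\<bar> + (2 * \<alpha> + 3) * ln \<delta>"
        using ln_realpow[of "\<bar>\<kappa>\<bar>" 2] \<kappa> \<delta>0 by (simp add: ln_mult ln_powr)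
      also have "\<dots> = ln (lam\<^sup>2 * \<delta> ^ 3)"
        unfolding lnk using lam \<delta>0 by (simp add: ln_mult ln_realpow algebra_simps)
      finally show "ln (\<kappa>\<^sup>2 * \<delta> powr (2 * \<alpha> + 3)) = ln (lam\<^sup>2 * \<delta> ^ 3)" .
    qed (use \<kappa> \<delta>0 lam in auto)
    define q where "q y = \<kappa> * u y + Im z" for y
    define R where "R y = \<i> * of_real (q y) * W y - of_real \<nu> * W'' y" for y
    have cq: "continuous_on T q" for T
      unfolding q_def by (intro continuous_intros continuous_on_subset[OF u]) auto
    have cW: "continuous_on T W" and cW': "continuous_on T W'" for T
      by (rule continuous_at_imp_continuous_on, blast intro: has_vector_derivative_continuous W[rule_format] W'[rule_format])+
    have cW''2: "continuous_on T W''" for T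
      using cW'' continuous_on_subset by blast
    have cR: "continuous_on T R" for T
      unfolding R_def by (intro continuous_intros cW cW''2 cq)
    note c = cW cW' cW''2 cq cR
    define X E D where "X = l2sq W"
      and "E = l2sq R" and "D = l2sq W'"
    have nn: "X \<ge> 0" "E \<ge> 0" "D \<ge> 0"
      unfolding X_def E_def D_def by (auto intro!: integral_nonneg integrable_continuous_interval continuous_intros c)
    have en: "integral {0..2*pi} (\<lambda>y. R y \<bullet> W y) = \<nu> * D"
      unfolding R_def D_def
      by (rule periodic_energy_identity[OF W[rule_format] W'[rule_format] cW'' cq])
        (use pW[rule_format, of 0] pW'[rule_format, of 0] in simp_all)
    have en_le: "\<nu> * D \<le> sqrt (E * X)"
    proof -
      have "integral {0..2*pi} (\<lambda>y. R y \<bullet> W y) \<le> integral {0..2*pi} (\<lambda>y. cmod (R y) * cmod (W y))"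
        by (rule integral_le) (auto intro!: integrable_continuous_interval continuous_intros c norm_cauchy_schwarz)
      also have "\<dots> \<le> sqrt (E * X)"
        unfolding E_def X_def by (intro real_le_rsqrt integral_Cauchy_Schwarz continuous_intros c)
      finally show ?thesis using en by simp
    qed
    define h where "h y = 48 / (C\<^sub>1 * lam\<^sup>2) * (cmod (R y))\<^sup>2 + (36 + 6 / C\<^sub>1) * \<delta>\<^sup>2 * (cmod (W' y))\<^sup>2" for y
    have loc: "integral {a..a + 2 * \<delta>} (\<lambda>y. (cmod (W y))\<^sup>2) \<le> integral {a..a + 2 * \<delta>} h" for a
    proof -
      define b where "b = a + 2 * \<delta>"
      have ab: "a < b" using \<delta>0 by (simp add: b_def)
      define \<Phi>0 where "\<Phi>0 y = \<kappa> * \<psi> y + Im z * y" for y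
      define m where "m = integral {a..b} \<Phi>0 / (b - a)"
      define \<Phi> where "\<Phi> y = \<Phi>0 y - m" for y
      have d\<Phi>: "(\<Phi> has_real_derivative q y) (at y)" for y
        unfolding \<Phi>_def[abs_def] \<Phi>0_def[abs_def] q_def by (auto intro!: derivative_eq_intros \<psi>)
      have d\<Phi>0: "(\<Phi>0 has_real_derivative q y) (at y)" for y
        unfolding \<Phi>0_def[abs_def] q_def by (auto intro!: derivative_eq_intros \<psi>)
      have c\<Phi>: "continuous_on T \<Phi>" and c\<Phi>0: "continuous_on T \<Phi>0" for T
        by (rule continuous_at_imp_continuous_on, blast intro: DERIV_isCont d\<Phi> d\<Phi>0)+
      have mean: "integral {a..b} \<Phi> = 0"
      proof -
        have "((\<lambda>y. \<Phi>0 y - m) has_integral (integral {a..b} \<Phi>0 - (b - a) * m)) {a..b}"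
          using has_integral_const_real[of m a b] ab
          by (intro has_integral_diff integrable_integral integrable_continuous_interval c\<Phi>0) simp
        then show ?thesis unfolding \<Phi>_def using ab by (simp add: m_def integral_unique)
      qed
      define M where "M = integral {a..b} (\<lambda>y. (\<Phi> y)\<^sup>2)"
      define M0 where "M0 = C\<^sub>1 * (lam\<^sup>2 * \<delta> ^ 3)"
      have M0: "M0 > 0" using C1 lam \<delta>0 by (simp add: M0_def)
      have MM0: "M \<ge> M0"
      proof -
        \<comment> \<open>Here it matters that \<open>omega1\<close> discards affine functions: the
          mean \<open>m\<close> goes into \<open>c1\<close> and the imaginary part of
          \<open>z\<close> into \<open>c2\<close>, so the lower bound on \<open>M\<close> is uniform
          in \<open>Im z\<close>.\<close>
        have "\<Phi> y = \<kappa> * (\<psi> y - m / \<kappa> - (- Im z / \<kappa>) * y)" for y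
          using \<kappa> by (simp add: \<Phi>_def \<Phi>0_def field_simps)
        then have "M = \<kappa>\<^sup>2 * integral {a..b} (\<lambda>y. (\<psi> y - m / \<kappa> - (- Im z / \<kappa>) * y)\<^sup>2)"
          by (simp only: M_def power_mult_distrib integral_mult_right)
        also have "\<dots> \<ge> \<kappa>\<^sup>2 * omega1 \<delta> u"
          using omega1_le[of \<psi> u \<delta> "a + \<delta>" "m / \<kappa>" "- Im z / \<kappa>", OF \<psi>]
          by (intro mult_left_mono) (simp_all add: b_def add.commute[of a])
        finally have "M \<ge> \<kappa>\<^sup>2 * omega1 \<delta> u" .
        moreover have "\<kappa>\<^sup>2 * omega1 \<delta> u \<ge> \<kappa>\<^sup>2 * (C\<^sub>1 * \<delta> powr (2 * \<alpha> + 3))"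
          by (intro mult_left_mono om \<delta>0 \<delta>1) simp
        ultimately show ?thesis using kap_eq by (simp add: M0_def mult.left_commute)
      qed
      define Ei Di where "Ei = integral {a..b} (\<lambda>y. (cmod (R y))\<^sup>2)" and "Di = integral {a..b} (\<lambda>y. (cmod (W' y))\<^sup>2)"
      have nni: "Ei \<ge> 0" "Di \<ge> 0"
        unfolding Ei_def Di_def by (auto intro!: integral_nonneg integrable_continuous_interval continuous_intros c)
      define B where "B = 6 * (b - a)\<^sup>2 * Ei / M0 + (9 * (b - a) + 3 * \<nu>\<^sup>2 / M0) * Di"
      have pt: "(cmod (W y))\<^sup>2 \<le> B" if y: "y \<in> {a..b}" for y
      proof -
        have "M * (cmod (W y))\<^sup>2 \<le> 6 * (b - a)\<^sup>2 * Ei + (9 * (b - a) * M + 3 * \<nu>\<^sup>2) * Di"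
          unfolding M_def Ei_def Di_def
          by (rule local_resolvent_estimate[OF W[rule_format] W'[rule_format] cW'' d\<Phi> cq R_def less_imp_le[OF ab] mean y])
        \<comment> \<open>After division by \<open>M\<close> the right-hand side is nonincreasing in
          \<open>M\<close>, so the lower bound \<open>M0\<close> suffices and no upper bound on
          \<open>M\<close> enters.\<close>
        then have "(cmod (W y))\<^sup>2 \<le> 6 * (b - a)\<^sup>2 * Ei / M + (9 * (b - a) + 3 * \<nu>\<^sup>2 / M) * Di"
          using M0 MM0 by (simp add: field_simps)
        also have "\<dots> \<le> B"
          unfolding B_def using M0 MM0 nni ab
          by (intro add_mono mult_right_mono divide_left_mono mult_pos_pos mult_nonneg_nonneg) auto
        finally show ?thesis .
      qed
      have "integral {a..b} (\<lambda>y. (cmod (W y))\<^sup>2) \<le> integral {a..b} (\<lambda>_. B)"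
        by (rule integral_le) (auto intro!: integrable_continuous_interval continuous_intros c simp: pt)
      also have "\<dots> = (b - a) * B" using ab by simp
      \<comment> \<open>Substituting \<open>b - a = 2 * \<delta>\<close>,
        \<open>M0 = C\<^sub>1 * lam\<^sup>2 * \<delta> ^ 3\<close> and
        \<open>\<nu> = lam * \<delta>\<^sup>2\<close> cancels \<open>\<delta>\<close> in the first
        coefficient and leaves \<open>\<delta>\<^sup>2\<close> in both parts of the second.\<close>
      also have "\<dots> = 48 / (C\<^sub>1 * lam\<^sup>2) * Ei + (36 + 6 / C\<^sub>1) * \<delta>\<^sup>2 * Di"
        unfolding B_def b_def M0_def nu_eq using \<delta>0 lam C1
        by (simp add: field_simps power2_eq_square power3_eq_cube)
      also have "\<dots> = integral {a..b} h"
        unfolding Ei_def Di_def h_def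
        by (rule integral_unique[symmetric], intro has_integral_add has_integral_mult_right integrable_integral
          integrable_continuous_interval continuous_intros c)
      finally show ?thesis by (simp add: b_def)
    qed
    have "X \<le> 2 * integral {0..2*pi} h"
      unfolding X_def
    proof (rule integral_periodic_cover[where l = "2 * \<delta>"])
      show "h (y + 2 * pi) = h y" for y
        unfolding h_def R_def q_def using pW pW' pW'' per by simp
      show "2 * \<delta> \<le> 2 * pi" using \<delta>1 pi_gt3 by simp
    qed (use \<delta>0 C1 lam loc in \<open>auto simp: h_def intro!: continuous_intros c\<close>)
    also have "integral {0..2*pi} h = 48 / (C\<^sub>1 * lam\<^sup>2) * E + (36 + 6 / C\<^sub>1) * \<delta>\<^sup>2 * D"
      unfolding E_def D_def h_def
      by (rule integral_unique, intro has_integral_add has_integral_mult_right integrable_integral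
          integrable_continuous_interval continuous_intros c)
    also have "2 * \<dots> \<le> K * (E / lam\<^sup>2) + K * (\<nu> * D / lam)"
    proof -
      have "2 * (48 / (C\<^sub>1 * lam\<^sup>2) * E) \<le> K * (E / lam\<^sup>2)"
        using nn C1 lam by (simp add: K_def algebra_simps)
      moreover have "2 * ((36 + 6 / C\<^sub>1) * \<delta>\<^sup>2 * D) \<le> K * (\<nu> * D / lam)"
      proof -
        have "\<nu> * D / lam = \<delta>\<^sup>2 * D" using lam by (simp add: nu_eq)
        moreover have "2 * (36 + 6 / C\<^sub>1) \<le> K" using C1 by (simp add: K_def field_simps)
        moreover have "2 * ((36 + 6 / C\<^sub>1) * \<delta>\<^sup>2 * D) = (2 * (36 + 6 / C\<^sub>1)) * (\<delta>\<^sup>2 * D)"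
          by (simp add: algebra_simps)
        ultimately show ?thesis using mult_right_mono[of "2 * (36 + 6 / C\<^sub>1)" K "\<delta>\<^sup>2 * D"] nn
          by (metis mult_nonneg_nonneg zero_le_power2)
      qed
      ultimately show ?thesis by simp
    qed
    also have "\<dots> \<le> K * (E / lam\<^sup>2) + K * (sqrt (E * X) / lam)"
      using en_le K lam by (intro add_left_mono mult_left_mono divide_right_mono) auto
    finally have X1: "X \<le> K * (E / lam\<^sup>2) + K * (sqrt (E * X) / lam)" .
    define P Q where "P = sqrt X" and "Q = sqrt E / lam"
    have PQ: "P\<^sup>2 = X" "Q\<^sup>2 = E / lam\<^sup>2" "Q * P = sqrt (E * X) / lam"
      using nn lam by (simp_all add: P_def Q_def power_divide real_sqrt_mult)
    have "P\<^sup>2 \<le> K * Q\<^sup>2 + K * (Q * P)" using X1 by (simp only: PQ)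
    \<comment> \<open>Half of \<open>P\<^sup>2\<close> is produced here and absorbed on the
      left.\<close>
    moreover have "K * (Q * P) \<le> P\<^sup>2 / 2 + (K * Q)\<^sup>2 / 2"
      using sum_squares_bound[of P "K * Q"] by (simp add: mult_ac)
    ultimately have "P\<^sup>2 \<le> (2 * K + K\<^sup>2) * Q\<^sup>2" by (simp add: power_mult_distrib algebra_simps)
    then have "lam\<^sup>2 * X \<le> (2 * K + K\<^sup>2) * E" unfolding PQ using lam by (simp add: field_simps)
    then have "\<epsilon>\<^sup>2 * (lam\<^sup>2 * X) \<le> \<epsilon>\<^sup>2 * ((2 * K + K\<^sup>2) * E)" by (intro mult_left_mono) auto
    also have "\<dots> = E" using \<epsilon>2 by (simp add: mult.assoc[symmetric])
    finally have main: "(\<epsilon> * lam)\<^sup>2 * X \<le> E" by (simp add: power_mult_distrib mult.assoc)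
    have Req: "\<i> * of_real (\<kappa> * u y) * W y + z * W y - of_real \<nu> * W'' y = R y + of_real (Re z) * W y" for y
      by (simp add: R_def q_def complex_eq_iff algebra_simps)
    \<comment> \<open>A positive real part of \<open>z\<close> only helps: its cross term with
      \<open>R\<close> integrates to a multiple of the dissipation \<open>\<nu> * D\<close>, which
      is nonnegative. This reduces the half plane to the imaginary axis.\<close>
    have "integral {0..2*pi} (\<lambda>y. (cmod (R y + of_real (Re z) * W y))\<^sup>2) = E + 2 * Re z * (\<nu> * D) + (Re z)\<^sup>2 * X"
    proof -
      have "(cmod (R y + of_real (Re z) * W y))\<^sup>2 = (cmod (R y))\<^sup>2 + 2 * Re z * (R y \<bullet> W y) + (Re z)\<^sup>2 * (cmod (W y))\<^sup>2" for y
        unfolding cmod_power2 inner_complex_def by (simp add: power2_eq_square algebra_simps)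
      then show ?thesis
        unfolding E_def X_def en[symmetric]
        by (simp only:) (rule integral_unique, intro has_integral_add has_integral_mult_right integrable_integral
          integrable_continuous_interval continuous_intros c)
    qed
    also have "\<dots> \<ge> E" using z nn \<nu> by simp
    finally show "(\<epsilon> * decay_rate \<alpha> \<nu> \<kappa>)\<^sup>2 * l2sq W \<le> l2sq (mode_op \<kappa> u \<nu> z W W'')"
      using main by (simp only: Req lam_def[symmetric] X_def[symmetric])
  qed
qed

section \<open>The Hilbert space of the torus\<close>

lemma space_circle [simp]: "space circle_measure = {0..<2*pi}"
  by (simp add: circle_measure_def space_restrict_space)

lemma space_torus [simp]: "space torus_measure = {0..<2*pi} \<times> {0..<2*pi}"
  by (simp add: torus_measure_def space_pair_measure)

lemma borel_measurable_circleI: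
  assumes "f \<in> borel_measurable borel"
  shows "f \<in> borel_measurable circle_measure"
  using assms unfolding circle_measure_def by (intro measurable_restrict_space1) simp

lemma borel_measurable_torusI:
  assumes "f \<in> borel_measurable borel"
  shows "f \<in> borel_measurable torus_measure"
proof -
  have "(\<lambda>x. x) \<in> circle_measure \<rightarrow>\<^sub>M borel"
    by (rule borel_measurable_circleI) simp
  then have "(\<lambda>z. (fst z, snd z)) \<in> torus_measure \<rightarrow>\<^sub>M borel \<Otimes>\<^sub>M borel"
    unfolding torus_measure_def by (intro measurable_Pair measurable_compose[OF measurable_fst]
      measurable_compose[OF measurable_snd]) auto
  from measurable_compose[OF this, of f borel] assms show ?thesis
    by (simp add: borel_prod)
qed

lemma finite_measure_torus: "finite_measure torus_measure"
  unfolding torus_measure_def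
  by (rule finite_measure_pair_measure) (rule circle.finite_measure_axioms)+

interpretation torus_fin: finite_measure torus_measure
  by (rule finite_measure_torus)

lemma sq_integrable_bounded:
  assumes "f \<in> borel_measurable torus_measure" "\<And>z. cmod (f z) \<le> B"
  shows "sq_integrable f"
  unfolding sq_integrable_def
proof
  show "integrable torus_measure (\<lambda>z. (cmod (f z))\<^sup>2)"
  proof (rule torus_fin.integrable_const_bound[of _ "B\<^sup>2"])
    show "AE x in torus_measure. norm ((cmod (f x))\<^sup>2) \<le> B\<^sup>2"
      by (intro AE_I2) (simp add: power_mono assms(2))
  qed (use assms in auto)
qed (fact assms)

lemma sq_integrable_rep [simp, intro]: "sq_integrable (rep_l2_torus F)"
  using Quotient_rep_reflp[OF Quotient_l2_torus] by blast

lemma borel_measurable_rep_l2 [measurable, simp]: "rep_l2_torus F \<in> borel_measurable torus_measure"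
  using sq_integrable_rep[of F] by (simp add: sq_integrable_def)

lemma abs_rep_l2 [simp]: "abs_l2_torus (rep_l2_torus F) = F"
  by (rule Quotient_abs_rep[OF Quotient_l2_torus])

lemma rep_abs_l2:
  assumes "sq_integrable f"
  shows "AE z in torus_measure. rep_l2_torus (abs_l2_torus f) z = f z"
  using Quotient_rep_abs[OF Quotient_l2_torus, of f] assms by blast

lemma abs_l2_eqI:
  assumes "sq_integrable f" "sq_integrable g" "AE z in torus_measure. f z = g z"
  shows "abs_l2_torus f = abs_l2_torus g"
  using Quotient_rel_abs[OF Quotient_l2_torus, of f g] assms by blast

lemma add_abs_l2:
  assumes "sq_integrable f" "sq_integrable g"
  shows "abs_l2_torus f + abs_l2_torus g = abs_l2_torus (\<lambda>z. f z + g z)"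
  using assms by (simp add: plus_l2_torus.abs_eq)

lemma scaleR_abs_l2:
  assumes "sq_integrable f"
  shows "c *\<^sub>R abs_l2_torus f = abs_l2_torus (\<lambda>z. c *\<^sub>R f z)"
  using assms by (simp add: scaleR_l2_torus.abs_eq)

lemma norm_abs_l2:
  assumes "sq_integrable f"
  shows "norm (abs_l2_torus f) = sqrt (\<integral>z. (cmod (f z))\<^sup>2 \<partial>torus_measure)"
  using assms by (simp add: norm_l2_torus.abs_eq)

lemma inner_abs_l2:
  assumes "sq_integrable f" "sq_integrable g"
  shows "abs_l2_torus f \<bullet> abs_l2_torus g = (\<integral>z. f z \<bullet> g z \<partial>torus_measure)"
  using assms by (simp add: inner_l2_torus.abs_eq)

lemma uminus_abs_l2:
  assumes "sq_integrable f"
  shows "- abs_l2_torus f = abs_l2_torus (\<lambda>z. - f z)"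
  using scaleR_abs_l2[OF assms, of "-1"] by simp

lemma sq_integrable_uminus: "sq_integrable f \<Longrightarrow> sq_integrable (\<lambda>z. - f z)"
  using sq_integrable_scaleR[of f "-1"] by simp

lemma sq_integrable_diff: "sq_integrable f \<Longrightarrow> sq_integrable g \<Longrightarrow> sq_integrable (\<lambda>z. f z - g z)"
  using sq_integrable_add[OF _ sq_integrable_uminus, of f g] by simp

lemma diff_abs_l2:
  assumes "sq_integrable f" "sq_integrable g"
  shows "abs_l2_torus f - abs_l2_torus g = abs_l2_torus (\<lambda>z. f z - g z)"
  unfolding diff_conv_add_uminus[of "abs_l2_torus f"]
  using add_abs_l2[OF assms(1) sq_integrable_uminus[OF assms(2)]] uminus_abs_l2[OF assms(2)] by simp

lemma integrable_mult_sq_integrable: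
  assumes "sq_integrable f" "sq_integrable g"
  shows "integrable torus_measure (\<lambda>z. f z * g z)"
proof -
  have i: "integrable torus_measure (\<lambda>z. (cmod (f z))\<^sup>2 + (cmod (g z))\<^sup>2)"
    using assms by (auto simp: sq_integrable_def)
  have b: "cmod (f z * g z) \<le> (cmod (f z))\<^sup>2 + (cmod (g z))\<^sup>2" for z
    using sum_squares_bound[of "cmod (f z)" "cmod (g z)"]
      mult_nonneg_nonneg[of "cmod (f z)" "cmod (g z)", OF norm_ge_zero norm_ge_zero]
    unfolding norm_mult by linarith
  show ?thesis
    by (rule Bochner_Integration.integrable_bound[OF i])
       (use assms b in \<open>auto simp: sq_integrable_def\<close>)
qed

lemma borel_measurable_cnj [measurable (raw)]:
  "f \<in> borel_measurable M \<Longrightarrow> (\<lambda>z. cnj (f z)) \<in> borel_measurable M"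
  by (rule measurable_compose[OF _ borel_measurable_continuous_onI]) (auto intro: continuous_intros)

lemma sq_integrable_cnj: "sq_integrable f \<Longrightarrow> sq_integrable (\<lambda>z. cnj (f z))"
  by (auto simp: sq_integrable_def)

text \<open>The type class provides only a real inner product. This form, complex linear in its
  first argument, has that product as real part and yields the Fourier coefficients.\<close>

definition herm :: "l2_torus \<Rightarrow> l2_torus \<Rightarrow> complex" where
  "herm F G = (\<integral>z. rep_l2_torus F z * cnj (rep_l2_torus G z) \<partial>torus_measure)"

lemma herm_abs_right:
  assumes "sq_integrable g"
  shows "herm F (abs_l2_torus g) = (\<integral>z. rep_l2_torus F z * cnj (g z) \<partial>torus_measure)"
  unfolding herm_def
proof (rule integral_cong_AE)
  show "AE z in torus_measure. rep_l2_torus F z * cnj (rep_l2_torus (abs_l2_torus g) z) = rep_l2_torus F z * cnj (g z)"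
    using rep_abs_l2[OF assms] by eventually_elim simp
qed (use assms in \<open>auto simp: sq_integrable_def intro!: borel_measurable_times borel_measurable_cnj\<close>)

lemma herm_abs:
  assumes "sq_integrable f" "sq_integrable g"
  shows "herm (abs_l2_torus f) (abs_l2_torus g) = (\<integral>z. f z * cnj (g z) \<partial>torus_measure)"
  unfolding herm_abs_right[OF assms(2)]
proof (rule integral_cong_AE)
  show "AE z in torus_measure. rep_l2_torus (abs_l2_torus f) z * cnj (g z) = f z * cnj (g z)"
    using rep_abs_l2[OF assms(1)] by eventually_elim simp
qed (use assms in \<open>auto simp: sq_integrable_def intro!: borel_measurable_times borel_measurable_cnj\<close>)

lemma herm_commute: "herm G F = cnj (herm F G)"
  unfolding herm_def by (subst Bochner_Integration.integral_cnj[symmetric]) (simp add: mult.commute)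

lemma Re_herm: "Re (herm F G) = F \<bullet> G"
proof -
  have "Re (herm F G) = (\<integral>z. rep_l2_torus F z \<bullet> rep_l2_torus G z \<partial>torus_measure)"
    unfolding herm_def
    by (subst integral_Re[symmetric])
      (auto simp: inner_complex_def intro!: integrable_mult_sq_integrable sq_integrable_cnj)
  also have "\<dots> = F \<bullet> G"
    using inner_abs_l2[of "rep_l2_torus F" "rep_l2_torus G"] by simp
  finally show ?thesis .
qed

lemma herm_add_left: "herm (F + G) H = herm F H + herm G H"
proof -
  have "herm (F + G) H = herm (abs_l2_torus (\<lambda>z. rep_l2_torus F z + rep_l2_torus G z)) (abs_l2_torus (rep_l2_torus H))"
    by (simp add: add_abs_l2[symmetric])
  also have "\<dots> = herm F H + herm G H"
    by (subst herm_abs)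
      (auto simp: herm_def distrib_right intro!: sq_integrable_add Bochner_Integration.integral_add
        integrable_mult_sq_integrable sq_integrable_cnj)
  finally show ?thesis .
qed

section \<open>Bounded multipliers and complex scalar multiplication\<close>

definition bounded_multiplier :: "(real \<times> real \<Rightarrow> complex) \<Rightarrow> bool" where
  "bounded_multiplier w \<longleftrightarrow> w \<in> borel_measurable torus_measure \<and> (\<exists>B. \<forall>z. cmod (w z) \<le> B)"

definition mul :: "(real \<times> real \<Rightarrow> complex) \<Rightarrow> l2_torus \<Rightarrow> l2_torus" where
  "mul w F = abs_l2_torus (\<lambda>z. w z * rep_l2_torus F z)"

lemma bounded_multiplier_const [simp, intro]: "bounded_multiplier (\<lambda>_. c)"
  by (auto simp: bounded_multiplier_def)

lemma bounded_multiplier_cnj [intro]: "bounded_multiplier w \<Longrightarrow> bounded_multiplier (\<lambda>z. cnj (w z))"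
  by (auto simp: bounded_multiplier_def)

lemma sq_integrable_mult:
  assumes "bounded_multiplier w" "sq_integrable f"
  shows "sq_integrable (\<lambda>z. w z * f z)"
proof -
  obtain B where B: "\<And>z. cmod (w z) \<le> B" using assms by (auto simp: bounded_multiplier_def)
  have m: "(\<lambda>z. w z * f z) \<in> borel_measurable torus_measure"
    using assms by (auto simp: bounded_multiplier_def sq_integrable_def)
  have "integrable torus_measure (\<lambda>z. B\<^sup>2 * (cmod (f z))\<^sup>2)"
    using assms by (auto simp: sq_integrable_def)
  then have "integrable torus_measure (\<lambda>z. (cmod (w z * f z))\<^sup>2)"
  proof (rule Bochner_Integration.integrable_bound)
    show "AE z in torus_measure. norm ((cmod (w z * f z))\<^sup>2) \<le> norm (B\<^sup>2 * (cmod (f z))\<^sup>2)"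
      by (intro AE_I2) (simp add: norm_mult power_mult_distrib mult_right_mono power_mono B)
  qed (use m in measurable)
  then show ?thesis using m by (simp add: sq_integrable_def)
qed

lemma mul_abs:
  assumes "bounded_multiplier w" "sq_integrable f"
  shows "mul w (abs_l2_torus f) = abs_l2_torus (\<lambda>z. w z * f z)"
  unfolding mul_def
proof (rule abs_l2_eqI)
  show "AE z in torus_measure. w z * rep_l2_torus (abs_l2_torus f) z = w z * f z"
    using rep_abs_l2[OF assms(2)] by eventually_elim simp
qed (use assms in \<open>auto intro: sq_integrable_mult\<close>)

lemma mul_add:
  assumes "bounded_multiplier w"
  shows "mul w (F + G) = mul w F + mul w G"
proof -
  have "mul w (F + G) = mul w (abs_l2_torus (\<lambda>z. rep_l2_torus F z + rep_l2_torus G z))"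
    by (simp add: add_abs_l2[symmetric])
  also have "\<dots> = abs_l2_torus (\<lambda>z. w z * rep_l2_torus F z + w z * rep_l2_torus G z)"
    by (subst mul_abs) (auto simp: assms distrib_left intro!: sq_integrable_add)
  also have "\<dots> = mul w F + mul w G"
    unfolding mul_def by (rule add_abs_l2[symmetric]) (auto intro: assms sq_integrable_mult)
  finally show ?thesis .
qed

lemma mul_add_left:
  assumes "bounded_multiplier v" "bounded_multiplier w"
  shows "mul (\<lambda>z. v z + w z) F = mul v F + mul w F"
  unfolding mul_def by (subst add_abs_l2) (auto intro: assms sq_integrable_mult simp: distrib_right)

lemma mul_mul:
  assumes "bounded_multiplier v" "bounded_multiplier w"
  shows "mul v (mul w F) = mul (\<lambda>z. v z * w z) F"
  unfolding mul_def[of w]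
  by (subst mul_abs) (auto intro: assms sq_integrable_mult simp: mul_def mult.assoc)

lemma mul_of_real: "mul (\<lambda>_. of_real c) F = c *\<^sub>R F"
  unfolding mul_def using scaleR_abs_l2[of "rep_l2_torus F" c] by (simp add: scaleR_conv_of_real)

lemma mul_one [simp]: "mul (\<lambda>_. 1) F = F"
  using mul_of_real[of 1 F] by simp

lemma mul_commute: "mul v (mul w F) = mul w (mul v F)" if "bounded_multiplier v" "bounded_multiplier w"
  using that by (simp add: mul_mul mult.commute)

lemma norm_mul_le:
  assumes "bounded_multiplier w" "\<And>z. cmod (w z) \<le> B"
  shows "norm (mul w F) \<le> B * norm F"
proof -
  have B: "B \<ge> 0" using assms(2) norm_ge_zero order_trans by blast
  let ?f = "rep_l2_torus F"
  have i: "integrable torus_measure (\<lambda>z. (cmod (?f z))\<^sup>2)" "integrable torus_measure (\<lambda>z. (cmod (w z * ?f z))\<^sup>2)"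
    using sq_integrable_mult[OF assms(1), of ?f] sq_integrable_rep[of F] by (auto simp: sq_integrable_def)
  have "(\<integral>z. (cmod (w z * ?f z))\<^sup>2 \<partial>torus_measure) \<le> (\<integral>z. B\<^sup>2 * (cmod (?f z))\<^sup>2 \<partial>torus_measure)"
    by (rule integral_mono) (use i assms(2) in \<open>auto simp: norm_mult power_mult_distrib intro!: mult_right_mono power_mono\<close>)
  also have "\<dots> = B\<^sup>2 * (\<integral>z. (cmod (?f z))\<^sup>2 \<partial>torus_measure)" by simp
  finally have "norm (mul w F) \<le> sqrt (B\<^sup>2 * (\<integral>z. (cmod (?f z))\<^sup>2 \<partial>torus_measure))"
    unfolding mul_def by (subst norm_abs_l2) (auto intro: assms sq_integrable_mult)
  also have "\<dots> = B * norm (abs_l2_torus ?f)"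
    by (subst norm_abs_l2) (auto simp: real_sqrt_mult B)
  finally show ?thesis by simp
qed

lemma bounded_linear_mul:
  assumes "bounded_multiplier w"
  shows "bounded_linear (mul w)"
proof -
  obtain B where B: "\<And>z. cmod (w z) \<le> B" using assms by (auto simp: bounded_multiplier_def)
  have "mul w (r *\<^sub>R F) = r *\<^sub>R mul w F" for r F
    unfolding mul_of_real[symmetric] by (rule mul_commute[OF assms]) simp
  then show ?thesis
    using norm_mul_le[OF assms B]
    by (intro bounded_linear_intro[where K = B]) (auto simp: mul_add[OF assms] mult.commute)
qed

lemma herm_mul_left:
  assumes "bounded_multiplier w"
  shows "herm (mul w F) G = herm F (mul (\<lambda>z. cnj (w z)) G)"
proof -
  have "herm (mul w F) (abs_l2_torus (rep_l2_torus G)) = (\<integral>z. w z * rep_l2_torus F z * cnj (rep_l2_torus G z) \<partial>torus_measure)"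
    unfolding mul_def by (subst herm_abs) (auto intro: assms sq_integrable_mult)
  also have "\<dots> = herm F (mul (\<lambda>z. cnj (w z)) G)"
    unfolding mul_def
    by (simp add: herm_abs_right[OF sq_integrable_mult[OF bounded_multiplier_cnj[OF assms] sq_integrable_rep]] mult_ac)
  finally show ?thesis by simp
qed

text \<open>Complex scalars act as constant multipliers, because \<open>l2_torus\<close> is declared
  as a real vector space.\<close>

definition cscale :: "complex \<Rightarrow> l2_torus \<Rightarrow> l2_torus" where
  "cscale c = mul (\<lambda>_. c)"

lemma herm_cscale_left [simp]: "herm (cscale c F) G = c * herm F G"
proof -
  have "herm (cscale c F) (abs_l2_torus (rep_l2_torus G)) = (\<integral>z. c * rep_l2_torus F z * cnj (rep_l2_torus G z) \<partial>torus_measure)"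
    unfolding cscale_def mul_def by (subst herm_abs) (auto intro: sq_integrable_mult)
  then show ?thesis by (simp add: herm_def mult.assoc)
qed

lemma herm_cscale_right [simp]: "herm F (cscale c G) = cnj c * herm F G"
  by (metis herm_commute herm_cscale_left complex_cnj_mult)

lemma herm_add_right: "herm H (F + G) = herm H F + herm H G"
  by (metis herm_commute herm_add_left complex_cnj_add)

lemma cscale_add_right: "cscale c (F + G) = cscale c F + cscale c G"
  unfolding cscale_def by (rule mul_add) simp

lemma cscale_add_left: "cscale (c + d) F = cscale c F + cscale d F"
  unfolding cscale_def by (rule mul_add_left) simp_all

lemma cscale_cscale [simp]: "cscale c (cscale d F) = cscale (c * d) F"
  unfolding cscale_def by (rule mul_mul) simp_all

lemma cscale_of_real: "cscale (of_real c) F = c *\<^sub>R F"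
  unfolding cscale_def by (rule mul_of_real)

lemma cscale_one [simp]: "cscale 1 F = F"
  unfolding cscale_def by simp

lemma bounded_linear_cscale: "bounded_linear (cscale c)"
  unfolding cscale_def by (rule bounded_linear_mul) simp

lemma herm_self: "herm F F = of_real ((norm F)\<^sup>2)"
proof -
  have "Im (herm F F) = 0" using arg_cong[OF herm_commute[of F F], of Im] by simp
  then show ?thesis by (simp add: complex_eq_iff Re_herm power2_norm_eq_inner)
qed

lemma norm_cscale [simp]: "norm (cscale c F) = cmod c * norm F"
proof -
  have "complex_of_real ((norm (cscale c F))\<^sup>2) = herm (cscale c F) (cscale c F)"
    by (simp only: herm_self)
  also have "\<dots> = c * cnj c * herm F F" by simp
  also have "\<dots> = of_real ((cmod c * norm F)\<^sup>2)"
    by (simp add: herm_self complex_norm_square[symmetric] power_mult_distrib)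
  finally have "complex_of_real ((norm (cscale c F))\<^sup>2) = of_real ((cmod c * norm F)\<^sup>2)" .
  then show ?thesis by (metis of_real_eq_iff power2_eq_iff_nonneg mult_nonneg_nonneg norm_ge_zero)
qed

lemma norm_herm_le: "cmod (herm F G) \<le> norm F * norm G"
proof (cases "herm F G = 0")
  case False
  \<comment> \<open>A phase that rotates \<open>herm F G\<close> onto its modulus and so reduces the
    claim to the real Cauchy-Schwarz inequality.\<close>
  define c where "c = cnj (herm F G) / of_real (cmod (herm F G))"
  have "cmod c = 1" using False by (simp add: c_def norm_divide)
  have "c * herm F G = of_real (cmod (herm F G))"
    using False by (simp add: c_def complex_norm_square[symmetric] mult.commute power2_eq_square)
  then have "cmod (herm F G) = Re (herm (cscale c F) G)" by simp
  also have "\<dots> \<le> norm (cscale c F) * norm G" unfolding Re_herm by (rule norm_cauchy_schwarz)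
  finally show ?thesis using \<open>cmod c = 1\<close> by simp
qed simp

lemma bounded_linear_herm_left: "bounded_linear (\<lambda>F. herm F G)"
  by (rule bounded_linear_intro[where K = "norm G"])
    (auto simp: herm_add_left cscale_of_real[symmetric] scaleR_conv_of_real norm_herm_le)

lemma bounded_linear_herm_right: "bounded_linear (herm F)"
  by (rule bounded_linear_intro[where K = "norm F"])
    (auto simp: herm_add_right cscale_of_real[symmetric] scaleR_conv_of_real norm_herm_le mult.commute[of "norm F"]
      intro: order_trans[OF norm_herm_le])

lemmas herm_linear_simps =
  linear_diff[OF bounded_linear.linear[OF bounded_linear_herm_left]]
  linear_diff[OF bounded_linear.linear[OF bounded_linear_herm_right]]
  linear_sum[OF bounded_linear.linear[OF bounded_linear_herm_left]]
  linear_sum[OF bounded_linear.linear[OF bounded_linear_herm_right]]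
  linear_0[OF bounded_linear.linear[OF bounded_linear_herm_left]]
  linear_0[OF bounded_linear.linear[OF bounded_linear_herm_right]]

text \<open>The limit inherits the bound \<open>g\<close> almost everywhere, so the squared
  differences are dominated by \<open>4 * (g z)\<^sup>2\<close>. All later norm limits of explicit
  functions come from here.\<close>

lemma l2_dominated_convergence:
  assumes s: "\<And>n. s n \<in> borel_measurable torus_measure" and f: "f \<in> borel_measurable torus_measure"
    and g: "integrable torus_measure (\<lambda>z. (g z)\<^sup>2)"
    and lim: "AE z in torus_measure. (\<lambda>n. s n z) \<longlonglongrightarrow> f z"
    and bound: "\<And>n z. cmod (s n z) \<le> g z"
  shows "sq_integrable (s n)" "sq_integrable f" "(\<lambda>n. abs_l2_torus (s n)) \<longlonglongrightarrow> abs_l2_torus f"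
proof -
  have g0: "g z \<ge> 0" for z using bound[of 0 z] norm_ge_zero order_trans by blast
  show sq: "sq_integrable (s n)" for n
    unfolding sq_integrable_def
    by (intro conjI s Bochner_Integration.integrable_bound[OF g])
      (use s bound g0 in \<open>auto intro!: power_mono\<close>)
  have fb: "AE z in torus_measure. cmod (f z) \<le> g z"
    using lim by eventually_elim (rule LIMSEQ_le_const2[OF tendsto_norm], auto intro: bound)
  show sqf: "sq_integrable f"
    unfolding sq_integrable_def
    by (intro conjI f Bochner_Integration.integrable_bound[OF g])
      (use f fb g0 in \<open>auto intro!: power_mono\<close>)
  have "(\<lambda>n. \<integral>z. (cmod (s n z - f z))\<^sup>2 \<partial>torus_measure) \<longlonglongrightarrow> (\<integral>z. 0 \<partial>torus_measure)"
  proof (rule integral_dominated_convergence)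
    show "integrable torus_measure (\<lambda>z. 4 * (g z)\<^sup>2)" using g by simp
    show "AE z in torus_measure. (\<lambda>n. (cmod (s n z - f z))\<^sup>2) \<longlonglongrightarrow> 0"
      using lim
    proof eventually_elim
      case (elim z)
      then have "(\<lambda>n. (cmod (s n z - f z))\<^sup>2) \<longlonglongrightarrow> (cmod (f z - f z))\<^sup>2" by (intro tendsto_intros)
      then show ?case by simp
    qed
    show "AE z in torus_measure. norm ((cmod (s n z - f z))\<^sup>2) \<le> 4 * (g z)\<^sup>2" for n
      using fb
    proof eventually_elim
      case (elim z)
      have "cmod (s n z - f z) \<le> 2 * g z"
        using norm_triangle_ineq4[of "s n z" "f z"] bound[of n z] elim by linarith
      then have "(cmod (s n z - f z))\<^sup>2 \<le> (2 * g z)\<^sup>2" by (intro power_mono) auto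
      then show ?case by (simp add: power_mult_distrib)
    qed
  qed (use s f in auto)
  then have "(\<lambda>n. sqrt (\<integral>z. (cmod (s n z - f z))\<^sup>2 \<partial>torus_measure)) \<longlonglongrightarrow> sqrt 0"
    by (intro tendsto_real_sqrt) simp
  then have "(\<lambda>n. norm (abs_l2_torus (s n) - abs_l2_torus f)) \<longlonglongrightarrow> 0"
    by (simp add: diff_abs_l2 sq sqf norm_abs_l2 sq_integrable_diff)
  then show "(\<lambda>n. abs_l2_torus (s n)) \<longlonglongrightarrow> abs_l2_torus f"
    by (simp add: tendsto_norm_zero_iff LIM_zero_iff)
qed

section \<open>Fourier modes and trigonometric polynomials\<close>

text \<open>Removes the seam of the fundamental square, where the continuous approximations of
  indicators used below may fail to converge to them.\<close>

lemma torus_measure_AE_neq_0: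
  "AE z in torus_measure. fst z \<noteq> 0 \<and> snd z \<noteq> 0"
proof -
  have ae: "AE x in circle_measure. x \<noteq> 0"
    unfolding circle_measure_def by (subst AE_restrict_space_iff) (auto intro: AE_mp[OF AE_lborel_singleton[of 0]])
  show ?thesis
    unfolding torus_measure_def
  proof (rule torus.AE_pair_measure)
    show "{z \<in> space (circle_measure \<Otimes>\<^sub>M circle_measure). fst z \<noteq> 0 \<and> snd z \<noteq> 0} \<in> sets (circle_measure \<Otimes>\<^sub>M circle_measure)"
    proof -
      have [measurable]: "fst \<in> borel_measurable torus_measure" "snd \<in> borel_measurable torus_measure"
        by (auto intro!: borel_measurable_torusI borel_measurable_continuous_onI continuous_intros)
      have "{z \<in> space torus_measure. fst z \<noteq> 0 \<and> snd z \<noteq> 0} \<in> sets torus_measure"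
        by measurable
      then show ?thesis by (simp add: torus_measure_def)
    qed
    show "AE x in circle_measure. AE y in circle_measure. fst (x, y) \<noteq> 0 \<and> snd (x, y) \<noteq> 0"
      using ae by eventually_elim (use ae in simp)
  qed
qed

lemma circle_integral:
  fixes f :: "real \<Rightarrow> 'a :: euclidean_space"
  assumes "continuous_on {0..2*pi} f"
  shows "(\<integral>x. f x \<partial>circle_measure) = integral {0..2*pi} f"
proof -
  have si: "set_integrable lborel {0..2*pi} f"
    using borel_integrable_compact[OF compact_Icc assms] by (simp add: set_integrable_def)
  have "(\<integral>x. f x \<partial>circle_measure) = (\<integral>x. indicator {0..<2*pi} x *\<^sub>R f x \<partial>lborel)"
    unfolding circle_measure_def by (rule integral_restrict_space) simp
  also have "\<dots> = (\<integral>x. indicator {0..2*pi} x *\<^sub>R f x \<partial>lborel)"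
  proof (rule integral_cong_AE)
    show "(\<lambda>x. indicator {0..<2*pi} x *\<^sub>R f x) \<in> borel_measurable lborel"
    proof -
      have "set_integrable lborel {0..<2*pi} f"
        by (rule set_integrable_subset[OF si]) auto
      then show ?thesis unfolding set_integrable_def by (rule borel_measurable_integrable)
    qed
    show "AE x in lborel. indicator {0..<2*pi} x *\<^sub>R f x = indicator {0..2*pi} x *\<^sub>R f x"
      using AE_lborel_singleton[of "2*pi"] by eventually_elim (auto simp: indicator_def)
  qed (use si in \<open>auto simp: set_integrable_def\<close>)
  also have "\<dots> = integral {0..2*pi} f"
    using set_borel_integral_eq_integral(2)[OF si] by (simp add: set_lebesgue_integral_def)
  finally show ?thesis .
qed

lemma circle_integral_cis:
  "(\<integral>x. cis (of_int n * x) \<partial>circle_measure) = (if n = 0 then 2 * pi else 0)"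
proof -
  have "(\<integral>x. cis (of_int n * x) \<partial>circle_measure) = integral {0..2*pi} (\<lambda>x. cis (of_int n * x))"
    by (rule circle_integral) (intro continuous_intros)
  also have "\<dots> = (if n = 0 then 2 * pi else 0)"
  proof (cases "n = 0")
    case True
    then show ?thesis by (simp add: scaleR_conv_of_real)
  next
    case False
    define g where "g x = cis (of_int n * x) / (\<i> * of_int n)" for x
    have "(g has_vector_derivative cis (of_int n * x)) (at x within {0..2*pi})" for x
      unfolding g_def cis_conv_exp using False
      by (auto intro!: derivative_eq_intros has_vector_derivative_real_field simp: field_simps)
    then have "((\<lambda>x. cis (of_int n * x)) has_integral (g (2 * pi) - g 0)) {0..2*pi}"
      by (intro fundamental_theorem_of_calculus) auto
    moreover have "g (2 * pi) = g 0"
      by (simp add: g_def cis.ctr complex_eq_iff mult.commute[of _ "2*pi"] cos_int_2pin sin_int_2pin)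
    ultimately show ?thesis using False by (simp add: integral_unique)
  qed
  finally show ?thesis .
qed

lemma torus_integral_xy:
  fixes f :: "real \<times> real \<Rightarrow> complex"
  assumes "integrable torus_measure f"
  shows "(\<integral>z. f z \<partial>torus_measure) = (\<integral>x. (\<integral>y. f (x, y) \<partial>circle_measure) \<partial>circle_measure)"
  using torus.integral_fst'[of f] assms by (simp add: torus_measure_def)

lemma torus_integral_yx:
  fixes f :: "real \<times> real \<Rightarrow> complex"
  assumes "integrable torus_measure f"
  shows "(\<integral>z. f z \<partial>torus_measure) = (\<integral>y. (\<integral>x. f (x, y) \<partial>circle_measure) \<partial>circle_measure)"
  using torus.integral_snd[of "\<lambda>x y. f (x, y)"] assms by (simp add: torus_measure_def)

lemma sq_integrable_bounded_on:
  assumes "f \<in> borel_measurable torus_measure" "\<And>z. z \<in> space torus_measure \<Longrightarrow> cmod (f z) \<le> B"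
  shows "sq_integrable f"
  unfolding sq_integrable_def
proof
  show "integrable torus_measure (\<lambda>z. (cmod (f z))\<^sup>2)"
  proof (rule torus_fin.integrable_const_bound[of _ "B\<^sup>2"])
    show "AE x in torus_measure. norm ((cmod (f x))\<^sup>2) \<le> B\<^sup>2"
      by (rule AE_I2) (use assms(2) in \<open>simp add: power_mono del: space_torus\<close>)
  qed (use assms in auto)
qed (fact assms)

lemma continuous_bounded_on_torus:
  fixes f :: "real \<times> real \<Rightarrow> 'a :: real_normed_vector"
  assumes "continuous_on UNIV f"
  shows "\<exists>B. \<forall>z\<in>space torus_measure. norm (f z) \<le> B"
proof -
  have "compact (f ` ({0..2*pi} \<times> {0..2*pi}))"
    by (intro compact_continuous_image compact_Times compact_Icc continuous_on_subset[OF assms]) auto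
  then obtain B where "\<forall>w\<in>f ` ({0..2*pi} \<times> {0..2*pi}). norm w \<le> B"
    using compact_imp_bounded bounded_iff by metis
  then show ?thesis by (intro exI[of _ B]) auto
qed

lemma sq_integrable_continuous:
  assumes "continuous_on UNIV f"
  shows "sq_integrable f"
proof -
  obtain B where "\<forall>z\<in>space torus_measure. norm (f z) \<le> B"
    using continuous_bounded_on_torus[OF assms] by blast
  then show ?thesis
    by (intro sq_integrable_bounded_on[of f B] borel_measurable_torusI borel_measurable_continuous_onI assms) auto
qed

lemma measure_torus: "measure torus_measure (space torus_measure) = (2 * pi)\<^sup>2"
proof -
  have "emeasure torus_measure (space torus_measure) = ennreal (2 * pi) * ennreal (2 * pi)"
    unfolding torus_measure_def space_pair_measure
    by (subst circle.emeasure_pair_measure_Times) (auto simp: emeasure_circle_space simp del: space_circle)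
  then show ?thesis
    by (simp add: measure_def ennreal_mult[symmetric] power2_eq_square)
qed

lemma norm_abs_l2_le:
  assumes f: "f \<in> borel_measurable torus_measure" and "\<And>z. z \<in> space torus_measure \<Longrightarrow> cmod (f z) \<le> B"
  shows "norm (abs_l2_torus f) \<le> 2 * pi * \<bar>B\<bar>"
proof -
  have sq: "sq_integrable f" by (rule sq_integrable_bounded_on[OF assms])
  have "(\<integral>z. (cmod (f z))\<^sup>2 \<partial>torus_measure) \<le> (\<integral>z. B\<^sup>2 \<partial>torus_measure)"
    by (rule integral_mono) (use sq assms in \<open>auto simp: sq_integrable_def intro!: power_mono\<close>)
  also have "\<dots> = (2 * pi * \<bar>B\<bar>)\<^sup>2"
    by (simp add: measure_torus[simplified] power_mult_distrib)
  finally show ?thesis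
    unfolding norm_abs_l2[OF sq] by (intro real_le_lsqrt) auto
qed

definition tmode :: "int \<Rightarrow> int \<Rightarrow> real \<times> real \<Rightarrow> complex" where
  "tmode j m z = cis (of_int j * fst z) * cis (of_int m * snd z)"

definition emode :: "int \<Rightarrow> int \<Rightarrow> l2_torus" where
  "emode j m = abs_l2_torus (tmode j m)"

text \<open>Embeds functions of \<open>y\<close> as the \<open>k\<close>-th mode in
  \<open>x\<close>. Norms are multiplied by \<open>sqrt (2 * pi)\<close>, so homogeneous estimates
  on the circle carry over unchanged.\<close>

definition slice :: "int \<Rightarrow> (real \<Rightarrow> complex) \<Rightarrow> l2_torus" where
  "slice k Q = abs_l2_torus (\<lambda>z. cis (of_int k * fst z) * Q (snd z))"

lemma continuous_on_tmode: "continuous_on A (tmode j m)"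
  unfolding tmode_def by (intro continuous_intros)

lemma sq_integrable_tmode [simp, intro]: "sq_integrable (tmode j m)"
  by (intro sq_integrable_continuous continuous_on_tmode)

lemma continuous_on_slice:
  assumes "continuous_on UNIV Q"
  shows "continuous_on A (\<lambda>z. cis (of_int k * fst z) * Q (snd z))"
  by (intro continuous_intros continuous_on_compose2[OF assms]) auto

lemma herm_slice:
  assumes P: "continuous_on UNIV P" and Q: "continuous_on UNIV Q"
  shows "herm (slice j P) (slice k Q) = (if j = k then 2 * pi * integral {0..2*pi} (\<lambda>y. P y * cnj (Q y)) else 0)"
proof -
  note sq = sq_integrable_continuous[OF continuous_on_slice]
  have "herm (slice j P) (slice k Q) = (\<integral>z. (cis (of_int j * fst z) * P (snd z)) * cnj (cis (of_int k * fst z) * Q (snd z)) \<partial>torus_measure)"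
    unfolding slice_def by (rule herm_abs[OF sq[OF P] sq[OF Q]])
  also have "\<dots> = (\<integral>y. (\<integral>x. cis (of_int (j - k) * x) * (P y * cnj (Q y)) \<partial>circle_measure) \<partial>circle_measure)"
  proof (subst torus_integral_yx)
    have pt: "cis (of_int j * x) * P y * cnj (cis (of_int k * x) * Q y) = cis (of_int (j - k) * x) * (P y * cnj (Q y))" for x y
    proof -
      have "cis (of_int j * x) * P y * cnj (cis (of_int k * x) * Q y) = (cis (of_int j * x) * cis (- (of_int k * x))) * (P y * cnj (Q y))"
        by (simp add: cis_cnj)
      then show ?thesis by (simp only: cis_mult) (simp add: left_diff_distrib)
    qed
    show "(\<integral>y. (\<integral>x. cis (of_int j * fst (x, y)) * P (snd (x, y)) * cnj (cis (of_int k * fst (x, y)) * Q (snd (x, y))) \<partial>circle_measure) \<partial>circle_measure)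
      = (\<integral>y. (\<integral>x. cis (of_int (j - k) * x) * (P y * cnj (Q y)) \<partial>circle_measure) \<partial>circle_measure)"
      by (simp only: pt fst_conv snd_conv)
  qed (intro integrable_mult_sq_integrable sq_integrable_cnj sq[OF P] sq[OF Q])
  also have "\<dots> = (if j = k then 2 * pi else 0) * (\<integral>y. P y * cnj (Q y) \<partial>circle_measure)"
    by (simp add: circle_integral_cis del: of_int_diff)
  also have "(\<integral>y. P y * cnj (Q y) \<partial>circle_measure) = integral {0..2*pi} (\<lambda>y. P y * cnj (Q y))"
    by (intro circle_integral continuous_intros continuous_on_subset[OF P] continuous_on_subset[OF Q]) auto
  finally show ?thesis by simp
qed

lemma emode_slice: "emode k m = slice k (\<lambda>y. cis (of_int m * y))"
  by (simp add: emode_def slice_def tmode_def[abs_def])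

lemma herm_emode: "herm (emode j m) (emode k n) = (if j = k \<and> m = n then 4 * pi\<^sup>2 else 0)"
proof -
  have "integral {0..2*pi} (\<lambda>y. cis (of_int m * y) * cnj (cis (of_int n * y))) = integral {0..2*pi} (\<lambda>y. cis (of_int (m - n) * y))"
    by (simp add: cis_cnj cis_mult left_diff_distrib)
  also have "\<dots> = (\<integral>y. cis (of_int (m - n) * y) \<partial>circle_measure)"
    by (rule circle_integral[symmetric]) (intro continuous_intros)
  finally show ?thesis
    unfolding emode_slice
    by (subst herm_slice) (auto intro!: continuous_intros simp: circle_integral_cis power2_eq_square simp del: of_int_diff)
qed

lemma norm_slice:
  assumes Q: "continuous_on UNIV Q"
  shows "(norm (slice k Q))\<^sup>2 = 2 * pi * l2sq Q"
proof -
  have "integral {0..2*pi} (\<lambda>y. Q y * cnj (Q y)) = integral {0..2*pi} (\<lambda>y. complex_of_real ((cmod (Q y))\<^sup>2))"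
    by (simp only: complex_norm_square)
  also have "\<dots> = of_real (l2sq Q)"
    by (intro integral_linear[OF _ bounded_linear_of_real, unfolded o_def] integrable_continuous_interval
        continuous_intros continuous_on_subset[OF Q]) auto
  finally have "herm (slice k Q) (slice k Q) = of_real (2 * pi * l2sq Q)"
    by (simp add: herm_slice[OF Q Q])
  then show ?thesis unfolding herm_self of_real_eq_iff .
qed

section \<open>Trigonometric polynomials and uniform approximation\<close>

inductive trig :: "(real \<times> real \<Rightarrow> complex) \<Rightarrow> bool" where
  trig_mode: "trig (\<lambda>z. c * tmode j m z)"
| trig_add: "trig f \<Longrightarrow> trig g \<Longrightarrow> trig (\<lambda>z. f z + g z)"

lemma trig_const: "trig (\<lambda>z. c)"
  using trig_mode[of c 0 0] by (simp add: tmode_def)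

lemma trig_mult:
  assumes "trig f" "trig g"
  shows "trig (\<lambda>z. f z * g z)"
  using assms
proof (induction f)
  case (trig_mode c j m)
  from \<open>trig g\<close> show ?case
  proof (induction g)
    case (trig_mode d j' m')
    have "(\<lambda>z. c * tmode j m z * (d * tmode j' m' z)) = (\<lambda>z. (c * d) * tmode (j + j') (m + m') z)"
    proof
      fix z :: "real \<times> real"
      have "c * tmode j m z * (d * tmode j' m' z) = (c * d) * ((cis (of_int j * fst z) * cis (of_int j' * fst z)) * (cis (of_int m * snd z) * cis (of_int m' * snd z)))"
        by (simp only: tmode_def mult_ac)
      then show "c * tmode j m z * (d * tmode j' m' z) = (c * d) * tmode (j + j') (m + m') z"
        by (simp only: cis_mult tmode_def of_int_add distrib_right)
    qed
    then show ?case by (simp only: trig.trig_mode)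
  qed (simp add: distrib_left trig.trig_add)
qed (simp add: distrib_right trig.trig_add)

text \<open>\<open>span\<close> is taken over the reals, hence all complex multiples of the
  exponentials are listed as generators.\<close>

definition trig_space :: "l2_torus set" where
  "trig_space = span {cscale c (emode j m) | c j m. True}"

lemma trig_continuous_span:
  assumes "trig f"
  shows "continuous_on UNIV f \<and> abs_l2_torus f \<in> trig_space"
  using assms
proof induction
  case (trig_mode c j m)
  have "abs_l2_torus (\<lambda>z. c * tmode j m z) = cscale c (emode j m)"
    unfolding cscale_def emode_def by (rule mul_abs[symmetric]) auto
  then show ?case
    unfolding trig_space_def by (auto intro!: continuous_intros continuous_on_tmode span_base)
next
  case (trig_add f g)
  then show ?case
    unfolding trig_space_def
    by (auto simp: add_abs_l2[symmetric] sq_integrable_continuous intro!: continuous_intros span_add)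
qed

text \<open>Induction over polynomials on two complex planes, pulled back by the embedding of the
  torus. A real linear functional becomes a combination of cosines and sines, which Euler's formula
  turns into exponentials; \<open>trig_mult\<close> handles products.\<close>

lemma trig_polynomial:
  fixes p :: "complex \<times> complex \<Rightarrow> real"
  assumes "real_polynomial_function p"
  shows "trig (\<lambda>z. of_real (p (cis (fst z), cis (snd z))))"
  using assms
proof induction
  case (linear h)
  interpret h: bounded_linear h by fact
  have hexp: "h (a, b) = Re a * h (1, 0) + Im a * h (\<i>, 0) + Re b * h (0, 1) + Im b * h (0, \<i>)" for a b
  proof -
    have "(a, b) = Re a *\<^sub>R (1, 0) + Im a *\<^sub>R (\<i>, 0) + Re b *\<^sub>R (0, 1) + Im b *\<^sub>R (0, \<i>)"
      by (simp add: complex_eq_iff)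
    from arg_cong[OF this, of h] show ?thesis by (simp only: h.add h.scaleR real_scaleR_def)
  qed
  have eq: "(\<lambda>z. complex_of_real (h (cis (fst z), cis (snd z)))) =
      (\<lambda>z. of_real (cos (fst z)) * of_real (h (1, 0)) + of_real (sin (fst z)) * of_real (h (\<i>, 0))
       + of_real (cos (snd z)) * of_real (h (0, 1)) + of_real (sin (snd z)) * of_real (h (0, \<i>)))"
  proof
    fix z :: "real \<times> real"
    show "complex_of_real (h (cis (fst z), cis (snd z))) = of_real (cos (fst z)) * of_real (h (1, 0)) + of_real (sin (fst z)) * of_real (h (\<i>, 0))
       + of_real (cos (snd z)) * of_real (h (0, 1)) + of_real (sin (snd z)) * of_real (h (0, \<i>))"
      using hexp[of "cis (fst z)" "cis (snd z)"] by simp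
  qed
  have C: "complex_of_real (cos t) = 1 / 2 * cis t + 1 / 2 * cis (- t)"
    and S: "complex_of_real (sin t) = - \<i> / 2 * cis t + \<i> / 2 * cis (- t)" for t
    by (auto simp: complex_eq_iff)
  have "(\<lambda>z. of_real (cos (fst z))) = (\<lambda>z. 1 / 2 * tmode 1 0 z + 1 / 2 * tmode (-1) 0 z)"
    "(\<lambda>z. of_real (sin (fst z))) = (\<lambda>z. - \<i> / 2 * tmode 1 0 z + \<i> / 2 * tmode (-1) 0 z)"
    "(\<lambda>z. of_real (cos (snd z))) = (\<lambda>z. 1 / 2 * tmode 0 1 z + 1 / 2 * tmode 0 (-1) z)"
    "(\<lambda>z. of_real (sin (snd z))) = (\<lambda>z. - \<i> / 2 * tmode 0 1 z + \<i> / 2 * tmode 0 (-1) z)"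
    by (simp_all only: fun_eq_iff tmode_def C S of_int_1 of_int_minus of_int_0 mult_1 mult_zero_left
        cis_zero mult_1_right mult_minus_left simp_thms)
  then have "trig (\<lambda>z. of_real (cos (fst z)))" "trig (\<lambda>z. of_real (sin (fst z)))"
    "trig (\<lambda>z. of_real (cos (snd z)))" "trig (\<lambda>z. of_real (sin (snd z)))"
    by (simp_all only: trig.intros)
  then show ?case unfolding eq by (intro trig_add trig_mult trig_const)
next
  case (mult f g)
  then show ?case using trig_mult by simp
qed (simp_all add: trig_const trig_add)

lemma subspace_closure:
  fixes S :: "'a :: real_normed_vector set"
  assumes S: "subspace S"
  shows "subspace (closure S)"
proof (rule subspaceI)
  show "0 \<in> closure S" using S closure_subset subspace_0 by blast
next
  fix x y assume "x \<in> closure S" "y \<in> closure S"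
  then obtain f g where "\<And>n. f n \<in> S" "f \<longlonglongrightarrow> x" "\<And>n. g n \<in> S" "g \<longlonglongrightarrow> y"
    unfolding closure_sequential by blast
  then show "x + y \<in> closure S"
    unfolding closure_sequential by (intro exI[of _ "\<lambda>n. f n + g n"]) (auto intro: tendsto_add subspace_add[OF S])
next
  fix c x assume "x \<in> closure S"
  then obtain f where "\<And>n. f n \<in> S" "f \<longlonglongrightarrow> x"
    unfolding closure_sequential by blast
  then show "c *\<^sub>R x \<in> closure S"
    unfolding closure_sequential by (intro exI[of _ "\<lambda>n. c *\<^sub>R f n"]) (auto intro: tendsto_intros subspace_scale[OF S])
qed

lemma subspace_closure_trig_space: "subspace (closure trig_space)"
  unfolding trig_space_def by (rule subspace_closure) simp

lemma cscale_closure_trig_space: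
  assumes "F \<in> closure trig_space"
  shows "cscale c F \<in> closure trig_space"
proof -
  have "cscale c ` trig_space \<subseteq> trig_space"
  proof
    fix G assume "G \<in> cscale c ` trig_space"
    then obtain H where H: "H \<in> trig_space" "G = cscale c H" by blast
    have "cscale c H \<in> trig_space"
      using H(1) unfolding trig_space_def
    proof (induction rule: span_induct_alt)
      case base
      then show ?case using linear_0[OF bounded_linear.linear[OF bounded_linear_cscale]] by (simp add: span_zero)
    next
      case (step r x y)
      obtain d j m where x: "x = cscale d (emode j m)" using step by blast
      have "cscale c (r *\<^sub>R x + y) = r *\<^sub>R cscale (c * d) (emode j m) + cscale c y"
        unfolding x by (simp add: cscale_add_right cscale_of_real[symmetric] mult_ac)
      moreover have "r *\<^sub>R cscale (c * d) (emode j m) \<in> span {cscale c (emode j m) |c j m. True}"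
        by (intro span_scale span_base) blast
      ultimately show ?case using step by (simp add: span_add)
    qed
    then show "G \<in> trig_space" using H by simp
  qed
  moreover have "cscale c ` closure trig_space \<subseteq> closure (cscale c ` trig_space)"
    by (intro image_closure_subset closed_closure closure_subset)
      (rule linear_continuous_on[OF bounded_linear_cscale])
  ultimately show ?thesis using assms closure_mono by blast
qed

text \<open>Writing the function through \<open>cis\<close> builds in periodicity, so
  Stone-Weierstrass applies to \<open>G\<close> on a product of two unit circles.\<close>

lemma continuous_in_closure_trig_space:
  fixes G :: "complex \<times> complex \<Rightarrow> real"
  assumes G: "continuous_on UNIV G"
  shows "abs_l2_torus (\<lambda>z. of_real (G (cis (fst z), cis (snd z)))) \<in> closure trig_space"
proof (unfold closure_approachable, intro allI impI)
  fix \<epsilon> :: real assume \<epsilon>: "\<epsilon> > 0"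
  let ?f = "\<lambda>z. complex_of_real (G (cis (fst z), cis (snd z)))"
  have cf: "continuous_on UNIV ?f"
    by (intro continuous_intros continuous_on_compose2[OF G]) auto
  define S where "S = sphere (0::complex) 1 \<times> sphere (0::complex) 1"
  have "compact S" unfolding S_def by (intro compact_Times compact_sphere)
  \<comment> \<open>The norm on the square is at most \<open>2 * pi\<close> times the supremum; as
    \<open>pi < 4\<close>, the uniform error \<open>\<epsilon> / 8\<close> is small enough.\<close>
  then obtain p where p: "real_polynomial_function p" "\<And>x. x \<in> S \<Longrightarrow> \<bar>G x - p x\<bar> < \<epsilon> / 8"
    using Stone_Weierstrass_real_polynomial_function[of S G "\<epsilon> / 8"] continuous_on_subset[OF G] \<epsilon> by auto
  let ?g = "\<lambda>z. complex_of_real (p (cis (fst z), cis (snd z)))"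
  have g: "continuous_on UNIV ?g" "abs_l2_torus ?g \<in> trig_space"
    using trig_continuous_span[OF trig_polynomial[OF p(1)]] by auto
  have "norm (abs_l2_torus ?g - abs_l2_torus ?f) = norm (abs_l2_torus (\<lambda>z. ?g z - ?f z))"
    by (simp only: diff_abs_l2 sq_integrable_continuous g cf)
  also have "\<dots> \<le> 2 * pi * \<bar>\<epsilon> / 8\<bar>"
  proof (rule norm_abs_l2_le)
    show "(\<lambda>z. ?g z - ?f z) \<in> borel_measurable torus_measure"
      by (intro borel_measurable_torusI borel_measurable_continuous_onI continuous_intros g cf)
    fix z :: "real \<times> real"
    have "(cis (fst z), cis (snd z)) \<in> S" by (simp add: S_def)
    from p(2)[OF this] show "cmod (?g z - ?f z) \<le> \<epsilon> / 8"
      unfolding of_real_diff[symmetric] norm_of_real by (simp add: abs_minus_commute)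
  qed
  also have "\<dots> < \<epsilon>" using \<epsilon> mult_strict_right_mono[OF pi_less_4, of "\<epsilon>"] by simp
  finally show "\<exists>y\<in>trig_space. dist y (abs_l2_torus ?f) < \<epsilon>"
    using g(2) by (auto simp: dist_norm)
qed

section \<open>Density of trigonometric polynomials\<close>

text \<open>The approximations live on the complex plane so that they can be composed with
  \<open>cis\<close>. The angle 0 is exempt: the ramp constructed below vanishes there, whereas the
  indicator of an initial segment is 1.\<close>

definition circ_approx :: "real set \<Rightarrow> (nat \<Rightarrow> complex \<Rightarrow> real) \<Rightarrow> bool" where
  "circ_approx A g \<longleftrightarrow> (\<forall>n. continuous_on UNIV (g n)) \<and> (\<forall>n z. \<bar>g n z\<bar> \<le> 1) \<and>
     (\<forall>x\<in>{0<..<2*pi}. (\<lambda>n. g n (cis x)) \<longlonglongrightarrow> indicator A x)"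

text \<open>
  For \<open>0 < a < 2\<pi>\<close> and \<open>0 < x < 2\<pi>\<close> one has \<open>x < a\<close> iff
  \<open>cos (x - a/2) - cos (a/2) = 2 sin (x/2) sin ((a - x)/2)\<close> is positive.
\<close>

lemma circ_approx_exists: "\<exists>g. circ_approx ({0..<2*pi} \<inter> {..<a}) g"
proof -
  consider "a \<le> 0" | "a \<ge> 2 * pi" | "0 < a" "a < 2 * pi" by linarith
  then show ?thesis
  proof cases
    case 1
    then have "{0..<2*pi} \<inter> {..<a} = {}" by auto
    then show ?thesis by (intro exI[of _ "\<lambda>_ _. 0"]) (simp add: circ_approx_def)
  next
    case 2
    then show ?thesis by (intro exI[of _ "\<lambda>_ _. 1"]) (auto simp: circ_approx_def indicator_def)
  next
    case 3
    define d where "d x = cos (x - a / 2) - cos (a / 2)" for x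
    \<comment> \<open>Clipping \<open>n * max 0 (d x)\<close> at 1 tends, as \<open>n\<close> grows,
      to the indicator of the set where \<open>d x\<close> is positive.\<close>
    define g where "g n z = min 1 (real n * max 0 (Re (z * cis (- a / 2)) - cos (a / 2)))" for n z
    have gd: "g n (cis x) = min 1 (real n * max 0 (d x))" for n x
      by (simp add: g_def d_def cis_mult)
    have "(\<lambda>n. g n (cis x)) \<longlonglongrightarrow> indicator ({0..<2*pi} \<inter> {..<a}) x" if x: "x \<in> {0<..<2*pi}" for x
    proof -
      have dx: "d x = 2 * sin (x / 2) * sin ((a - x) / 2)"
      proof -
        have "(x - a / 2 + a / 2) / 2 = x / 2" "(a / 2 - (x - a / 2)) / 2 = (a - x) / 2"
          by (simp_all add: field_simps)
        then show ?thesis unfolding d_def cos_diff_cos by (simp only:)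
      qed
      have s: "sin (x / 2) > 0" by (rule sin_gt_zero) (use x in auto)
      show ?thesis
      proof (cases "x < a")
        case True
        have "sin ((a - x) / 2) > 0" by (rule sin_gt_zero) (use x True 3 in auto)
        then have pos: "d x > 0" using s by (simp add: dx)
        have "eventually (\<lambda>n. g n (cis x) = 1) sequentially"
          using eventually_ge_at_top[of "nat \<lceil>1 / d x\<rceil>"]
        proof eventually_elim
          case (elim n)
          then have "1 / d x \<le> real n" by linarith
          then have "1 \<le> real n * d x" using pos by (simp add: field_simps)
          then show ?case unfolding gd using pos by simp
        qed
        then show ?thesis using True x by (auto intro: tendsto_eventually)
      next
        case False
        have "sin ((x - a) / 2) \<ge> 0" by (rule sin_ge_zero) (use x False 3 in auto)
        then have "sin ((a - x) / 2) \<le> 0" using sin_minus[of "(x - a) / 2"] by (simp add: minus_divide_left)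
        then have "d x \<le> 0" using s by (simp add: dx mult_nonneg_nonpos)
        then have "g n (cis x) = 0" for n unfolding gd by simp
        then show ?thesis using False by simp
      qed
    qed
    moreover have "continuous_on UNIV (g n)" for n unfolding g_def by (intro continuous_intros)
    moreover have "\<bar>g n z\<bar> \<le> 1" for n z unfolding g_def by simp
    ultimately show ?thesis by (intro exI[of _ g]) (simp add: circ_approx_def)
  qed
qed

text \<open>Initial segments are stable under intersection, which the induction over disjoint unions
  requires of a generator.\<close>

definition circ_gen :: "real set set" where
  "circ_gen = range (\<lambda>a. {0..<2*pi} \<inter> {..<a})"

lemma circ_approx_gen: "A \<in> circ_gen \<Longrightarrow> \<exists>g. circ_approx A g"
  using circ_approx_exists by (auto simp: circ_gen_def)

lemma sets_circle: "sets circle_measure = sigma_sets {0..<2*pi} circ_gen"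
proof -
  have "sets circle_measure = (\<inter>) {0..<2*pi} ` sigma_sets UNIV (range lessThan)"
    unfolding circle_measure_def sets_restrict_space sets_lborel by (subst borel_Iio) simp
  also have "\<dots> = sigma_sets {0..<2*pi} ((\<inter>) {0..<2*pi} ` range lessThan)"
  proof (rule sigma_sets_Int)
    have "{0..<2*pi} \<in> sets (borel :: real measure)" by simp
    then show "{0..<2*pi::real} \<in> sigma_sets UNIV (range lessThan)"
      by (subst (asm) borel_Iio) simp
  qed simp
  finally show ?thesis by (simp add: circ_gen_def image_image)
qed

lemma sets_torus:
  "sets torus_measure = sigma_sets ({0..<2*pi} \<times> {0..<2*pi}) {A \<times> B | A B. A \<in> circ_gen \<and> B \<in> circ_gen}"
proof -
  have full: "{0..<2*pi} \<in> circ_gen" by (auto simp: circ_gen_def intro!: image_eqI[of _ _ "2*pi"])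
  have sub: "circ_gen \<subseteq> Pow (space circle_measure)" by (auto simp: circ_gen_def)
  have "sets torus_measure = sets (sigma (space circle_measure \<times> space circle_measure) {A \<times> B | A B. A \<in> circ_gen \<and> B \<in> circ_gen})"
    unfolding torus_measure_def
    by (rule sets_pair_eq[where Ca = "{{0..<2*pi}}" and Cb = "{{0..<2*pi}}"])
      (use sub full in \<open>auto simp: sets_circle\<close>)
  also have "\<dots> = sigma_sets ({0..<2*pi} \<times> {0..<2*pi}) {A \<times> B | A B. A \<in> circ_gen \<and> B \<in> circ_gen}"
    unfolding space_circle by (rule sets_measure_of) (use sub in auto)
  finally show ?thesis .
qed

lemma indicator_bound_l2:
  assumes "A \<in> sets torus_measure"
  shows "sq_integrable (indicator A)" "(indicator A :: _ \<Rightarrow> complex) \<in> borel_measurable torus_measure"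
  using assms by (auto intro!: sq_integrable_bounded[of _ 1] borel_measurable_indicator simp: indicator_def)

lemma abs_l2_sum:
  assumes "finite W" "\<And>v. v \<in> W \<Longrightarrow> sq_integrable (f v)"
  shows "sq_integrable (\<lambda>z. \<Sum>v\<in>W. f v z) \<and> abs_l2_torus (\<lambda>z. \<Sum>v\<in>W. f v z) = (\<Sum>v\<in>W. abs_l2_torus (f v))"
  using assms
proof (induction W rule: finite_induct)
  case empty
  then show ?case by (simp add: zero_l2_torus_def sq_integrable_zero)
next
  case (insert v W)
  then show ?case by (simp add: add_abs_l2[symmetric] sq_integrable_add)
qed

text \<open>Dynkin's argument: the sets with this property contain the products of initial segments,
  by approximation with continuous functions, and are closed under complements and disjoint
  countable unions, by linearity and dominated convergence.\<close>

lemma indicator_in_closure_trig_space: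
  assumes "A \<in> sets torus_measure"
  shows "abs_l2_torus (indicator A) \<in> closure trig_space"
proof -
  let ?V = "closure trig_space"
  have lim: "f \<longlonglongrightarrow> l \<Longrightarrow> (\<And>n. f n \<in> ?V) \<Longrightarrow> l \<in> ?V" for f l
    using closed_sequentially[OF closed_closure] by metis
  let ?\<Omega> = "{0..<2*pi} \<times> {0..<2*pi}"
  let ?G = "{A \<times> B | A B. A \<in> circ_gen \<and> B \<in> circ_gen}"
  have "Int_stable ?G"
  proof (rule Int_stableI, clarify)
    fix A B C D assume "A \<in> circ_gen" "B \<in> circ_gen" "C \<in> circ_gen" "D \<in> circ_gen"
    moreover have "X \<inter> Y \<in> circ_gen" if "X \<in> circ_gen" "Y \<in> circ_gen" for X Y
    proof -
      obtain a b where "X = {0..<2*pi} \<inter> {..<a}" "Y = {0..<2*pi} \<inter> {..<b}" using \<open>X \<in> circ_gen\<close> \<open>Y \<in> circ_gen\<close> by (auto simp: circ_gen_def)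
      then have "X \<inter> Y = {0..<2*pi} \<inter> {..<min a b}" by auto
      then show ?thesis by (auto simp: circ_gen_def)
    qed
    ultimately show "\<exists>A' B'. (A \<times> B) \<inter> (C \<times> D) = A' \<times> B' \<and> A' \<in> circ_gen \<and> B' \<in> circ_gen"
      by (intro exI[of _ "A \<inter> C"] exI[of _ "B \<inter> D"]) auto
  qed
  moreover have "?G \<subseteq> Pow ?\<Omega>" by (auto simp: circ_gen_def)
  moreover have "A \<in> sigma_sets ?\<Omega> ?G" using assms by (simp add: sets_torus)
  ultimately show ?thesis
  proof (induction rule: sigma_sets_induct_disjoint)
    case (basic X)
    then obtain A B where X: "X = A \<times> B" and AB: "A \<in> circ_gen" "B \<in> circ_gen" by blast
    then obtain g h where g: "circ_approx A g" and h: "circ_approx B h"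
      using circ_approx_gen by metis
    have Xs: "X \<in> sets torus_measure"
      unfolding sets_torus using basic by (rule sigma_sets.Basic)
    have cg: "continuous_on UNIV (g n)" and ch: "continuous_on UNIV (h n)" for n
      using g h by (simp_all add: circ_approx_def)
    let ?s = "\<lambda>n z. complex_of_real (g n (cis (fst z)) * h n (cis (snd z)))"
    have c: "continuous_on UNIV (\<lambda>w. g n (fst w) * h n (snd w))" for n
      by (intro continuous_on_mult continuous_on_compose2[OF cg] continuous_on_compose2[OF ch] continuous_intros) auto
    have inV: "abs_l2_torus (?s n) \<in> ?V" for n
      using continuous_in_closure_trig_space[OF c[of n]] by simp
    have "(\<lambda>n. abs_l2_torus (?s n)) \<longlonglongrightarrow> abs_l2_torus (indicator X)"
    proof (rule l2_dominated_convergence(3)[where g = "\<lambda>_. 1"])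
      have "continuous_on UNIV (?s n)" for n
        by (intro continuous_on_of_real continuous_on_mult continuous_on_compose2[OF cg] continuous_on_compose2[OF ch] continuous_intros) auto
      then show "?s n \<in> borel_measurable torus_measure" for n
        by (intro borel_measurable_torusI borel_measurable_continuous_onI)
      show "(indicator X :: _ \<Rightarrow> complex) \<in> borel_measurable torus_measure" by (rule indicator_bound_l2(2)[OF Xs])
      show "AE z in torus_measure. (\<lambda>n. ?s n z) \<longlonglongrightarrow> indicator X z"
        using torus_measure_AE_neq_0 AE_space
      proof eventually_elim
        case (elim z)
        then have z: "fst z \<in> {0<..<2*pi}" "snd z \<in> {0<..<2*pi}" by auto
        have "(\<lambda>n. complex_of_real (g n (cis (fst z)) * h n (cis (snd z)))) \<longlonglongrightarrow> of_real (indicator A (fst z) * indicator B (snd z))"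
          using g h z unfolding circ_approx_def by (intro tendsto_intros) auto
        also have "complex_of_real (indicator A (fst z) * indicator B (snd z)) = indicator X z"
          by (cases z) (simp add: X indicator_def)
        finally show ?case .
      qed
      show "cmod (?s n z) \<le> 1" for n z
        using g h unfolding norm_of_real abs_mult circ_approx_def by (intro mult_le_one) auto
    qed simp
    then show ?case by (rule lim) (rule inV)
  next
    case empty
    have "abs_l2_torus (indicator {}) = 0"
      by (simp add: zero_l2_torus_def indicator_def[abs_def])
    then show ?case by (rule ssubst) (rule subspace_0[OF subspace_closure_trig_space])
  next
    case (compl X)
    have Xs: "X \<in> sets torus_measure" using compl by (simp add: sets_torus)
    have "abs_l2_torus (indicator (?\<Omega> - X)) = abs_l2_torus (\<lambda>z. 1 - indicator X z)"
    proof (rule abs_l2_eqI)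
      show "AE z in torus_measure. indicator (?\<Omega> - X) z = (1 - indicator X z :: complex)"
        by (rule AE_I2) (auto simp: indicator_def)
      show "sq_integrable (indicator (?\<Omega> - X))"
        using sets.compl_sets[OF Xs] by (intro indicator_bound_l2) simp
      show "sq_integrable (\<lambda>z. 1 - indicator X z)"
        by (intro sq_integrable_diff indicator_bound_l2 Xs sq_integrable_continuous continuous_intros)
    qed
    also have "\<dots> = abs_l2_torus (\<lambda>_. 1) - abs_l2_torus (indicator X)"
      by (intro diff_abs_l2[symmetric] indicator_bound_l2 Xs sq_integrable_continuous continuous_intros)
    also have "\<dots> \<in> ?V"
    proof (rule subspace_diff[OF subspace_closure_trig_space])
      show "abs_l2_torus (\<lambda>_. 1) \<in> ?V"
        using trig_continuous_span[OF trig_const[of 1]] closure_subset by blast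
    qed (rule compl)
    finally show ?case .
  next
    case (union X)
    have Xs: "X i \<in> sets torus_measure" for i using union(2) unfolding sets_torus by blast
    let ?s = "\<lambda>n z. \<Sum>i<n. indicator (X i) z :: complex"
    have s: "?s n = indicator (\<Union>i<n. X i)" for n
    proof
      fix z
      show "?s n z = indicator (\<Union>i<n. X i) z"
        by (rule indicator_UN_disjoint[symmetric]) (use union(1) in \<open>auto simp: disjoint_family_on_def\<close>)
    qed
    have inV: "abs_l2_torus (?s n) \<in> ?V \<and> sq_integrable (?s n)" for n
      using abs_l2_sum[of "{..<n}" "\<lambda>i. indicator (X i)"] union(3) Xs
      by (auto simp: indicator_bound_l2 intro: subspace_sum[OF subspace_closure_trig_space])
    have "(\<lambda>n. abs_l2_torus (?s n)) \<longlonglongrightarrow> abs_l2_torus (indicator (\<Union>i. X i))"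
    proof (rule l2_dominated_convergence(3)[where g = "\<lambda>_. 1"])
      show "?s n \<in> borel_measurable torus_measure" for n
        using inV by (auto simp: sq_integrable_def)
      show "(indicator (\<Union>i. X i) :: _ \<Rightarrow> complex) \<in> borel_measurable torus_measure"
        using Xs by (intro indicator_bound_l2(2)) auto
      show "AE z in torus_measure. (\<lambda>n. ?s n z) \<longlonglongrightarrow> indicator (\<Union>i. X i) z"
        unfolding fun_cong[OF s] by (intro AE_I2 LIMSEQ_indicator_UN)
      show "cmod (?s n z) \<le> 1" for n z unfolding fun_cong[OF s] by (simp add: indicator_def)
    qed simp
    then show ?case by (rule lim) (use inV in blast)
  qed
qed

text \<open>Simple functions are complex combinations of indicators, and every \<open>F\<close> is a
  dominated limit of simple functions.\<close>

lemma closure_trig_space: "closure trig_space = UNIV"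
proof -
  let ?V = "closure trig_space"
  have "F \<in> ?V" for F
  proof -
    have "rep_l2_torus F \<in> borel_measurable torus_measure" by simp
    from borel_measurable_implies_sequence_metric[OF this, of 0]
    obtain s where s: "\<And>i. simple_function torus_measure (s i)"
      "\<And>z. z \<in> space torus_measure \<Longrightarrow> (\<lambda>i. s i z) \<longlonglongrightarrow> rep_l2_torus F z"
      "\<And>i z. z \<in> space torus_measure \<Longrightarrow> cmod (s i z) \<le> 2 * cmod (rep_l2_torus F z)"
      unfolding dist_0_norm[symmetric] dist_commute[of 0] by metis
    \<comment> \<open>The domination in \<open>l2_dominated_convergence\<close> is required at every
      point, while \<open>s i\<close> is controlled only on the space of the measure.\<close>
    define s' where "s' i z = s i z * indicator (space torus_measure) z" for i z
    have s'm: "s' i \<in> borel_measurable torus_measure" for i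
      unfolding s'_def using borel_measurable_simple_function[OF s(1)] by measurable
    have s'V: "abs_l2_torus (s' i) \<in> ?V" for i
    proof -
      let ?A = "\<lambda>v. s i -` {v} \<inter> space torus_measure"
      have fin: "finite (s i ` space torus_measure)" and A: "?A v \<in> sets torus_measure" for v
        by (rule simple_functionD[OF s(1)])+
      have "s' i = (\<lambda>z. \<Sum>v\<in>s i ` space torus_measure. v * indicator (?A v) z)"
      proof
        fix z
        show "s' i z = (\<Sum>v\<in>s i ` space torus_measure. v * indicator (?A v) z)"
        proof (cases "z \<in> space torus_measure")
          case True
          then have "(\<Sum>v\<in>s i ` space torus_measure. v * indicator (?A v) z) = (\<Sum>v\<in>s i ` space torus_measure. if s i z = v then v else 0)"
            by (intro sum.cong) (auto simp: indicator_def)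
          also have "\<dots> = s i z" using fin True by (simp add: sum.delta)
          finally show ?thesis using True by (simp add: s'_def)
        qed (simp add: s'_def)
      qed
      moreover have "abs_l2_torus (\<lambda>z. \<Sum>v\<in>s i ` space torus_measure. v * indicator (?A v) z) \<in> ?V"
      proof -
        have sq: "sq_integrable (\<lambda>z. v * indicator (?A v) z)" for v
          by (rule sq_integrable_mult[OF bounded_multiplier_const indicator_bound_l2(1)[OF A]])
        have "abs_l2_torus (\<lambda>z. v * indicator (?A v) z) = cscale v (abs_l2_torus (indicator (?A v)))" for v
          unfolding cscale_def by (rule mul_abs[OF bounded_multiplier_const indicator_bound_l2(1)[OF A], symmetric])
        then have "abs_l2_torus (\<lambda>z. v * indicator (?A v) z) \<in> ?V" for v
          using cscale_closure_trig_space[OF indicator_in_closure_trig_space[OF A]] by simp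
        then have "(\<Sum>v\<in>s i ` space torus_measure. abs_l2_torus (\<lambda>z. v * indicator (?A v) z)) \<in> ?V"
          by (rule subspace_sum[OF subspace_closure_trig_space])
        then show ?thesis using abs_l2_sum[OF fin sq] by (simp only:)
      qed
      ultimately show ?thesis by (simp only:)
    qed
    have "(\<lambda>n. abs_l2_torus (s' n)) \<longlonglongrightarrow> abs_l2_torus (rep_l2_torus F)"
    proof (rule l2_dominated_convergence(3)[where g = "\<lambda>z. 2 * cmod (rep_l2_torus F z)"])
      show "integrable torus_measure (\<lambda>z. (2 * cmod (rep_l2_torus F z))\<^sup>2)"
        using sq_integrable_rep[of F] by (simp add: sq_integrable_def power_mult_distrib)
      show "AE z in torus_measure. (\<lambda>n. s' n z) \<longlonglongrightarrow> rep_l2_torus F z"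
        by (rule AE_I2) (use s(2) in \<open>simp add: s'_def del: space_torus\<close>)
      show "cmod (s' n z) \<le> 2 * cmod (rep_l2_torus F z)" for n z
        using s(3)[of z n] by (cases "z \<in> space torus_measure") (simp_all add: s'_def del: space_torus)
    qed (use s'm in auto)
    then show ?thesis using closed_sequentially[OF closed_closure, of "\<lambda>n. abs_l2_torus (s' n)"] s'V by simp
  qed
  then show ?thesis by blast
qed

section \<open>Fourier series\<close>

definition fcoef :: "l2_torus \<Rightarrow> int \<Rightarrow> int \<Rightarrow> complex" where
  "fcoef F j m = herm F (emode j m) / (4 * pi\<^sup>2)"

definition psum :: "nat \<Rightarrow> l2_torus \<Rightarrow> l2_torus" where
  "psum N F = (\<Sum>p\<in>{- int N..int N} \<times> {- int N..int N}. cscale (fcoef F (fst p) (snd p)) (emode (fst p) (snd p)))"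

lemma cscale_0 [simp]: "cscale 0 F = 0"
  using cscale_of_real[of 0 F] by simp

lemma cscale_zero_right [simp]: "cscale c 0 = 0"
  by (rule linear_0[OF bounded_linear.linear[OF bounded_linear_cscale]])

lemma fcoef_emode: "fcoef (cscale c (emode j m)) k n = (if j = k \<and> m = n then c else 0)"
  by (simp add: fcoef_def herm_emode)

lemma fcoef_add: "fcoef (F + G) j m = fcoef F j m + fcoef G j m"
  by (simp add: fcoef_def herm_add_left add_divide_distrib)

lemma fcoef_sum: "fcoef (\<Sum>p\<in>A. F p) j m = (\<Sum>p\<in>A. fcoef (F p) j m)"
  by (simp add: fcoef_def herm_linear_simps sum_divide_distrib)

lemma fcoef_0 [simp]: "fcoef 0 j m = 0"
  by (simp add: fcoef_def herm_linear_simps)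

lemma herm_emode_fcoef: "herm F (emode j m) = 4 * pi\<^sup>2 * fcoef F j m"
  by (simp add: fcoef_def)

lemma fcoef_psum: "fcoef (psum N F) j m = (if \<bar>j\<bar> \<le> int N \<and> \<bar>m\<bar> \<le> int N then fcoef F j m else 0)"
proof -
  let ?B = "{- int N..int N} \<times> {- int N..int N}"
  have "fcoef (psum N F) j m = (\<Sum>p\<in>?B. if p = (j, m) then fcoef F j m else 0)"
    unfolding psum_def fcoef_sum fcoef_emode by (intro sum.cong) auto
  also have "\<dots> = (if (j, m) \<in> ?B then fcoef F j m else 0)" by (simp add: sum.delta)
  finally show ?thesis by (auto simp: abs_le_iff)
qed

text \<open>Bessel's inequality: \<open>psum N F\<close> pairs with \<open>F\<close> as it does with
  itself, by orthogonality, and Cauchy-Schwarz gives the rest.\<close>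

lemma norm_psum_le: "norm (psum N F) \<le> norm F"
proof -
  have "herm (psum N F) (psum N F) = herm F (psum N F)"
    unfolding psum_def[of N F, THEN arg_cong[of _ _ "herm (psum N F)"]] psum_def[of N F, THEN arg_cong[of _ _ "herm F"]]
      herm_linear_simps
    by (intro sum.cong) (auto simp: herm_emode_fcoef fcoef_psum abs_le_iff)
  then have "(norm (psum N F))\<^sup>2 = F \<bullet> psum N F"
    using Re_herm by (metis power2_norm_eq_inner)
  also have "\<dots> \<le> norm F * norm (psum N F)" by (rule norm_cauchy_schwarz)
  finally show ?thesis by (smt (verit) norm_ge_zero power2_eq_square mult_le_cancel_right)
qed

lemma psum_add: "psum N (F + G) = psum N F + psum N G"
  by (simp add: psum_def fcoef_add cscale_add_left sum.distrib)

lemma psum_emode: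
  assumes "\<bar>j\<bar> \<le> int N" "\<bar>m\<bar> \<le> int N"
  shows "psum N (cscale c (emode j m)) = cscale c (emode j m)"
proof -
  let ?B = "{- int N..int N} \<times> {- int N..int N}"
  have "psum N (cscale c (emode j m)) = (\<Sum>p\<in>?B. if p = (j, m) then cscale c (emode j m) else 0)"
    unfolding psum_def fcoef_emode by (intro sum.cong) auto
  also have "\<dots> = cscale c (emode j m)" using assms by (simp add: sum.delta abs_le_iff)
  finally show ?thesis .
qed

lemma psum_trig_space:
  assumes "F \<in> trig_space"
  shows "\<exists>N0. \<forall>N\<ge>N0. psum N F = F"
  using assms unfolding trig_space_def
proof (induction rule: span_induct_alt)
  case base
  show ?case by (simp add: psum_def fcoef_def herm_linear_simps)
next
  case (step r x y)
  then obtain c j m N0 where x: "x = cscale c (emode j m)" and N0: "\<forall>N\<ge>N0. psum N y = y" by blast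
  have "psum N (r *\<^sub>R x + y) = r *\<^sub>R x + y" if "N \<ge> max N0 (max (nat \<bar>j\<bar>) (nat \<bar>m\<bar>))" for N
    using psum_emode[of j N m "of_real r * c"] N0 that
    by (auto simp: psum_add x cscale_of_real[symmetric])
  then show ?case by blast
qed

text \<open>On \<open>trig_space\<close> the partial sums are eventually exact; contractivity and
  density extend the convergence to all \<open>F\<close>.\<close>

lemma psum_tendsto: "(\<lambda>N. psum N F) \<longlonglongrightarrow> F"
proof (rule LIMSEQ_I)
  fix r :: real assume r: "r > 0"
  have "F \<in> closure trig_space" by (simp add: closure_trig_space)
  then obtain G where G: "G \<in> trig_space" "dist G F < r / 2"
    using r unfolding closure_approachable by (meson half_gt_zero)
  obtain N0 where N0: "\<forall>N\<ge>N0. psum N G = G" using psum_trig_space[OF G(1)] by blast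
  have "norm (psum N F - F) < r" if "N \<ge> N0" for N
  proof -
    have "psum N F = G + psum N (F - G)" using psum_add[of N G "F - G"] N0 that by simp
    then have "norm (psum N F - F) = norm (psum N (F - G) + (G - F))" by (simp add: algebra_simps)
    also have "\<dots> \<le> norm (psum N (F - G)) + norm (G - F)" by (rule norm_triangle_ineq)
    also have "\<dots> \<le> norm (F - G) + norm (G - F)" by (simp add: norm_psum_le)
    also have "\<dots> < r" using G(2) by (simp add: dist_norm norm_minus_commute)
    finally show ?thesis .
  qed
  then show "\<exists>no. \<forall>n\<ge>no. norm (psum n F - F) < r" by blast
qed

lemma l2_torus_eqI:
  assumes "\<And>j m. fcoef F j m = fcoef G j m"
  shows "F = G"
proof -
  have "psum N F = psum N G" for N by (simp add: psum_def assms)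
  then show ?thesis using psum_tendsto[of F] psum_tendsto[of G] LIMSEQ_unique by simp
qed

text \<open>Fubini with the \<open>x\<close> integral inside: orthogonality of exponentials in
  \<open>x\<close> leaves only \<open>j = k\<close>, and the factor \<open>2 * pi\<close> cancels
  the normalisation in \<open>mode_proj\<close>.\<close>

lemma fcoef_fourier_proj: "fcoef (fourier_proj k F) j m = (if j = k then fcoef F k m else 0)"
proof -
  define f where "f = rep_l2_torus F"
  have f: "sq_integrable f" by (simp add: f_def)
  have fm: "sq_integrable (mode_proj k f)" by (rule sq_integrable_mode_proj[OF f])
  have P: "fourier_proj k F = abs_l2_torus (mode_proj k f)"
    using fourier_proj.abs_eq[of f k] f by (simp add: f_def)
  define I where "I y = (\<integral>s. f (s, y) * cis (- of_int k * s) \<partial>circle_measure)" for y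
  have "herm (fourier_proj k F) (emode j m) = (\<integral>z. mode_proj k f z * cnj (tmode j m z) \<partial>torus_measure)"
    unfolding P emode_def by (rule herm_abs[OF fm]) simp
  also have "\<dots> = (\<integral>y. (\<integral>x. mode_proj k f (x, y) * cnj (tmode j m (x, y)) \<partial>circle_measure) \<partial>circle_measure)"
    by (intro torus_integral_yx integrable_mult_sq_integrable sq_integrable_cnj fm) simp
  also have "\<dots> = (\<integral>y. (if k = j then 1 else 0) * (I y * cis (- of_int m * y)) \<partial>circle_measure)"
  proof (rule arg_cong[where f = "integral\<^sup>L circle_measure"], rule ext)
    fix y
    have pt: "mode_proj k f (x, y) * cnj (tmode j m (x, y)) = cis (of_int (k - j) * x) * (I y * cis (- of_int m * y) / (2 * pi))" for x
    proof -
      have "mode_proj k f (x, y) * cnj (tmode j m (x, y)) = (cis (of_int k * x) * cis (- (of_int j * x))) * (I y * cis (- of_int m * y) / (2 * pi))"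
        by (simp add: mode_proj_def tmode_def I_def cis_cnj)
      then show ?thesis by (simp only: cis_mult) (simp add: left_diff_distrib)
    qed
    show "(\<integral>x. mode_proj k f (x, y) * cnj (tmode j m (x, y)) \<partial>circle_measure) = (if k = j then 1 else 0) * (I y * cis (- of_int m * y))"
      unfolding pt by (simp add: circle_integral_cis del: of_int_diff)
  qed
  also have "\<dots> = (if k = j then 1 else 0) * (\<integral>y. I y * cis (- of_int m * y) \<partial>circle_measure)"
    by simp
  also have "(\<integral>y. I y * cis (- of_int m * y) \<partial>circle_measure) = herm F (emode k m)"
  proof -
    have "herm F (emode k m) = (\<integral>z. f z * cnj (tmode k m z) \<partial>torus_measure)"
      unfolding emode_def f_def by (rule herm_abs_right) simp
    also have "\<dots> = (\<integral>y. (\<integral>x. f (x, y) * cnj (tmode k m (x, y)) \<partial>circle_measure) \<partial>circle_measure)"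
      by (intro torus_integral_yx integrable_mult_sq_integrable sq_integrable_cnj f) simp
    also have "\<dots> = (\<integral>y. I y * cis (- of_int m * y) \<partial>circle_measure)"
    proof (rule arg_cong[where f = "integral\<^sup>L circle_measure"], rule ext)
      fix y
      have "f (x, y) * cnj (tmode k m (x, y)) = f (x, y) * cis (- of_int k * x) * cis (- of_int m * y)" for x
        by (simp add: tmode_def cis_cnj)
      then show "(\<integral>x. f (x, y) * cnj (tmode k m (x, y)) \<partial>circle_measure) = I y * cis (- of_int m * y)"
        by (simp only: integral_mult_left_zero I_def)
    qed
    finally show ?thesis ..
  qed
  finally show ?thesis by (simp add: fcoef_def)
qed

section \<open>Fourier sums of a single mode in \<open>x\<close>\<close>

definition mode_sum :: "int \<Rightarrow> nat \<Rightarrow> l2_torus \<Rightarrow> l2_torus" where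
  "mode_sum k N F = (\<Sum>m\<in>{- int N..int N}. cscale (fcoef F k m) (emode k m))"

lemma fcoef_cscale: "fcoef (cscale c F) j m = c * fcoef F j m"
  by (simp add: fcoef_def)

lemma fcoef_mode_sum: "fcoef (mode_sum k N F) j m = (if j = k \<and> \<bar>m\<bar> \<le> int N then fcoef F k m else 0)"
proof -
  have "fcoef (mode_sum k N F) j m = (\<Sum>n\<in>{- int N..int N}. if n = m then (if j = k then fcoef F k m else 0) else 0)"
    unfolding mode_sum_def fcoef_sum fcoef_emode by (intro sum.cong) auto
  then show ?thesis by (auto simp: sum.delta abs_le_iff)
qed

lemma mode_sum_tendsto: "(\<lambda>N. mode_sum k N F) \<longlonglongrightarrow> fourier_proj k F"
proof -
  have "psum N (fourier_proj k F) = mode_sum k N F" if "N \<ge> nat \<bar>k\<bar>" for N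
    using that by (intro l2_torus_eqI) (auto simp: fcoef_psum fcoef_fourier_proj fcoef_mode_sum)
  then have "eventually (\<lambda>N. psum N (fourier_proj k F) = mode_sum k N F) sequentially"
    using eventually_sequentially by blast
  then show ?thesis using psum_tendsto[of "fourier_proj k F"] by (rule Lim_transform_eventually[rotated])
qed

lemma tendsto_herm:
  assumes "(f \<longlongrightarrow> F) X" "(g \<longlongrightarrow> G) X"
  shows "((\<lambda>n. herm (f n) (g n)) \<longlongrightarrow> herm F G) X"
proof -
  have "bounded_bilinear herm"
    by standard (auto simp: herm_add_left herm_add_right cscale_of_real[symmetric] scaleR_conv_of_real
      intro!: exI[of _ 1] norm_herm_le)
  from bounded_bilinear.tendsto[OF this assms] show ?thesis .
qed

lemma herm_fourier_proj_left: "herm (fourier_proj k F) G = herm F (fourier_proj k G)"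
proof (rule LIMSEQ_unique)
  show "(\<lambda>N. herm (mode_sum k N F) G) \<longlonglongrightarrow> herm (fourier_proj k F) G"
    by (intro tendsto_herm mode_sum_tendsto tendsto_const)
  have "herm (mode_sum k N F) G = herm F (mode_sum k N G)" for N
    unfolding mode_sum_def herm_linear_simps
    by (intro sum.cong) (auto simp: herm_commute[of "emode k _" G] herm_emode_fcoef)
  moreover have "(\<lambda>N. herm F (mode_sum k N G)) \<longlonglongrightarrow> herm F (fourier_proj k G)"
    by (intro tendsto_herm mode_sum_tendsto tendsto_const)
  ultimately show "(\<lambda>N. herm (mode_sum k N F) G) \<longlonglongrightarrow> herm F (fourier_proj k G)" by simp
qed

lemma fourier_proj_fourier_proj: "fourier_proj j (fourier_proj k F) = (if j = k then fourier_proj k F else 0)"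
  by (rule l2_torus_eqI) (auto simp: fcoef_fourier_proj)

lemma norm_fourier_proj_le: "norm (fourier_proj k F) \<le> norm F"
proof -
  have "herm (fourier_proj k F) (fourier_proj k F) = herm F (fourier_proj k F)"
    using herm_fourier_proj_left[of k F "fourier_proj k F"] by (simp add: fourier_proj_fourier_proj)
  then have "(norm (fourier_proj k F))\<^sup>2 = F \<bullet> fourier_proj k F"
    using Re_herm by (metis power2_norm_eq_inner)
  also have "\<dots> \<le> norm F * norm (fourier_proj k F)" by (rule norm_cauchy_schwarz)
  finally show ?thesis by (smt (verit) norm_ge_zero power2_eq_square mult_le_cancel_right)
qed

lemma bounded_linear_fourier_proj: "bounded_linear (fourier_proj k)"
proof (rule bounded_linear_intro[where K = 1])
  show "fourier_proj k (F + G) = fourier_proj k F + fourier_proj k G" for F G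
    by (rule l2_torus_eqI) (simp add: fcoef_fourier_proj fcoef_add)
  show "fourier_proj k (r *\<^sub>R F) = r *\<^sub>R fourier_proj k F" for r F
    unfolding cscale_of_real[symmetric] by (rule l2_torus_eqI) (simp add: fcoef_fourier_proj fcoef_cscale)
qed (simp add: norm_fourier_proj_le)

lemma fourier_proj_cscale: "fourier_proj k (cscale c F) = cscale c (fourier_proj k F)"
  by (rule l2_torus_eqI) (simp add: fcoef_fourier_proj fcoef_cscale)

lemma fourier_proj_slice:
  assumes "continuous_on UNIV Q"
  shows "fourier_proj j (slice k Q) = (if j = k then slice k Q else 0)"
proof -
  have "fcoef (slice k Q) i m = 0" if "i \<noteq> k" for i m
    using herm_slice[OF assms, of "\<lambda>y. cis (of_int m * y)" k i] that
    by (simp add: fcoef_def emode_slice continuous_intros del: of_int_of_nat_eq)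
  then have "i \<noteq> k \<Longrightarrow> fcoef (slice k Q) i m = 0" for i m by blast
  then show ?thesis
    by (intro l2_torus_eqI) (auto simp: fcoef_fourier_proj)
qed

text \<open>The criterion by which an orbit starting in one mode is shown to remain in it.\<close>

lemma fourier_proj_complete:
  assumes "\<And>j. j \<noteq> k \<Longrightarrow> fourier_proj j F = 0"
  shows "fourier_proj k F = F"
proof (rule l2_torus_eqI)
  fix j m
  have eq: "fcoef F j m = fcoef (fourier_proj j F) j m" by (simp add: fcoef_fourier_proj)
  show "fcoef (fourier_proj k F) j m = fcoef F j m"
  proof (cases "j = k")
    case False
    then have "fcoef F j m = 0" using eq unfolding assms[OF False] by simp
    then show ?thesis using False by (simp add: fcoef_fourier_proj)
  qed (simp add: fcoef_fourier_proj)
qed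

section \<open>The drift-diffusion operator on Fourier modes\<close>

lemma has_vector_derivative_cis_int:
  "((\<lambda>s. cis (of_int j * s)) has_vector_derivative \<i> * of_int j * cis (of_int j * s)) (at s within A)"
  unfolding cis_conv_exp
  by (auto intro!: derivative_eq_intros has_vector_derivative_real_field simp: field_simps)

lemma has_vector_derivative_tmode:
  "((\<lambda>s. c * tmode j m (s, y)) has_vector_derivative \<i> * of_int j * c * tmode j m (x, y)) (at x)"
  "((\<lambda>s. c * tmode j m (x, s)) has_vector_derivative \<i> * of_int m * c * tmode j m (x, y)) (at y)"
  using has_vector_derivative_mult_left[OF has_vector_derivative_cis_int[of j x UNIV], of "c * cis (of_int m * y)"]
    has_vector_derivative_mult_left[OF has_vector_derivative_cis_int[of m y UNIV], of "c * cis (of_int j * x)"]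
  by (simp_all add: tmode_def mult_ac)

lemma partial_tmode:
  "partial_x (\<lambda>z. c * tmode j m z) = (\<lambda>z. (\<i> * of_int j * c) * tmode j m z)"
  "partial_y (\<lambda>z. c * tmode j m z) = (\<lambda>z. (\<i> * of_int m * c) * tmode j m z)"
  by (auto simp: partial_x_def partial_y_def fun_eq_iff
      intro!: vector_derivative_at has_vector_derivative_tmode)

lemma Ck_tmode: "Ck n (\<lambda>z. c * tmode j m z)"
proof (induction n arbitrary: c)
  case 0
  show ?case by (simp add: continuous_intros continuous_on_tmode)
next
  case (Suc n)
  have "(\<lambda>s. c * tmode j m (s, y)) differentiable at x \<and> (\<lambda>s. c * tmode j m (x, s)) differentiable at y" for x y
    using differentiableI_vector[OF has_vector_derivative_tmode(1)] differentiableI_vector[OF has_vector_derivative_tmode(2)]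
    by blast
  then show ?case using Suc by (simp add: partial_tmode continuous_intros continuous_on_tmode)
qed

lemma torus_test_function_tmode: "torus_test_function (tmode j m)"
proof -
  have "cis (of_int n * (x + 2 * pi)) = cis (of_int n * x)" for n x
  proof -
    have "cis (of_int n * (x + 2 * pi)) = cis (of_int n * x) * cis (2 * pi * of_int n)"
      unfolding cis_mult by (simp add: algebra_simps)
    then show ?thesis by (simp add: cis_multiple_2pi)
  qed
  moreover have "\<forall>n. Ck n (tmode j m)"
    using Ck_tmode[of _ 1 j m] by simp
  ultimately show ?thesis
    unfolding torus_test_function_def by (simp add: tmode_def)
qed

definition mulu :: "(real \<Rightarrow> real) \<Rightarrow> l2_torus \<Rightarrow> l2_torus" where
  "mulu u = mul (\<lambda>z. of_real (u (snd z)))"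

lemma continuous_periodic_bounded:
  fixes u :: "real \<Rightarrow> real"
  assumes c: "continuous_on UNIV u" and per: "\<And>y. u (y + 2 * pi) = u y"
  shows "\<exists>B. \<forall>y. \<bar>u y\<bar> \<le> B"
proof -
  have "compact (u ` {0..2*pi})"
    by (intro compact_continuous_image compact_Icc continuous_on_subset[OF c]) auto
  then obtain B where B: "\<forall>w\<in>u ` {0..2*pi}. norm w \<le> B"
    using compact_imp_bounded bounded_iff by metis
  have shift: "u (y + of_int n * (2 * pi)) = u y" for y n
  proof (induction n rule: int_induct[of _ 0])
    case (step1 i)
    then show ?case using per[of "y + of_int i * (2 * pi)"] by (simp add: algebra_simps)
  next
    case (step2 i)
    then show ?case using per[of "y + of_int (i - 1) * (2 * pi)"] by (simp add: algebra_simps)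
  qed simp
  have "\<bar>u y\<bar> \<le> B" for y
  proof -
    define n where "n = - \<lfloor>y / (2 * pi)\<rfloor>"
    have "of_int \<lfloor>y / (2 * pi)\<rfloor> * (2 * pi) \<le> y" "y < (of_int \<lfloor>y / (2 * pi)\<rfloor> + 1) * (2 * pi)"
      by (rule floor_divide_lower floor_divide_upper, simp)+
    then have "y + of_int n * (2 * pi) \<in> {0..2*pi}" by (simp add: n_def algebra_simps)
    then have "\<bar>u (y + of_int n * (2 * pi))\<bar> \<le> B" using B by (auto simp del: atLeastAtMost_iff)
    then show ?thesis by (simp only: shift)
  qed
  then show ?thesis by blast
qed

lemma bounded_multiplier_u:
  assumes "continuous_on UNIV u" "\<And>y. u (y + 2 * pi) = (u y :: real)"
  shows "bounded_multiplier (\<lambda>z. of_real (u (snd z)))"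
proof -
  obtain B where "\<forall>y. \<bar>u y\<bar> \<le> B" using continuous_periodic_bounded[of u] assms by blast
  moreover have "(\<lambda>z. complex_of_real (u (snd z))) \<in> borel_measurable torus_measure"
    by (intro borel_measurable_torusI borel_measurable_continuous_onI continuous_on_of_real
        continuous_on_compose2[OF assms(1)] continuous_intros) auto
  ultimately show ?thesis unfolding bounded_multiplier_def by (auto intro!: exI[of _ B])
qed

lemma integrable_rep_continuous:
  assumes "continuous_on UNIV (\<phi> :: real \<times> real \<Rightarrow> complex)"
  shows "integrable torus_measure (\<lambda>z. rep_l2_torus F z * \<phi> z)"
  by (intro integrable_mult_sq_integrable sq_integrable_rep sq_integrable_continuous assms)

text \<open>The distributional pairing involves no conjugation, so the test function is the
  conjugate exponential. Multiplication by \<open>u\<close> mixes the frequencies in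
  \<open>y\<close>; its term therefore stays a coefficient of the product.\<close>

lemma drift_diffusion_fcoef:
  assumes u: "continuous_on UNIV u" "\<And>y. u (y + 2 * pi) = u y"
    and fg: "(F, G) \<in> drift_diffusion a b u"
  shows "fcoef G k m = - of_real (a * (of_int k)\<^sup>2 + b * (of_int m)\<^sup>2) * fcoef F k m - \<i> * of_int k * fcoef (mulu u F) k m"
proof -
  define \<phi> where "\<phi> = tmode (- k) (- m)"
  have \<phi>: "\<phi> z = cnj (tmode k m z)" for z by (simp add: \<phi>_def tmode_def cis_cnj)
  have herm: "herm H (emode k m) = (\<integral>z. rep_l2_torus H z * \<phi> z \<partial>torus_measure)" for H
    unfolding emode_def \<phi> by (rule herm_abs_right) simp
  have c\<phi>: "continuous_on UNIV \<phi>" unfolding \<phi>_def by (rule continuous_on_tmode)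
  have cu: "continuous_on UNIV (\<lambda>z::real\<times>real. complex_of_real (u (snd z)))"
    by (intro continuous_on_of_real continuous_on_compose2[OF u(1)] continuous_intros) auto
  have px: "partial_x \<phi> = (\<lambda>z. (- \<i> * of_int k) * \<phi> z)" "partial_y \<phi> = (\<lambda>z. (- \<i> * of_int m) * \<phi> z)"
    using partial_tmode[of 1 "- k" "- m"] by (simp_all add: \<phi>_def)
  have pxx: "partial_x (\<lambda>z. (- \<i> * of_int k) * \<phi> z) = (\<lambda>z. - of_int (k\<^sup>2) * \<phi> z)" "partial_y (\<lambda>z. (- \<i> * of_int m) * \<phi> z) = (\<lambda>z. - of_int (m\<^sup>2) * \<phi> z)"
    using partial_tmode[of "- \<i> * of_int k" "- k" "- m"] partial_tmode[of "- \<i> * of_int m" "- k" "- m"]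
    by (simp_all add: \<phi>_def power2_eq_square mult_ac)
  have uF: "herm (mulu u F) (emode k m) = (\<integral>z. rep_l2_torus F z * (of_real (u (snd z)) * \<phi> z) \<partial>torus_measure)"
  proof -
    have "herm (mulu u F) (emode k m) = herm F (mul (\<lambda>z. cnj (of_real (u (snd z)))) (emode k m))"
      unfolding mulu_def by (rule herm_mul_left[OF bounded_multiplier_u[OF u]])
    also have "\<dots> = herm F (abs_l2_torus (\<lambda>z. of_real (u (snd z)) * tmode k m z))"
      unfolding emode_def using mul_abs[OF bounded_multiplier_u[OF u] sq_integrable_tmode] by simp
    also have "\<dots> = (\<integral>z. rep_l2_torus F z * cnj (of_real (u (snd z)) * tmode k m z) \<partial>torus_measure)"
      by (rule herm_abs_right[OF sq_integrable_mult[OF bounded_multiplier_u[OF u] sq_integrable_tmode]])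
    finally show ?thesis by (simp add: \<phi>)
  qed
  have "herm G (emode k m) = (\<integral>z. rep_l2_torus F z * (of_real a * partial_x (partial_x \<phi>) z + of_real b * partial_y (partial_y \<phi>) z + of_real (u (snd z)) * partial_x \<phi> z) \<partial>torus_measure)"
    using fg torus_test_function_tmode[of "- k" "- m"] unfolding herm drift_diffusion_def \<phi>_def by blast
  also have "\<dots> = (\<integral>z. (- of_real (a * (of_int k)\<^sup>2 + b * (of_int m)\<^sup>2)) * (rep_l2_torus F z * \<phi> z) + (- (\<i> * of_int k)) * (rep_l2_torus F z * (of_real (u (snd z)) * \<phi> z)) \<partial>torus_measure)"
    unfolding px pxx by (intro Bochner_Integration.integral_cong) (auto simp: algebra_simps)
  also have "\<dots> = (- of_real (a * (of_int k)\<^sup>2 + b * (of_int m)\<^sup>2)) * herm F (emode k m) + (- (\<i> * of_int k)) * herm (mulu u F) (emode k m)"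
    unfolding herm[of F] uF
    by (subst Bochner_Integration.integral_add)
      (auto intro!: integrable_mult_right integrable_rep_continuous continuous_on_mult c\<phi> cu)
  finally have eq: "herm G (emode k m) = \<dots>" .
  show ?thesis
    unfolding fcoef_def eq add_divide_distrib by simp
qed

section \<open>Integration by parts on the torus\<close>

lemma vector_derivative_periodic:
  fixes f :: "real \<Rightarrow> 'a :: real_normed_vector"
  assumes "\<And>s. f (s + p) = f s" "\<And>s. f differentiable at s"
  shows "vector_derivative f (at (s + p)) = vector_derivative f (at s)"
proof -
  have "(f has_vector_derivative vector_derivative f (at (s + p))) (at (s + p))"
    using assms(2) by (simp add: vector_derivative_works[symmetric])
  moreover have "((\<lambda>s. s + p) has_vector_derivative 1) (at s)"
    by (auto intro!: derivative_eq_intros)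
  ultimately have "(f \<circ> (\<lambda>s. s + p) has_vector_derivative 1 *\<^sub>R vector_derivative f (at (s + p))) (at s)"
    by (rule vector_diff_chain_at[rotated])
  then have "(f has_vector_derivative vector_derivative f (at (s + p))) (at s)"
    using assms(1) by (simp add: o_def)
  then show ?thesis by (rule vector_derivative_at[symmetric])
qed

lemma circle_integration_by_parts:
  fixes v v' :: "real \<Rightarrow> complex"
  assumes v: "\<And>s. (v has_vector_derivative v' s) (at s)" and v': "continuous_on UNIV v'" and per: "v (2 * pi) = v 0"
  shows "(\<integral>s. cis (of_int j * s) * v' s \<partial>circle_measure) = - (\<i> * of_int j) * (\<integral>s. cis (of_int j * s) * v s \<partial>circle_measure)"
proof -
  have cv: "continuous_on A v" for A
    by (auto intro!: continuous_at_imp_continuous_on has_vector_derivative_continuous[OF v])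
  have cv': "continuous_on A v'" for A
    by (rule continuous_on_subset[OF v']) simp
  have "((\<lambda>s. cis (of_int j * s) * v s) has_vector_derivative (cis (of_int j * s) * v' s + \<i> * of_int j * cis (of_int j * s) * v s)) (at s)" for s
    using has_vector_derivative_mult[OF has_vector_derivative_cis_int v] by simp
  then have "((\<lambda>s. cis (of_int j * s) * v' s + \<i> * of_int j * cis (of_int j * s) * v s) has_integral
      (cis (of_int j * (2 * pi)) * v (2 * pi) - cis (of_int j * 0) * v 0)) {0..2*pi}"
    by (intro fundamental_theorem_of_calculus) (auto intro: has_vector_derivative_at_within)
  moreover have "cis (of_int j * (2 * pi)) = 1"
    using cis_multiple_2pi[of "of_int j"] by (simp add: mult.commute)
  ultimately have "((\<lambda>s. cis (of_int j * s) * v' s + \<i> * of_int j * cis (of_int j * s) * v s) has_integral 0) {0..2*pi}"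
    using per by simp
  moreover have "((\<lambda>s. (\<i> * of_int j) * (cis (of_int j * s) * v s)) has_integral (\<i> * of_int j) * integral {0..2*pi} (\<lambda>s. cis (of_int j * s) * v s)) {0..2*pi}"
    by (intro has_integral_mult_right integrable_integral integrable_continuous_interval continuous_intros cv)
  ultimately have "((\<lambda>s. cis (of_int j * s) * v' s) has_integral (0 - (\<i> * of_int j) * integral {0..2*pi} (\<lambda>s. cis (of_int j * s) * v s))) {0..2*pi}"
    by (rule has_integral_diff[THEN has_integral_eq[rotated]]) (simp add: algebra_simps)
  then show ?thesis
    by (subst (1 2) circle_integral) (auto intro!: continuous_intros cv cv' simp: integral_unique)
qed

lemma torus_integration_by_parts_x:
  assumes \<phi>: "continuous_on UNIV \<phi>" "continuous_on UNIV (partial_x \<phi>)"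
    and d: "\<And>x y. (\<lambda>s. \<phi> (s, y)) differentiable at x" and per: "\<And>y. \<phi> (2 * pi, y) = \<phi> (0, y)"
    and w: "continuous_on UNIV w"
  shows "(\<integral>z. cis (of_int j * fst z) * w (snd z) * partial_x \<phi> z \<partial>torus_measure)
    = - (\<i> * of_int j) * (\<integral>z. cis (of_int j * fst z) * w (snd z) * \<phi> z \<partial>torus_measure)"
proof -
  have cw: "continuous_on UNIV (\<lambda>z::real\<times>real. cis (of_int j * fst z) * w (snd z))"
    by (intro continuous_intros continuous_on_compose2[OF w]) auto
  have int: "integrable torus_measure (\<lambda>z. cis (of_int j * fst z) * w (snd z) * f z)" if "continuous_on UNIV f" for f :: "real \<times> real \<Rightarrow> complex"
    by (intro integrable_mult_sq_integrable sq_integrable_continuous cw that)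
  have ibp: "(\<integral>x. cis (of_int j * x) * partial_x \<phi> (x, y) \<partial>circle_measure) = - (\<i> * of_int j) * (\<integral>x. cis (of_int j * x) * \<phi> (x, y) \<partial>circle_measure)" for y
  proof (rule circle_integration_by_parts)
    show "((\<lambda>x. \<phi> (x, y)) has_vector_derivative partial_x \<phi> (x, y)) (at x)" for x
      using d unfolding partial_x_def by (simp add: vector_derivative_works)
    show "continuous_on UNIV (\<lambda>x. partial_x \<phi> (x, y))"
      by (rule continuous_on_compose2[OF \<phi>(2)]) (auto intro: continuous_intros)
  qed (rule per)
  have "(\<integral>x. cis (of_int j * fst (x, y)) * w (snd (x, y)) * partial_x \<phi> (x, y) \<partial>circle_measure)
      = - (\<i> * of_int j) * (\<integral>x. cis (of_int j * fst (x, y)) * w (snd (x, y)) * \<phi> (x, y) \<partial>circle_measure)" for y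
  proof -
    have "cis (of_int j * fst (x, y)) * w (snd (x, y)) * f (x, y) = cis (of_int j * x) * f (x, y) * w y" for f :: "real \<times> real \<Rightarrow> complex" and x
      by simp
    then show ?thesis by (simp only: integral_mult_left_zero ibp) simp
  qed
  then show ?thesis
    unfolding torus_integral_yx[OF int[OF \<phi>(2)]] torus_integral_yx[OF int[OF \<phi>(1)]]
    by (simp only: integral_mult_right_zero)
qed

lemma torus_integration_by_parts_y:
  assumes \<phi>: "continuous_on UNIV \<phi>" "continuous_on UNIV (partial_y \<phi>)"
    and d: "\<And>x y. (\<lambda>s. \<phi> (x, s)) differentiable at y" and per: "\<And>x. \<phi> (x, 2 * pi) = \<phi> (x, 0)"
    and w: "continuous_on UNIV w"
  shows "(\<integral>z. w (fst z) * cis (of_int m * snd z) * partial_y \<phi> z \<partial>torus_measure)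
    = - (\<i> * of_int m) * (\<integral>z. w (fst z) * cis (of_int m * snd z) * \<phi> z \<partial>torus_measure)"
proof -
  have cw: "continuous_on UNIV (\<lambda>z::real\<times>real. w (fst z) * cis (of_int m * snd z))"
    by (intro continuous_intros continuous_on_compose2[OF w]) auto
  have int: "integrable torus_measure (\<lambda>z. w (fst z) * cis (of_int m * snd z) * f z)" if "continuous_on UNIV f" for f :: "real \<times> real \<Rightarrow> complex"
    by (intro integrable_mult_sq_integrable sq_integrable_continuous cw that)
  have ibp: "(\<integral>y. cis (of_int m * y) * partial_y \<phi> (x, y) \<partial>circle_measure) = - (\<i> * of_int m) * (\<integral>y. cis (of_int m * y) * \<phi> (x, y) \<partial>circle_measure)" for x
  proof (rule circle_integration_by_parts)
    show "((\<lambda>y. \<phi> (x, y)) has_vector_derivative partial_y \<phi> (x, y)) (at y)" for y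
      using d unfolding partial_y_def by (simp add: vector_derivative_works)
    show "continuous_on UNIV (\<lambda>y. partial_y \<phi> (x, y))"
      by (rule continuous_on_compose2[OF \<phi>(2)]) (auto intro: continuous_intros)
  qed (rule per)
  have "(\<integral>y. w (fst (x, y)) * cis (of_int m * snd (x, y)) * partial_y \<phi> (x, y) \<partial>circle_measure)
      = - (\<i> * of_int m) * (\<integral>y. w (fst (x, y)) * cis (of_int m * snd (x, y)) * \<phi> (x, y) \<partial>circle_measure)" for x
  proof -
    have "w (fst (x, y)) * cis (of_int m * snd (x, y)) * f (x, y) = cis (of_int m * y) * f (x, y) * w x" for f :: "real \<times> real \<Rightarrow> complex" and y
      by simp
    then show ?thesis by (simp only: integral_mult_left_zero ibp) simp
  qed
  then show ?thesis
    unfolding torus_integral_xy[OF int[OF \<phi>(2)]] torus_integral_xy[OF int[OF \<phi>(1)]]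
    by (simp only: integral_mult_right_zero)
qed

lemma torus_integral_rep_abs:
  assumes "sq_integrable f" "g \<in> borel_measurable torus_measure"
  shows "(\<integral>z. rep_l2_torus (abs_l2_torus f) z * g z \<partial>torus_measure) = (\<integral>z. f z * g z \<partial>torus_measure)"
proof (rule integral_cong_AE)
  show "AE z in torus_measure. rep_l2_torus (abs_l2_torus f) z * g z = f z * g z"
    using rep_abs_l2[OF assms(1)] by eventually_elim simp
qed (use assms in \<open>auto simp: sq_integrable_def intro!: borel_measurable_times\<close>)

text \<open>Provides the smooth initial data from which the decay is later extended by density. The
  partner \<open>G\<close> is the classical image of the exponential; integrations by parts move the
  derivatives onto the test function.\<close>

lemma emode_in_drift_diffusion:
  assumes u: "continuous_on UNIV u" "\<And>y. u (y + 2 * pi) = u y"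
  shows "\<exists>G. (cscale c (emode j m), G) \<in> drift_diffusion a b u"
proof -
  define f where "f z = c * tmode j m z" for z
  define g where "g z = - of_real (a * (of_int j)\<^sup>2 + b * (of_int m)\<^sup>2) * f z - \<i> * of_int j * of_real (u (snd z)) * f z" for z
  have cu: "continuous_on UNIV (\<lambda>z::real\<times>real. complex_of_real (u (snd z)))"
    by (intro continuous_on_of_real continuous_on_compose2[OF u(1)] continuous_intros) auto
  have cf: "continuous_on UNIV f" unfolding f_def by (intro continuous_intros continuous_on_tmode)
  have cg: "continuous_on UNIV g" unfolding g_def by (intro continuous_intros cf cu)
  note sq = sq_integrable_continuous
  have f: "cscale c (emode j m) = abs_l2_torus f"
    unfolding cscale_def emode_def f_def[abs_def] by (rule mul_abs) auto
  have "(cscale c (emode j m), abs_l2_torus g) \<in> drift_diffusion a b u"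
    unfolding drift_diffusion_def mem_Collect_eq prod.case
  proof (intro allI impI)
    fix \<phi> assume T: "torus_test_function \<phi>"
    define \<phi>x \<phi>y \<phi>xx \<phi>yy where "\<phi>x = partial_x \<phi>" and "\<phi>y = partial_y \<phi>"
      and "\<phi>xx = partial_x \<phi>x" and "\<phi>yy = partial_y \<phi>y"
    have C2: "Ck (Suc (Suc 0)) \<phi>" using T unfolding torus_test_function_def by blast
    have c: "continuous_on UNIV \<phi>" "continuous_on UNIV \<phi>x" "continuous_on UNIV \<phi>y"
        "continuous_on UNIV \<phi>xx" "continuous_on UNIV \<phi>yy"
      and d: "\<And>x y. (\<lambda>s. \<phi> (s, y)) differentiable at x" "\<And>x y. (\<lambda>s. \<phi> (x, s)) differentiable at y"
        "\<And>x y. (\<lambda>s. \<phi>x (s, y)) differentiable at x" "\<And>x y. (\<lambda>s. \<phi>y (x, s)) differentiable at y"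
      using C2 unfolding Ck.simps \<phi>x_def \<phi>y_def \<phi>xx_def \<phi>yy_def by auto
    have p: "\<phi> (x + 2 * pi, y) = \<phi> (x, y)" "\<phi> (x, y + 2 * pi) = \<phi> (x, y)" for x y
      using T by (simp_all add: torus_test_function_def)
    \<comment> \<open>Periodicity of the first derivatives removes the boundary terms of the second
      integration by parts.\<close>
    have px: "\<phi>x (x + 2 * pi, y) = \<phi>x (x, y)" for x y
      unfolding \<phi>x_def partial_x_def prod.case by (rule vector_derivative_periodic[OF p(1) d(1)])
    have py: "\<phi>y (x, y + 2 * pi) = \<phi>y (x, y)" for x y
      unfolding \<phi>y_def partial_y_def prod.case by (rule vector_derivative_periodic[OF p(2) d(2)])
    have per: "\<phi> (2 * pi, y) = \<phi> (0, y)" "\<phi> (x, 2 * pi) = \<phi> (x, 0)"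
        "\<phi>x (2 * pi, y) = \<phi>x (0, y)" "\<phi>y (x, 2 * pi) = \<phi>y (x, 0)" for x y
      using p(1)[of 0 y] p(2)[of x 0] px[of 0 y] py[of x 0] by simp_all
    define wx where "wx y = c * cis (of_int m * y)" for y
    define wy where "wy x = c * cis (of_int j * x)" for x
    define wu where "wu y = c * cis (of_int m * y) * of_real (u y)" for y
    have cw: "continuous_on UNIV wx" "continuous_on UNIV wy" "continuous_on UNIV wu"
      unfolding wx_def wy_def wu_def by (intro continuous_intros u)+
    have fx: "f z = cis (of_int j * fst z) * wx (snd z)" and fy: "f z = wy (fst z) * cis (of_int m * snd z)"
      and fu: "f z * of_real (u (snd z)) = cis (of_int j * fst z) * wu (snd z)" for z
      by (simp_all add: f_def tmode_def wx_def wy_def wu_def)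
    define I where "I = (\<integral>z. f z * \<phi> z \<partial>torus_measure)"
    define Iu where "Iu = (\<integral>z. f z * of_real (u (snd z)) * \<phi> z \<partial>torus_measure)"
    have Ixx: "(\<integral>z. f z * \<phi>xx z \<partial>torus_measure) = - of_int (j\<^sup>2) * I"
      unfolding I_def \<phi>xx_def fx
      by (subst torus_integration_by_parts_x[OF c(2) c(4)[unfolded \<phi>xx_def] d(3) per(3) cw(1)],
          unfold \<phi>x_def, subst torus_integration_by_parts_x[OF c(1) c(2)[unfolded \<phi>x_def] d(1) per(1) cw(1)])
        (simp add: power2_eq_square mult_ac)
    have Iyy: "(\<integral>z. f z * \<phi>yy z \<partial>torus_measure) = - of_int (m\<^sup>2) * I"
      unfolding I_def \<phi>yy_def fy
      by (subst torus_integration_by_parts_y[OF c(3) c(5)[unfolded \<phi>yy_def] d(4) per(4) cw(2)],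
          unfold \<phi>y_def, subst torus_integration_by_parts_y[OF c(1) c(3)[unfolded \<phi>y_def] d(2) per(2) cw(2)])
        (simp add: power2_eq_square mult_ac)
    have Ix: "(\<integral>z. f z * of_real (u (snd z)) * \<phi>x z \<partial>torus_measure) = - (\<i> * of_int j) * Iu"
      unfolding Iu_def \<phi>x_def fu
      by (rule torus_integration_by_parts_x[OF c(1) c(2)[unfolded \<phi>x_def] d(1) per(1) cw(3)])
    have int: "integrable torus_measure (\<lambda>z. f z * h z)" if "continuous_on UNIV h" for h :: "real \<times> real \<Rightarrow> complex"
      by (intro integrable_mult_sq_integrable sq cf that)
    have int2: "integrable torus_measure (\<lambda>z. f z * of_real (u (snd z)) * h z)" if "continuous_on UNIV h" for h :: "real \<times> real \<Rightarrow> complex"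
      by (intro integrable_mult_sq_integrable sq continuous_on_mult cf cu that)
    have "(\<integral>z. rep_l2_torus (abs_l2_torus g) z * \<phi> z \<partial>torus_measure) = (\<integral>z. g z * \<phi> z \<partial>torus_measure)"
      by (intro torus_integral_rep_abs sq cg borel_measurable_torusI borel_measurable_continuous_onI c)
    also have "\<dots> = (\<integral>z. (- of_real (a * (of_int j)\<^sup>2 + b * (of_int m)\<^sup>2)) * (f z * \<phi> z) + (- \<i> * of_int j) * (f z * of_real (u (snd z)) * \<phi> z) \<partial>torus_measure)"
      unfolding g_def by (intro Bochner_Integration.integral_cong) (auto simp: algebra_simps)
    also have "\<dots> = (- of_real (a * (of_int j)\<^sup>2 + b * (of_int m)\<^sup>2)) * I + (- \<i> * of_int j) * Iu"
      unfolding I_def Iu_def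
      by (subst Bochner_Integration.integral_add) (auto intro!: integrable_mult_right int int2 c)
    also have "\<dots> = of_real a * (- of_int (j\<^sup>2) * I) + of_real b * (- of_int (m\<^sup>2) * I) + (- (\<i> * of_int j) * Iu)"
      by (simp add: algebra_simps)
    also have "\<dots> = (\<integral>z. (of_real a * (f z * \<phi>xx z) + of_real b * (f z * \<phi>yy z)) + f z * of_real (u (snd z)) * \<phi>x z \<partial>torus_measure)"
      unfolding Ixx[symmetric] Iyy[symmetric] Ix[symmetric]
      by (subst Bochner_Integration.integral_add, (auto intro!: integrable_mult_right int int2 c)[2],
          subst Bochner_Integration.integral_add) (auto intro!: integrable_mult_right int int2 c)
    also have "\<dots> = (\<integral>z. f z * (of_real a * \<phi>xx z + of_real b * \<phi>yy z + of_real (u (snd z)) * \<phi>x z) \<partial>torus_measure)"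
      by (intro Bochner_Integration.integral_cong) (auto simp: algebra_simps)
    also have "\<dots> = (\<integral>z. rep_l2_torus (abs_l2_torus f) z * (of_real a * \<phi>xx z + of_real b * \<phi>yy z + of_real (u (snd z)) * \<phi>x z) \<partial>torus_measure)"
      by (intro torus_integral_rep_abs[symmetric] sq cf borel_measurable_torusI borel_measurable_continuous_onI continuous_intros c cu)
    finally show "(\<integral>z. rep_l2_torus (abs_l2_torus g) z * \<phi> z \<partial>torus_measure) =
      (\<integral>z. rep_l2_torus (cscale c (emode j m)) z * (of_real a * partial_x (partial_x \<phi>) z + of_real b * partial_y (partial_y \<phi>) z + of_real (u (snd z)) * partial_x \<phi> z) \<partial>torus_measure)"
      by (simp only: f \<phi>x_def \<phi>y_def \<phi>xx_def \<phi>yy_def)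
  qed
  then show ?thesis ..
qed

section \<open>Calculus of slices and the generator on one mode\<close>

lemma cscale_slice:
  assumes "continuous_on UNIV Q"
  shows "cscale c (slice k Q) = slice k (\<lambda>y. c * Q y)"
proof -
  have "cscale c (slice k Q) = abs_l2_torus (\<lambda>z. c * (cis (of_int k * fst z) * Q (snd z)))"
    unfolding cscale_def slice_def
    by (intro mul_abs sq_integrable_continuous continuous_on_slice assms) simp
  then show ?thesis by (simp add: slice_def mult.left_commute)
qed

lemma add_slice:
  assumes "continuous_on UNIV P" "continuous_on UNIV Q"
  shows "slice k P + slice k Q = slice k (\<lambda>y. P y + Q y)"
  unfolding slice_def
  by (simp add: add_abs_l2 sq_integrable_continuous continuous_on_slice assms distrib_left)

lemma mulu_slice:
  assumes u: "continuous_on UNIV u" "\<And>y. u (y + 2 * pi) = u y" and Q: "continuous_on UNIV Q"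
  shows "mulu u (slice k Q) = slice k (\<lambda>y. of_real (u y) * Q y)"
proof -
  have "mulu u (slice k Q) = abs_l2_torus (\<lambda>z. of_real (u (snd z)) * (cis (of_int k * fst z) * Q (snd z)))"
    unfolding mulu_def slice_def
    by (intro mul_abs sq_integrable_continuous continuous_on_slice Q bounded_multiplier_u u)
  then show ?thesis by (simp add: slice_def mult.left_commute)
qed

lemma sum_slice:
  assumes "finite A" "\<And>i. i \<in> A \<Longrightarrow> continuous_on UNIV (Q i)"
  shows "(\<Sum>i\<in>A. slice k (Q i)) = slice k (\<lambda>y. \<Sum>i\<in>A. Q i y)"
  using assms
proof (induction A rule: finite_induct)
  case empty
  then show ?case by (simp add: slice_def zero_l2_torus_def)
next
  case (insert i A)
  then show ?case by (simp add: add_slice continuous_on_sum)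
qed

text \<open>Commutation is checked on exponentials, where \<open>mulu_slice\<close> applies, and
  transferred to \<open>F\<close> because both operators are self-adjoint for
  \<open>herm\<close>.\<close>

lemma fourier_proj_mulu:
  assumes u: "continuous_on UNIV u" "\<And>y. u (y + 2 * pi) = u y"
  shows "fourier_proj k (mulu u F) = mulu u (fourier_proj k F)"
proof (rule l2_torus_eqI)
  fix j m
  have adj: "herm (mulu u F) G = herm F (mulu u G)" for F G
    using herm_mul_left[OF bounded_multiplier_u[OF u], of F G] by (simp add: mulu_def)
  have ce: "continuous_on UNIV (\<lambda>y. of_real (u y) * cis (of_int m * y))" "continuous_on UNIV (\<lambda>y::real. cis (of_int m * y))"
    by (intro continuous_intros u)+
  have "mulu u 0 = 0"
    unfolding mulu_def by (rule linear_0[OF bounded_linear.linear[OF bounded_linear_mul[OF bounded_multiplier_u[OF u]]]])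
  then have "fourier_proj k (mulu u (emode j m)) = mulu u (fourier_proj k (emode j m))"
    by (simp add: emode_slice mulu_slice[OF u] fourier_proj_slice ce)
  then have "herm (fourier_proj k (mulu u F)) (emode j m) = herm (mulu u (fourier_proj k F)) (emode j m)"
    by (simp add: herm_fourier_proj_left adj)
  then show "fcoef (fourier_proj k (mulu u F)) j m = fcoef (mulu u (fourier_proj k F)) j m"
    by (simp add: fcoef_def)
qed

text \<open>
  Truncating the Fourier series in \<open>y\<close> turns membership in the distributional graph into a
  statement about smooth functions: trigonometric polynomials form a core.
\<close>

lemma drift_diffusion_mode_approx:
  assumes u: "continuous_on UNIV u" "\<And>y. u (y + 2 * pi) = u y"
    and FG: "(F, G) \<in> drift_diffusion a b u"
  shows "\<exists>W W' W''. (\<forall>N. C2_periodic (W N) (W' N) (W'' N)) \<and> (\<lambda>N. slice k (W N)) \<longlonglongrightarrow> fourier_proj k F \<and>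
    (\<lambda>N. slice k (mode_op (of_int k) u b (of_real (a * (of_int k)\<^sup>2)) (W N) (W'' N)))
       \<longlonglongrightarrow> - fourier_proj k G"
proof -
  define c where "c m = fcoef F k m" for m
  define W where "W N y = (\<Sum>m\<in>{- int N..int N}. c m * cis (of_int m * y))" for N y
  define W' where "W' N y = (\<Sum>m\<in>{- int N..int N}. c m * (\<i> * of_int m * cis (of_int m * y)))" for N y
  define W'' where "W'' N y = (\<Sum>m\<in>{- int N..int N}. c m * (\<i> * of_int m * (\<i> * of_int m * cis (of_int m * y))))" for N y
  have d1: "(W N has_vector_derivative W' N y) (at y)" for N y
    unfolding W_def[abs_def] W'_def
    by (intro has_vector_derivative_sum has_vector_derivative_mult_right has_vector_derivative_cis_int)
  have d2: "(W' N has_vector_derivative W'' N y) (at y)" for N y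
    unfolding W'_def[abs_def] W''_def
    by (intro has_vector_derivative_sum has_vector_derivative_mult_right has_vector_derivative_cis_int)
  have cW: "continuous_on UNIV (W N)" and cW'': "continuous_on UNIV (W'' N)" for N
    unfolding W_def[abs_def] W''_def[abs_def] by (intro continuous_intros)+
  have cis_per: "cis (of_int n * (y + 2 * pi)) = cis (of_int n * y)" for n y
  proof -
    have "cis (of_int n * (y + 2 * pi)) = cis (of_int n * y) * cis (2 * pi * of_int n)"
      unfolding cis_mult by (simp add: algebra_simps)
    then show ?thesis by (simp add: cis_multiple_2pi)
  qed
  have ms: "mode_sum k N H = slice k (\<lambda>y. \<Sum>m\<in>{- int N..int N}. fcoef H k m * cis (of_int m * y))" for N H
  proof -
    have "mode_sum k N H = (\<Sum>m\<in>{- int N..int N}. slice k (\<lambda>y. fcoef H k m * cis (of_int m * y)))"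
      unfolding mode_sum_def emode_slice by (intro sum.cong cscale_slice refl continuous_intros)
    also have "\<dots> = slice k (\<lambda>y. \<Sum>m\<in>{- int N..int N}. fcoef H k m * cis (of_int m * y))"
      by (intro sum_slice continuous_intros) auto
    finally show ?thesis .
  qed
  have msF: "mode_sum k N F = slice k (W N)" for N
    unfolding ms W_def[abs_def] c_def ..
  define E where "E N = slice k (mode_op (of_int k) u b (of_real (a * (of_int k)\<^sup>2)) (W N) (W'' N))" for N
  \<comment> \<open>Truncation in \<open>y\<close> does not commute with \<open>u\<close>: the
    residual of the truncated function is minus the truncation of \<open>G\<close> plus
    \<open>\<i> * k\<close> times the commutator applied to \<open>F\<close>. The equation itself is
    used coefficientwise.\<close>
  have Eeq: "E N = cscale (\<i> * of_int k) (mulu u (mode_sum k N F)) + cscale (- 1) (mode_sum k N G + cscale (\<i> * of_int k) (mode_sum k N (mulu u F)))" for N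
  proof -
    let ?S = "\<lambda>H y. \<Sum>m\<in>{- int N..int N}. fcoef H k m * cis (of_int m * y)"
    have cS: "continuous_on UNIV (?S H)" for H by (intro continuous_intros)
    have cu: "continuous_on UNIV (\<lambda>y. complex_of_real (u y))" by (intro continuous_intros u)
    have "cscale (\<i> * of_int k) (mulu u (mode_sum k N F)) + cscale (- 1) (mode_sum k N G + cscale (\<i> * of_int k) (mode_sum k N (mulu u F)))
      = slice k (\<lambda>y. (\<i> * of_int k) * (of_real (u y) * W N y) + (- 1) * (?S G y + (\<i> * of_int k) * ?S (mulu u F) y))"
      unfolding msF unfolding ms
      by (simp only: mulu_slice[OF u] cscale_slice add_slice continuous_on_mult continuous_on_add continuous_on_const cW cS cu)
    moreover have "(\<i> * of_int k) * (of_real (u y) * W N y) + (- 1) * (?S G y + (\<i> * of_int k) * ?S (mulu u F) y)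
      = \<i> * of_real (of_int k * u y) * W N y + of_real (a * (of_int k)\<^sup>2) * W N y - of_real b * W'' N y" for y
    proof -
      have "?S G y + (\<i> * of_int k) * ?S (mulu u F) y = (\<Sum>m\<in>{- int N..int N}. (fcoef G k m + \<i> * of_int k * fcoef (mulu u F) k m) * cis (of_int m * y))"
        by (simp only: sum.distrib sum_distrib_left distrib_right mult.assoc)
      also have "\<dots> = (\<Sum>m\<in>{- int N..int N}. - of_real (a * (of_int k)\<^sup>2) * (c m * cis (of_int m * y)) + of_real b * (c m * (\<i> * of_int m * (\<i> * of_int m * cis (of_int m * y)))))"
        by (intro sum.cong refl) (simp add: drift_diffusion_fcoef[OF u FG] c_def algebra_simps power2_eq_square)
      also have "\<dots> = - of_real (a * (of_int k)\<^sup>2) * W N y + of_real b * W'' N y"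
        unfolding W_def W''_def sum.distrib sum_distrib_left ..
      finally show ?thesis by (simp add: algebra_simps)
    qed
    ultimately show ?thesis by (simp only: E_def)
  qed
  have blu: "bounded_linear (mulu u)"
    unfolding mulu_def by (rule bounded_linear_mul[OF bounded_multiplier_u[OF u]])
  \<comment> \<open>The two halves of the commutator converge separately, and their limits cancel
    because \<open>fourier_proj k\<close> commutes with \<open>mulu u\<close>.\<close>
  have "E \<longlonglongrightarrow> cscale (\<i> * of_int k) (mulu u (fourier_proj k F)) + cscale (- 1) (fourier_proj k G + cscale (\<i> * of_int k) (fourier_proj k (mulu u F)))"
    unfolding Eeq[abs_def]
    by (intro tendsto_add bounded_linear.tendsto[OF bounded_linear_cscale] bounded_linear.tendsto[OF blu] mode_sum_tendsto)
  also have "cscale (\<i> * of_int k) (mulu u (fourier_proj k F)) + cscale (- 1) (fourier_proj k G + cscale (\<i> * of_int k) (fourier_proj k (mulu u F))) = - fourier_proj k G"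
  proof -
    have "cscale (- 1) H = - H" for H using cscale_of_real[of "-1" H] by simp
    then show ?thesis by (simp add: fourier_proj_mulu[OF u])
  qed
  finally have lim: "E \<longlonglongrightarrow> - fourier_proj k G" .
  show ?thesis
  proof (rule exI[of _ W], rule exI[of _ W'], rule exI[of _ W''], intro conjI allI)
    show "C2_periodic (W N) (W' N) (W'' N)" for N
      unfolding C2_periodic_def
      by (intro conjI allI d1 d2 cW'') (simp_all only: W_def W'_def W''_def cis_per)
    show "(\<lambda>N. slice k (W N)) \<longlonglongrightarrow> fourier_proj k F"
      using mode_sum_tendsto[of k F] by (simp only: msF)
    show "(\<lambda>N. slice k (mode_op (of_int k) u b (of_real (a * (of_int k)\<^sup>2)) (W N) (W'' N))) \<longlonglongrightarrow> - fourier_proj k G"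
      using lim by (simp only: E_def[abs_def])
  qed
qed

text \<open>For the truncations the energy identity gives the dissipation in \<open>y\<close> plus
  the contribution of \<open>a * k\<^sup>2\<close>, both nonnegative; the sign survives the limit of
  the inner products.\<close>

lemma drift_diffusion_mode_dissipative:
  assumes u: "continuous_on UNIV u" "\<And>y. u (y + 2 * pi) = u y"
    and FG: "(F, G) \<in> drift_diffusion a b u" and ab: "a \<ge> 0" "b \<ge> 0"
  shows "fourier_proj k F \<bullet> fourier_proj k G \<le> 0"
proof -
  obtain W W' W'' where C2: "\<And>N. C2_periodic (W N) (W' N) (W'' N)"
    and lim: "(\<lambda>N. slice k (W N)) \<longlonglongrightarrow> fourier_proj k F"
    "(\<lambda>N. slice k (mode_op (of_int k) u b (of_real (a * (of_int k)\<^sup>2)) (W N) (W'' N)))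
       \<longlonglongrightarrow> - fourier_proj k G"
    using drift_diffusion_mode_approx[OF u FG, of k] by blast
  have W: "(W N has_vector_derivative W' N y) (at y)" "(W' N has_vector_derivative W'' N y) (at y)"
    "continuous_on UNIV (W'' N)" "W N (y + 2 * pi) = W N y" "W' N (y + 2 * pi) = W' N y" for N y
    using C2[of N] unfolding C2_periodic_def by blast+
  let ?E = "\<lambda>N. mode_op (of_int k) u b (of_real (a * (of_int k)\<^sup>2)) (W N) (W'' N)"
  have cW: "continuous_on T (W N)" and cW': "continuous_on T (W' N)" for N T
    by (rule continuous_at_imp_continuous_on, blast intro: has_vector_derivative_continuous W)+
  have cE: "continuous_on T (?E N)" for N T
    by (intro continuous_intros cW continuous_on_subset[OF W(3)] continuous_on_subset[OF u(1)]) auto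
  have cu: "continuous_on UNIV (\<lambda>y. of_int k * u y)" by (intro continuous_intros u)
  have "slice k (W N) \<bullet> slice k (?E N) \<ge> 0" for N
  proof -
    have "slice k (W N) \<bullet> slice k (?E N) = Re (herm (slice k (?E N)) (slice k (W N)))"
      by (simp add: Re_herm inner_commute)
    also have "\<dots> = 2 * pi * Re (integral {0..2*pi} (\<lambda>y. ?E N y * cnj (W N y)))"
      unfolding herm_slice[OF cE cW] by simp
    also have "Re (integral {0..2*pi} (\<lambda>y. ?E N y * cnj (W N y))) = integral {0..2*pi} (\<lambda>y. ?E N y \<bullet> W N y)"
    proof -
      have "(\<lambda>y. ?E N y * cnj (W N y)) integrable_on {0..2*pi}"
        by (intro integrable_continuous_interval continuous_on_mult continuous_on_cnj cE cW)
      from integral_linear[OF this bounded_linear_Re] show ?thesis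
        by (simp add: o_def inner_complex_def)
    qed
    also have "\<dots> = integral {0..2*pi} (\<lambda>y. (\<i> * of_real (of_int k * u y) * W N y - of_real b * W'' N y) \<bullet> W N y + a * (of_int k)\<^sup>2 * (cmod (W N y))\<^sup>2)"
      unfolding cmod_power2 inner_complex_def
      by (intro Henstock_Kurzweil_Integration.integral_cong) (simp add: power2_eq_square algebra_simps)
    also have "\<dots> = b * l2sq (W' N) + a * (of_int k)\<^sup>2 * l2sq (W N)"
      using periodic_energy_identity[OF W(1,2,3) cu, of N "2 * pi" 0 b] W(4)[of N 0] W(5)[of N 0]
      by (subst Henstock_Kurzweil_Integration.integral_add)
        (auto intro!: integrable_continuous_interval continuous_intros cW continuous_on_subset[OF W(3)] continuous_on_subset[OF u(1)])
    also have "2 * pi * \<dots> \<ge> 0"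
      using ab by (intro mult_nonneg_nonneg add_nonneg_nonneg integral_nonneg)
        (auto intro!: integrable_continuous_interval continuous_intros cW cW')
    finally show ?thesis .
  qed
  then have "fourier_proj k F \<bullet> (- fourier_proj k G) \<ge> 0"
    by (intro LIMSEQ_le_const[OF tendsto_inner[OF lim]]) auto
  then show ?thesis by simp
qed

text \<open>Diffusion in \<open>x\<close> acts on the mode as the nonnegative constant
  \<open>a * k\<^sup>2\<close>, which is added to \<open>z\<close>. Hence one bound for
  \<open>mode_op\<close> serves both semigroups; the inequality is preserved in the limit of the
  truncations.\<close>

lemma drift_diffusion_mode_resolvent:
  assumes u: "continuous_on UNIV u" "\<And>y. u (y + 2 * pi) = u y"
    and FG: "(F, G) \<in> drift_diffusion a b u" and a: "a \<ge> 0" and z: "Re z \<ge> 0" and \<Psi>: "\<Psi> \<ge> 0"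
    and est: "resolvent_bound u (of_int k) b \<Psi>"
  shows "\<Psi> * norm (fourier_proj k F) \<le> norm (cscale z (fourier_proj k F) - fourier_proj k G)"
proof -
  obtain W W' W'' where C2: "\<And>N. C2_periodic (W N) (W' N) (W'' N)"
    and lim: "(\<lambda>N. slice k (W N)) \<longlonglongrightarrow> fourier_proj k F"
    "(\<lambda>N. slice k (mode_op (of_int k) u b (of_real (a * (of_int k)\<^sup>2)) (W N) (W'' N)))
       \<longlonglongrightarrow> - fourier_proj k G"
    using drift_diffusion_mode_approx[OF u FG, of k] by blast
  have W: "(W N has_vector_derivative W' N y) (at y)" "(W' N has_vector_derivative W'' N y) (at y)"
    "continuous_on UNIV (W'' N)" "W N (y + 2 * pi) = W N y" "W' N (y + 2 * pi) = W' N y" for N y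
    using C2[of N] unfolding C2_periodic_def by blast+
  let ?E = "\<lambda>N. mode_op (of_int k) u b (of_real (a * (of_int k)\<^sup>2)) (W N) (W'' N)"
  let ?R = "\<lambda>N. mode_op (of_int k) u b (of_real (a * (of_int k)\<^sup>2) + z) (W N) (W'' N)"
  have cW: "continuous_on T (W N)" for N T
    by (rule continuous_at_imp_continuous_on, blast intro: has_vector_derivative_continuous W)+
  have cE: "continuous_on T (?E N)" and cR: "continuous_on T (?R N)" for N T
    by (intro continuous_intros cW continuous_on_subset[OF W(3)] continuous_on_subset[OF u(1)]; simp)+
  have "\<Psi> * norm (slice k (W N)) \<le> norm (cscale z (slice k (W N)) + slice k (?E N))" for N
  proof (rule power2_le_imp_le)
    have "cscale z (slice k (W N)) + slice k (?E N) = slice k (?R N)"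
      using cW[of UNIV] cE[of UNIV]
      by (simp add: cscale_slice add_slice continuous_on_mult) (simp add: algebra_simps)
    then have "(norm (cscale z (slice k (W N)) + slice k (?E N)))\<^sup>2 = 2 * pi * l2sq (?R N)"
      using norm_slice[OF cR] by simp
    also have "\<dots> \<ge> 2 * pi * (\<Psi>\<^sup>2 * l2sq (W N))"
      using a z by (intro mult_left_mono est[unfolded resolvent_bound_def, rule_format, OF C2]) auto
    finally show "(\<Psi> * norm (slice k (W N)))\<^sup>2 \<le> (norm (cscale z (slice k (W N)) + slice k (?E N)))\<^sup>2"
      using norm_slice[OF cW] by (simp add: power_mult_distrib mult_ac)
  qed simp
  then have "\<Psi> * norm (fourier_proj k F) \<le> norm (cscale z (fourier_proj k F) + - fourier_proj k G)"
    by (intro LIMSEQ_le[OF tendsto_mult[OF tendsto_const tendsto_norm[OF lim(1)]]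
        tendsto_norm[OF tendsto_add[OF bounded_linear.tendsto[OF bounded_linear_cscale lim(1)] lim(2)]]]) auto
  then show ?thesis by simp
qed

section \<open>Completeness\<close>

lemma ennreal_power2_le_imp_le:
  assumes "x\<^sup>2 \<le> (ennreal c)\<^sup>2" "0 \<le> c"
  shows "x \<le> ennreal c"
proof (cases x)
  case (real r)
  then have "r\<^sup>2 \<le> c\<^sup>2" using assms by (simp add: ennreal_power)
  then show ?thesis using real assms power2_le_imp_le by (simp add: ennreal_le_iff)
next
  case top
  then show ?thesis using assms by (simp add: ennreal_power top_unique)
qed

text \<open>The Riesz-Fischer argument. The torus has finite measure, so Cauchy-Schwarz makes the
  increments summable in L1 and the representatives converge almost everywhere; Fatou's lemma turns
  this into convergence in norm.\<close>

lemma l2_fast_Cauchy_convergent: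
  fixes X :: "nat \<Rightarrow> l2_torus"
  assumes X: "\<And>n. norm (X (Suc n) - X n) \<le> (1 / 2) ^ n"
  shows "convergent X"
proof -
  define f where "f n = rep_l2_torus (X n)" for n
  have sq: "sq_integrable (f n)" and m [measurable]: "f n \<in> borel_measurable torus_measure"
    and Xf: "X n = abs_l2_torus (f n)" for n
    by (simp_all add: f_def)
  have norm_diff: "(\<integral>\<^sup>+z. ennreal ((cmod (f m z - f n z))\<^sup>2) \<partial>torus_measure) = ennreal ((norm (X m - X n))\<^sup>2)" for m n
  proof -
    have s: "sq_integrable (\<lambda>z. f m z - f n z)" by (intro sq_integrable_diff sq)
    have "(norm (X m - X n))\<^sup>2 = (\<integral>z. (cmod (f m z - f n z))\<^sup>2 \<partial>torus_measure)"
      unfolding Xf diff_abs_l2[OF sq sq] norm_abs_l2[OF s] by simp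
    then show ?thesis
      using s by (simp add: nn_integral_eq_integral sq_integrable_def)
  qed
  have dist_bound: "norm (X (n + k) - X n) \<le> 2 * (1 / 2) ^ n" for n k
  proof -
    have "norm (X (n + k) - X n) \<le> 2 * (1 / 2) ^ n - 2 * (1 / 2) ^ (n + k)"
    proof (induction k)
      case (Suc k)
      have "norm (X (n + Suc k) - X n) \<le> norm (X (Suc (n + k)) - X (n + k)) + norm (X (n + k) - X n)"
        using norm_triangle_ineq[of "X (Suc (n + k)) - X (n + k)" "X (n + k) - X n"] by simp
      also have "\<dots> \<le> (1 / 2) ^ (n + k) + (2 * (1 / 2) ^ n - 2 * (1 / 2) ^ (n + k))"
        by (intro add_mono X Suc)
      finally show ?case by simp
    qed simp
    also have "\<dots> \<le> 2 * (1 / 2) ^ n" by simp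
    finally show ?thesis .
  qed
  have L1: "(\<integral>\<^sup>+z. ennreal (cmod (f (Suc n) z - f n z)) \<partial>torus_measure) \<le> ennreal (2 * pi * (1 / 2) ^ n)" for n
  proof -
    have "(\<integral>\<^sup>+z. ennreal (cmod (f (Suc n) z - f n z)) * 1 \<partial>torus_measure)\<^sup>2
        \<le> (\<integral>\<^sup>+z. (ennreal (cmod (f (Suc n) z - f n z)))\<^sup>2 \<partial>torus_measure) * (\<integral>\<^sup>+z. 1\<^sup>2 \<partial>torus_measure)"
      by (rule Cauchy_Schwarz_nn_integral) measurable
    also have "\<dots> = ennreal ((norm (X (Suc n) - X n))\<^sup>2) * ennreal ((2 * pi)\<^sup>2)"
      using torus_fin.emeasure_eq_measure[of "space torus_measure"] measure_torus
      by (simp add: ennreal_power norm_diff)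
    also have "\<dots> \<le> ennreal (((1 / 2) ^ n)\<^sup>2) * ennreal ((2 * pi)\<^sup>2)"
      by (intro mult_right_mono ennreal_leI power_mono X) auto
    also have "\<dots> = (ennreal (2 * pi * (1 / 2) ^ n))\<^sup>2"
      by (simp add: ennreal_mult[symmetric] ennreal_power power_mult_distrib mult.commute)
    finally have "(\<integral>\<^sup>+z. ennreal (cmod (f (Suc n) z - f n z)) \<partial>torus_measure)\<^sup>2 \<le> (ennreal (2 * pi * (1 / 2) ^ n))\<^sup>2" by simp
    then show ?thesis by (rule ennreal_power2_le_imp_le) simp
  qed
  have ae: "AE z in torus_measure. convergent (\<lambda>n. f n z)"
  proof -
    have "(\<integral>\<^sup>+z. (\<Sum>n. ennreal (cmod (f (Suc n) z - f n z))) \<partial>torus_measure) = (\<Sum>n. \<integral>\<^sup>+z. ennreal (cmod (f (Suc n) z - f n z)) \<partial>torus_measure)"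
      by (rule nn_integral_suminf) measurable
    also have "\<dots> \<le> (\<Sum>n. ennreal (2 * pi * (1 / 2) ^ n))"
      by (intro suminf_le L1) auto
    also have "\<dots> = ennreal (\<Sum>n. 2 * pi * (1 / 2) ^ n)"
      by (intro suminf_ennreal2 summable_mult summable_geometric) auto
    also have "\<dots> < \<infinity>" by simp
    finally have "AE z in torus_measure. (\<Sum>n. ennreal (cmod (f (Suc n) z - f n z))) \<noteq> \<infinity>"
      by (intro nn_integral_PInf_AE) auto
    then show ?thesis
    proof eventually_elim
      case (elim z)
      then have "summable (\<lambda>n. cmod (f (Suc n) z - f n z))"
        by (intro summable_suminf_not_top) auto
      then have "summable (\<lambda>n. f (Suc n) z - f n z)" by (rule summable_norm_cancel)
      then have "convergent (\<lambda>n. \<Sum>i<n. f (Suc i) z - f i z)" by (simp add: summable_iff_convergent)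
      then have "convergent (\<lambda>n. f n z - f 0 z)" by (simp only: sum_lessThan_telescope[of "\<lambda>n. f n z"])
      from convergent_add[OF this convergent_const[of "f 0 z"]] show ?case by simp
    qed
  qed
  define g where "g z = lim (\<lambda>n. f n z)" for z
  have g [measurable]: "g \<in> borel_measurable torus_measure"
    unfolding g_def[abs_def] by (rule borel_measurable_lim_metric) (rule m)
  have fatou: "(\<integral>\<^sup>+z. ennreal ((cmod (g z - f n z))\<^sup>2) \<partial>torus_measure) \<le> ennreal ((2 * (1 / 2) ^ n)\<^sup>2)" for n
  proof -
    have "(\<integral>\<^sup>+z. ennreal ((cmod (g z - f n z))\<^sup>2) \<partial>torus_measure) = (\<integral>\<^sup>+z. liminf (\<lambda>k. ennreal ((cmod (f (n + k) z - f n z))\<^sup>2)) \<partial>torus_measure)"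
    proof (rule nn_integral_cong_AE)
      show "AE z in torus_measure. ennreal ((cmod (g z - f n z))\<^sup>2) = liminf (\<lambda>k. ennreal ((cmod (f (n + k) z - f n z))\<^sup>2))"
        using ae
      proof eventually_elim
        case (elim z)
        then have "(\<lambda>k. f k z) \<longlonglongrightarrow> g z" by (simp add: g_def convergent_LIMSEQ_iff)
        then have "(\<lambda>k. f (k + n) z) \<longlonglongrightarrow> g z" by (rule LIMSEQ_ignore_initial_segment)
        then have "(\<lambda>k. ennreal ((cmod (f (n + k) z - f n z))\<^sup>2)) \<longlonglongrightarrow> ennreal ((cmod (g z - f n z))\<^sup>2)"
          by (intro tendsto_ennrealI tendsto_intros) (simp add: add.commute)
        then show ?case by (intro lim_imp_Liminf[symmetric]) simp_all
      qed
    qed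
    also have "\<dots> \<le> liminf (\<lambda>k. \<integral>\<^sup>+z. ennreal ((cmod (f (n + k) z - f n z))\<^sup>2) \<partial>torus_measure)"
      by (rule nn_integral_liminf) measurable
    also have "\<dots> \<le> ennreal ((2 * (1 / 2) ^ n)\<^sup>2)"
      unfolding norm_diff
      by (intro order_trans[OF Liminf_le_Limsup Limsup_bounded] always_eventually allI ennreal_leI power_mono dist_bound norm_ge_zero) simp
    finally show ?thesis .
  qed
  have sqd: "sq_integrable (\<lambda>z. g z - f n z)" for n
    unfolding sq_integrable_def
    by (intro conjI integrableI_bounded) (use fatou[of n] in \<open>auto intro: le_less_trans\<close>)
  have "sq_integrable (\<lambda>z. (g z - f 0 z) + f 0 z)" by (intro sq_integrable_add sqd sq)
  then have sqg: "sq_integrable g" by simp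
  have b: "norm (X n - abs_l2_torus g) \<le> 2 * (1 / 2) ^ n" for n
  proof -
    have "norm (X n - abs_l2_torus g) = norm (abs_l2_torus (\<lambda>z. g z - f n z))"
      unfolding Xf by (subst norm_minus_commute) (simp add: diff_abs_l2 sqg sq)
    also have "\<dots> \<le> 2 * (1 / 2) ^ n"
    proof -
      have "ennreal (\<integral>z. (cmod (g z - f n z))\<^sup>2 \<partial>torus_measure) \<le> ennreal ((2 * (1 / 2) ^ n)\<^sup>2)"
        using fatou[of n] sqd[of n] by (simp add: nn_integral_eq_integral sq_integrable_def)
      then have "(\<integral>z. (cmod (g z - f n z))\<^sup>2 \<partial>torus_measure) \<le> (2 * (1 / 2) ^ n)\<^sup>2"
        by (simp add: ennreal_le_iff)
      then show ?thesis unfolding norm_abs_l2[OF sqd] by (intro real_le_lsqrt) auto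
    qed
    finally show ?thesis .
  qed
  have l: "(\<lambda>n. 2 * (1 / 2 :: real) ^ n) \<longlonglongrightarrow> 0"
    by (intro tendsto_mult_right_zero LIMSEQ_realpow_zero) auto
  have "(\<lambda>n. norm (X n - abs_l2_torus g)) \<longlonglongrightarrow> 0"
  proof (rule tendsto_sandwich[OF _ _ tendsto_const l])
    show "eventually (\<lambda>n. norm (X n - abs_l2_torus g) \<le> 2 * (1 / 2) ^ n) sequentially"
      by (rule always_eventually) (rule allI, rule b)
  qed simp
  then have "(\<lambda>n. X n - abs_l2_torus g) \<longlonglongrightarrow> 0" by (simp only: tendsto_norm_zero_iff)
  then have "X \<longlonglongrightarrow> abs_l2_torus g" by (simp only: LIM_zero_iff)
  then show ?thesis by (rule convergentI)
qed

text \<open>Completeness makes \<open>uniform_boundedness\<close>, and with it the local boundedness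
  of semigroups, available on this space.\<close>

instance l2_torus :: banach
proof
  fix X :: "nat \<Rightarrow> l2_torus" assume X: "Cauchy X"
  have "\<exists>N. \<forall>m\<ge>N. \<forall>n\<ge>N. norm (X m - X n) < (1 / 2) ^ k" for k
    using X unfolding Cauchy_iff by (simp add: zero_less_power)
  then obtain N where N: "\<And>k m n. m \<ge> N k \<Longrightarrow> n \<ge> N k \<Longrightarrow> norm (X m - X n) < (1 / 2) ^ k"
    by metis
  \<comment> \<open>Summing all earlier thresholds keeps \<open>r k\<close> above
    \<open>N k\<close>, and the summand \<open>k\<close> makes \<open>r\<close> strictly
    increasing.\<close>
  define r where "r k = (\<Sum>i\<le>k. N i) + k" for k
  have "strict_mono r" by (rule strict_monoI_Suc) (simp add: r_def)
  have rN: "r k \<ge> N k" for k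
    using member_le_sum[of k "{..k}" N] by (simp add: r_def)
  have "norm ((X \<circ> r) (Suc k) - (X \<circ> r) k) \<le> (1 / 2) ^ k" for k
  proof -
    have "r (Suc k) \<ge> N k" using rN[of k] \<open>strict_mono r\<close> by (meson less_imp_le lessI order_trans strict_mono_less)
    then show ?thesis using N[of k "r (Suc k)" "r k"] rN[of k] by simp
  qed
  then have "convergent (X \<circ> r)" by (rule l2_fast_Cauchy_convergent)
  then obtain L where "(X \<circ> r) \<longlonglongrightarrow> L" by (auto simp: convergent_def)
  then have "X \<longlonglongrightarrow> L" using Cauchy_converges_subseq[OF X \<open>strict_mono r\<close>] by blast
  then show "convergent X" by (auto simp: convergent_def)
qed

section \<open>Strongly continuous semigroups\<close>

text \<open>The images of \<open>x + \<xi>\<close> and \<open>x - \<xi>\<close> differ by twice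
  \<open>T \<xi>\<close>, so one of them is at least as large as \<open>T \<xi>\<close>. The factor
  2/3 lies below 1, since the norm need not be attained, and above 1/2, the share lost to the tail
  in the next proof.\<close>

lemma bounded_linear_almost_attains_onorm:
  assumes T: "bounded_linear T" and r: "r > 0"
  shows "\<exists>y. norm (y - x) \<le> r \<and> 2 / 3 * r * onorm T \<le> norm (T y)"
proof -
  interpret T: bounded_linear T by fact
  have "\<exists>\<xi>. norm \<xi> \<le> r \<and> 2 / 3 * r * onorm T \<le> norm (T \<xi>)"
  proof (cases "onorm T = 0")
    case True
    then show ?thesis using r by (intro exI[of _ 0]) simp
  next
    case False
    then have pos: "onorm T > 0" using onorm_pos_le[OF T] by simp
    have "\<exists>v. norm (T v) > 2 / 3 * onorm T * norm v"
    proof (rule ccontr)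
      assume "\<not> ?thesis"
      then have "norm (T v) \<le> 2 / 3 * onorm T * norm v" for v by (simp add: not_less)
      then have "onorm T \<le> 2 / 3 * onorm T" by (intro onorm_bound) (use pos in auto)
      then show False using pos by simp
    qed
    then obtain v where v: "norm (T v) > 2 / 3 * onorm T * norm v" by blast
    have "v \<noteq> 0" using v by (auto simp: T.zero)
    define \<xi> where "\<xi> = (r / norm v) *\<^sub>R v"
    have "norm (T \<xi>) = (r / norm v) * norm (T v)" using r by (simp add: \<xi>_def T.scaleR)
    also have "\<dots> \<ge> (r / norm v) * (2 / 3 * onorm T * norm v)"
      using v r by (intro mult_left_mono) auto
    finally have "norm (T \<xi>) \<ge> 2 / 3 * r * onorm T" using \<open>v \<noteq> 0\<close> by simp
    moreover have "norm \<xi> \<le> r" using r \<open>v \<noteq> 0\<close> by (simp add: \<xi>_def)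
    ultimately show ?thesis by blast
  qed
  then obtain \<xi> where \<xi>: "norm \<xi> \<le> r" "2 / 3 * r * onorm T \<le> norm (T \<xi>)" by blast
  have "T (x + \<xi>) - T (x - \<xi>) = 2 *\<^sub>R T \<xi>"
    by (simp add: T.add T.diff scaleR_2)
  then have "2 * norm (T \<xi>) = norm (T (x + \<xi>) - T (x - \<xi>))" by simp
  also have "\<dots> \<le> norm (T (x + \<xi>)) + norm (T (x - \<xi>))" by (rule norm_triangle_ineq4)
  finally have "norm (T \<xi>) \<le> norm (T (x + \<xi>)) \<or> norm (T \<xi>) \<le> norm (T (x - \<xi>))" by linarith
  then show ?thesis
  proof
    assume "norm (T \<xi>) \<le> norm (T (x + \<xi>))"
    then show ?thesis using \<xi> by (intro exI[of _ "x + \<xi>"]) auto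
  next
    assume "norm (T \<xi>) \<le> norm (T (x - \<xi>))"
    then show ?thesis using \<xi> by (intro exI[of _ "x - \<xi>"]) auto
  qed
qed

text \<open>
  Sokal's gliding hump: if the operator norms were unbounded, steps of length \<open>3\<^sup>-\<^sup>k\<close> along which
  operators of norm at least \<open>4\<^sup>k\<close> grow would converge to a point with unbounded orbit.
\<close>

lemma uniform_boundedness:
  fixes T :: "'i \<Rightarrow> 'a :: banach \<Rightarrow> 'b :: real_normed_vector"
  assumes T: "\<And>i. bounded_linear (T i)" and ptw: "\<And>x. \<exists>B. \<forall>i. norm (T i x) \<le> B"
  shows "\<exists>M. \<forall>i. onorm (T i) \<le> M"
proof (rule ccontr)
  assume "\<not> ?thesis"
  then have "\<exists>i. onorm (T i) > 4 ^ k" for k :: nat by (meson not_le)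
  then obtain n where n: "\<And>k::nat. onorm (T (n k)) > 4 ^ k" by metis
  define r where "r k = (1 / 3 :: real) ^ k" for k
  have ex: "\<exists>y. norm (y - x) \<le> r k \<and> 2 / 3 * r k * onorm (T (n k)) \<le> norm (T (n k) y)" for k x
    by (rule bounded_linear_almost_attains_onorm[OF T]) (simp add: r_def)
  define Y where "Y k x = (SOME y. norm (y - x) \<le> r k \<and> 2 / 3 * r k * onorm (T (n k)) \<le> norm (T (n k) y))" for k x
  have Y: "norm (Y k x - x) \<le> r k \<and> 2 / 3 * r k * onorm (T (n k)) \<le> norm (T (n k) (Y k x))" for k x
    unfolding Y_def by (rule someI_ex[OF ex])
  define x where "x = rec_nat 0 (\<lambda>k. Y (Suc k))"
  have x: "norm (x (Suc k) - x k) \<le> r (Suc k)" "2 / 3 * r (Suc k) * onorm (T (n (Suc k))) \<le> norm (T (n (Suc k)) (x (Suc k)))" for k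
    using Y by (simp_all add: x_def)
  \<comment> \<open>The geometric series of the steps after \<open>k\<close> sums to
    \<open>r k / 2\<close>.\<close>
  have tail: "norm (x (k + j) - x k) \<le> r k / 2 - r (k + j) / 2" for k j
  proof (induction j)
    case (Suc j)
    have "norm (x (k + Suc j) - x k) \<le> norm (x (Suc (k + j)) - x (k + j)) + norm (x (k + j) - x k)"
      using norm_triangle_ineq[of "x (Suc (k + j)) - x (k + j)" "x (k + j) - x k"] by simp
    also have "\<dots> \<le> r (Suc (k + j)) + (r k / 2 - r (k + j) / 2)" by (intro add_mono x Suc)
    finally show ?case by (simp add: r_def)
  qed simp
  have rpos: "r k > 0" for k by (simp add: r_def)
  have tail': "norm (x (k + j) - x k) \<le> r k / 2" for k j
    using tail[of k j] rpos[of "k + j"] by linarith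
  have r0: "r \<longlonglongrightarrow> 0" unfolding r_def[abs_def] by (rule LIMSEQ_realpow_zero) auto
  have "Cauchy x"
  proof (rule CauchyI')
    fix e :: real assume "e > 0"
    then obtain M where M: "\<And>m. m \<ge> M \<Longrightarrow> norm (r m) < e" using LIMSEQ_D[OF r0] by auto
    have "norm (x m - x p) < e" if "m \<ge> M" "p > m" for m p
    proof -
      have "norm (x p - x m) \<le> r m / 2" using tail'[of m "p - m"] that by simp
      also have "\<dots> < e" using M[OF that(1)] rpos[of m] by simp
      finally show ?thesis by (simp add: norm_minus_commute)
    qed
    then show "\<exists>M. \<forall>m\<ge>M. \<forall>p>m. dist (x m) (x p) < e" by (auto simp: dist_norm)
  qed
  then obtain L where L: "x \<longlonglongrightarrow> L" using Cauchy_convergent convergent_def by blast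
  have Lk: "norm (L - x k) \<le> r k / 2" for k
  proof (rule LIMSEQ_le_const2[of "\<lambda>j. norm (x (j + k) - x k)"])
    show "(\<lambda>j. norm (x (j + k) - x k)) \<longlonglongrightarrow> norm (L - x k)"
      by (intro tendsto_intros LIMSEQ_ignore_initial_segment L)
  qed (use tail'[of k] in \<open>auto simp: add.commute\<close>)
  obtain B where B: "\<And>i. norm (T i L) \<le> B" using ptw by blast
  \<comment> \<open>The tail takes 1/2 from the 2/3, leaving 1/6 of the step
    \<open>(1 / 3) ^ Suc k\<close> times a norm above \<open>4 ^ Suc k\<close>.\<close>
  have bound: "1 / 6 * (4 / 3) ^ Suc k \<le> B" for k
  proof -
    interpret T: bounded_linear "T (n (Suc k))" by (rule T)
    let ?o = "onorm (T (n (Suc k)))"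
    have o: "?o > 4 ^ Suc k" by (rule n)
    have "norm (T (n (Suc k)) (x (Suc k))) \<le> norm (T (n (Suc k)) L) + norm (T (n (Suc k)) (L - x (Suc k)))"
      using norm_triangle_ineq4[of "T (n (Suc k)) L" "T (n (Suc k)) (L - x (Suc k))"] by (simp add: T.diff)
    also have "\<dots> \<le> B + ?o * (r (Suc k) / 2)"
      using onorm[OF T, of "n (Suc k)" "L - x (Suc k)"] mult_left_mono[OF Lk[of "Suc k"], of ?o] onorm_pos_le[OF T] B
      by (intro add_mono) (auto intro: order_trans)
    finally have "2 / 3 * r (Suc k) * ?o \<le> B + ?o * (r (Suc k) / 2)" using x(2)[of k] by linarith
    then have "1 / 6 * r (Suc k) * ?o \<le> B" by (simp add: algebra_simps)
    moreover have "1 / 6 * r (Suc k) * 4 ^ Suc k \<le> 1 / 6 * r (Suc k) * ?o"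
      using o by (intro mult_left_mono) (auto simp: r_def)
    moreover have "r (Suc k) * 4 ^ Suc k = (4 / 3) ^ Suc k" unfolding r_def by (simp only: power_mult_distrib[symmetric]) simp
    ultimately show ?thesis by (simp only: mult.assoc)
  qed
  obtain k where "(4 / 3 :: real) ^ k > 6 * B" using real_arch_pow[of "4 / 3" "6 * B"] by auto
  moreover have "(4 / 3 :: real) ^ Suc k \<ge> (4 / 3) ^ k" by simp
  ultimately show False using bound[of k] by linarith
qed

text \<open>If the norms were unbounded near 0, some times tending to 0 would carry operators of
  unbounded norm. By strong continuity these converge at every vector, hence are pointwise bounded,
  against uniform boundedness.\<close>

lemma C0_semigroup_bounded_near_0:
  fixes S :: "real \<Rightarrow> 'a :: banach \<Rightarrow> 'a"
  assumes S: "C0_semigroup S"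
  shows "\<exists>\<delta>>0. \<exists>M. \<forall>t\<in>{0..\<delta>}. onorm (S t) \<le> M"
proof (rule ccontr)
  assume neg: "\<not> ?thesis"
  have bl: "bounded_linear (S t)" if "t \<ge> 0" for t using S that by (simp add: C0_semigroup_def)
  have "\<exists>t\<in>{0..1 / (real n + 1)}. onorm (S t) > real n + 1" for n
  proof -
    have "1 / (real n + 1) > 0" by simp
    then show ?thesis using neg not_le by metis
  qed
  then obtain t where t: "\<And>n. t n \<in> {0..1 / (real n + 1)}" "\<And>n. onorm (S (t n)) > real n + 1" by metis
  have "S 0 = id" using S by (simp add: C0_semigroup_def)
  \<comment> \<open>Convergence along \<open>at_right 0\<close> needs positive times; time 0 is
    excluded because the identity has norm at most 1.\<close>
  have pos: "t n > 0" for n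
  proof (rule ccontr)
    assume "\<not> ?thesis"
    then have "t n = 0" using t(1)[of n] by auto
    moreover have "onorm (id :: 'a \<Rightarrow> 'a) \<le> 1" using onorm_id_le by (simp add: id_def)
    ultimately show False using t(2)[of n] \<open>S 0 = id\<close> by simp
  qed
  have "t \<longlonglongrightarrow> 0"
  proof (rule tendsto_sandwich[of "\<lambda>_. 0" t _ "\<lambda>n. 1 / (real n + 1)"])
    show "(\<lambda>n. 1 / (real n + 1)) \<longlonglongrightarrow> 0" using LIMSEQ_inverse_real_of_nat by (simp add: inverse_eq_divide add.commute)
  qed (use t in auto)
  then have ft: "filterlim t (at_right 0) sequentially" using pos by (simp add: filterlim_at less_imp_neq[THEN not_sym])
  have "\<exists>M. \<forall>n. onorm (S (t n)) \<le> M"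
  proof (rule uniform_boundedness)
    show "bounded_linear (S (t n))" for n by (rule bl) (use pos less_imp_le in blast)
    fix f
    have "((\<lambda>t. S t f) \<longlongrightarrow> f) (at_right 0)" using S by (simp add: C0_semigroup_def)
    from filterlim_compose[OF this ft] have "convergent (\<lambda>n. S (t n) f)" by (auto simp: convergent_def)
    then have "Bseq (\<lambda>n. S (t n) f)" by (rule convergent_imp_Bseq)
    then show "\<exists>B. \<forall>n. norm (S (t n) f) \<le> B" by (auto simp: Bseq_def)
  qed
  then obtain M where M: "\<And>n. onorm (S (t n)) \<le> M" by blast
  obtain n where "real n \<ge> M" using real_arch_simple by blast
  then show False using M[of n] t(2)[of n] by linarith
qed

lemma C0_semigroup_bounded_on:
  fixes S :: "real \<Rightarrow> 'a :: banach \<Rightarrow> 'a"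
  assumes S: "C0_semigroup S"
  shows "\<exists>M>0. \<forall>t\<in>{0..T}. \<forall>f. norm (S t f) \<le> M * norm f"
proof -
  obtain \<delta> M0 where \<delta>: "\<delta> > 0" and M0: "\<And>t. t \<in> {0..\<delta>} \<Longrightarrow> onorm (S t) \<le> M0"
    using C0_semigroup_bounded_near_0[OF S] by blast
  have bl: "bounded_linear (S t)" if "t \<ge> 0" for t using S that by (simp add: C0_semigroup_def)
  define M where "M = max M0 1"
  have M: "norm (S t f) \<le> M * norm f" if "t \<in> {0..\<delta>}" for t f
  proof -
    have "norm (S t f) \<le> onorm (S t) * norm f" using onorm[OF bl] that by simp
    also have "\<dots> \<le> M * norm f" using M0[OF that] by (intro mult_right_mono) (auto simp: M_def)
    finally show ?thesis .
  qed
  have iter: "\<forall>t\<in>{0..real n * \<delta>}. \<forall>f. norm (S t f) \<le> M ^ n * norm f" for n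
  proof (induction n)
    case 0
    then show ?case using S by (simp add: C0_semigroup_def)
  next
    case (Suc n)
    show ?case
    proof (intro ballI allI)
      fix t f assume t: "t \<in> {0..real (Suc n) * \<delta>}"
      define s where "s = min t \<delta>"
      have s: "s \<in> {0..\<delta>}" "t - s \<in> {0..real n * \<delta>}" using t \<delta> by (auto simp: s_def min_def algebra_simps)
      have "S (s + (t - s)) = S s \<circ> S (t - s)" using S s unfolding C0_semigroup_def by (metis atLeastAtMost_iff)
      then have "norm (S t f) = norm (S s (S (t - s) f))" by simp
      also have "\<dots> \<le> M * norm (S (t - s) f)" by (rule M[OF s(1)])
      also have "\<dots> \<le> M * (M ^ n * norm f)" using Suc s(2) by (intro mult_left_mono) (auto simp: M_def)
      finally show "norm (S t f) \<le> M ^ Suc n * norm f" by simp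
    qed
  qed
  obtain n where "T / \<delta> \<le> real n" using real_arch_simple by blast
  then have "{0..T} \<subseteq> {0..real n * \<delta>}" using \<delta> by (auto simp: pos_divide_le_eq)
  moreover have "M ^ n > 0" by (simp add: M_def)
  ultimately show ?thesis using iter[of n] by blast
qed

text \<open>Only right continuity at 0 is postulated. Left continuity follows because
  \<open>S (s + h) f - S s f\<close> is the image of \<open>S h f - f\<close> under
  \<open>S s\<close>, whose norm is bounded uniformly in \<open>s\<close>.\<close>

lemma C0_semigroup_continuous_on:
  fixes S :: "real \<Rightarrow> 'a :: banach \<Rightarrow> 'a"
  assumes S: "C0_semigroup S"
  shows "continuous_on {0..T} (\<lambda>t. S t f)"
proof (unfold continuous_on_iff, intro ballI allI impI)
  fix t e assume t: "t \<in> {0..T}" and e: "(e::real) > 0"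
  obtain M where M0: "M > 0" and M: "\<And>t f. t \<in> {0..T} \<Longrightarrow> norm (S t f) \<le> M * norm f"
    using C0_semigroup_bounded_on[OF S] by blast
  have bl: "bounded_linear (S t)" if "t \<ge> 0" for t using S that by (simp add: C0_semigroup_def)
  have "((\<lambda>t. S t f) \<longlongrightarrow> f) (at_right 0)" using S by (simp add: C0_semigroup_def)
  then have "eventually (\<lambda>h. dist (S h f) f < e / M) (at_right 0)" using e M0 by (intro tendstoD) auto
  then obtain d where d: "d > 0" "\<And>h. 0 < h \<Longrightarrow> h < d \<Longrightarrow> norm (S h f - f) < e / M"
    unfolding eventually_at_right_field by (auto simp: dist_norm)
  have step: "norm (S (s + h) f - S s f) < e" if "s \<ge> 0" "s \<le> T" "0 < h" "h < d" for s h
  proof -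
    have "S (s + h) = S s \<circ> S h" using S that unfolding C0_semigroup_def by (metis less_imp_le)
    then have "S (s + h) f - S s f = S s (S h f - f)"
      using linear_diff[OF bounded_linear.linear[OF bl[OF that(1)]]] by simp
    also have "norm \<dots> \<le> M * norm (S h f - f)" using M that by simp
    also have "\<dots> < M * (e / M)" using d(2)[OF that(3,4)] M0 by (intro mult_strict_left_mono)
    finally show ?thesis using M0 by simp
  qed
  show "\<exists>d>0. \<forall>s\<in>{0..T}. dist s t < d \<longrightarrow> dist (S s f) (S t f) < e"
  proof (intro exI[of _ d] conjI d(1) ballI impI)
    fix s assume s: "s \<in> {0..T}" "dist s t < d"
    consider "s = t" | "s > t" | "s < t" by linarith
    then show "dist (S s f) (S t f) < e"
    proof cases
      case 2
      then show ?thesis using step[of t "s - t"] s t by (simp add: dist_norm)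
    next
      case 3
      then show ?thesis using step[of s "t - s"] s t by (simp add: dist_norm norm_minus_commute)
    qed (use e in simp)
  qed
qed

section \<open>Orbits starting in the domain of the generator\<close>

lemma generator_invariant:
  fixes S :: "real \<Rightarrow> 'a :: real_normed_vector \<Rightarrow> 'a"
  assumes S: "C0_semigroup S" and fg: "(f, g) \<in> generator S" and t: "t \<ge> 0"
  shows "(S t f, S t g) \<in> generator S"
proof -
  have bl: "bounded_linear (S t)" using S t by (simp add: C0_semigroup_def)
  have "((\<lambda>h. (S h f - f) /\<^sub>R h) \<longlongrightarrow> g) (at_right 0)" using fg by (simp add: generator_def)
  then have "((\<lambda>h. S t ((S h f - f) /\<^sub>R h)) \<longlongrightarrow> S t g) (at_right 0)" by (rule bounded_linear.tendsto[OF bl])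
  moreover have "eventually (\<lambda>h. S t ((S h f - f) /\<^sub>R h) = (S h (S t f) - S t f) /\<^sub>R h) (at_right 0)"
    unfolding eventually_at_right_field
  proof (intro exI[of _ 1] conjI allI impI)
    fix h :: real assume "0 < h"
    then have "S (t + h) = S t \<circ> S h" "S (h + t) = S h \<circ> S t" using S t unfolding C0_semigroup_def by (metis less_imp_le)+
    then have "S h (S t f) = S t (S h f)" by (metis add.commute comp_apply)
    then show "S t ((S h f - f) /\<^sub>R h) = (S h (S t f) - S t f) /\<^sub>R h"
      by (simp add: linear_diff[OF bounded_linear.linear[OF bl]] linear_cmul[OF bounded_linear.linear[OF bl]])
  qed simp
  ultimately show ?thesis unfolding generator_def by (auto elim: Lim_transform_eventually)
qed

text \<open>The generator is a right derivative at 0. For difference quotients from the left the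
  base point moves with \<open>s\<close>: the uniform bound on \<open>S s\<close> controls the
  quotient based at \<open>s\<close>, and continuity of the orbit of \<open>g\<close> exchanges
  \<open>S s g\<close> for \<open>S t g\<close>.\<close>

lemma C0_semigroup_has_vector_derivative:
  fixes S :: "real \<Rightarrow> 'a :: banach \<Rightarrow> 'a"
  assumes S: "C0_semigroup S" and fg: "(f, g) \<in> generator S" and t: "t \<in> {0..T}"
  shows "((\<lambda>t. S t f) has_vector_derivative S t g) (at t within {0..T})"
  unfolding has_vector_derivative_def has_derivative_within_alt
proof (intro conjI allI impI)
  show "bounded_linear (\<lambda>x. x *\<^sub>R S t g)" by (rule bounded_linear_scaleR_left)
  fix e :: real assume e: "e > 0"
  obtain M where M0: "M > 0" and M: "\<And>t f. t \<in> {0..T} \<Longrightarrow> norm (S t f) \<le> M * norm f"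
    using C0_semigroup_bounded_on[OF S] by blast
  have bl: "linear (S t)" if "t \<ge> 0" for t using S that by (simp add: C0_semigroup_def bounded_linear.linear)
  have "((\<lambda>h. (S h f - f) /\<^sub>R h) \<longlongrightarrow> g) (at_right 0)" using fg by (simp add: generator_def)
  then have "eventually (\<lambda>h. dist ((S h f - f) /\<^sub>R h) g < e / (2 * M)) (at_right 0)" using e M0 by (intro tendstoD) auto
  then obtain d1 where d1: "d1 > 0" "\<And>h. 0 < h \<Longrightarrow> h < d1 \<Longrightarrow> norm ((S h f - f) /\<^sub>R h - g) < e / (2 * M)"
    unfolding eventually_at_right_field by (auto simp: dist_norm)
  have q: "norm (S h f - f - h *\<^sub>R g) \<le> e / (2 * M) * h" if "0 < h" "h < d1" for h
  proof -
    have "S h f - f - h *\<^sub>R g = h *\<^sub>R ((S h f - f) /\<^sub>R h - g)" using that by (simp add: scaleR_diff_right)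
    then have "norm (S h f - f - h *\<^sub>R g) = h * norm ((S h f - f) /\<^sub>R h - g)" using that by simp
    also have "\<dots> \<le> h * (e / (2 * M))" using d1(2)[OF that] that by (intro mult_left_mono) auto
    finally show ?thesis by (simp add: mult.commute)
  qed
  have "continuous_on {0..T} (\<lambda>t. S t g)" by (rule C0_semigroup_continuous_on[OF S])
  then obtain d2 where d2: "d2 > 0" "\<And>s. s \<in> {0..T} \<Longrightarrow> dist s t < d2 \<Longrightarrow> dist (S s g) (S t g) < e / 2"
    using t e unfolding continuous_on_iff by (meson half_gt_zero)
  have step: "norm (S (s + h) f - S s f - h *\<^sub>R S s g) \<le> e / 2 * h" if "s \<ge> 0" "s \<le> T" "0 < h" "h < d1" for s h
  proof -
    have "S (s + h) = S s \<circ> S h" using S that unfolding C0_semigroup_def by (metis less_imp_le)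
    then have "S (s + h) f - S s f - h *\<^sub>R S s g = S s (S h f - f - h *\<^sub>R g)"
      using linear_diff[OF bl[OF that(1)]] linear_cmul[OF bl[OF that(1)]] by simp
    also have "norm \<dots> \<le> M * norm (S h f - f - h *\<^sub>R g)" using M that by simp
    also have "\<dots> \<le> M * (e / (2 * M) * h)" using q[OF that(3,4)] M0 by (intro mult_left_mono) auto
    finally show ?thesis using M0 by simp
  qed
  show "\<exists>d>0. \<forall>s\<in>{0..T}. norm (s - t) < d \<longrightarrow> norm (S s f - S t f - (s - t) *\<^sub>R S t g) \<le> e * norm (s - t)"
  proof (intro exI[of _ "min d1 d2"] conjI ballI impI)
    fix s assume s: "s \<in> {0..T}" "norm (s - t) < min d1 d2"
    consider "s = t" | "s > t" | "s < t" by linarith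
    then show "norm (S s f - S t f - (s - t) *\<^sub>R S t g) \<le> e * norm (s - t)"
    proof cases
      case 2
      then have "norm (S s f - S t f - (s - t) *\<^sub>R S t g) \<le> e / 2 * (s - t)"
        using step[of t "s - t"] s t by simp
      also have "\<dots> \<le> e * norm (s - t)" using 2 e by simp
      finally show ?thesis .
    next
      case 3
      have "S s f - S t f - (s - t) *\<^sub>R S t g = - (S t f - S s f - (t - s) *\<^sub>R S s g) - (t - s) *\<^sub>R (S s g - S t g)"
        by (simp add: algebra_simps)
      then have "norm (S s f - S t f - (s - t) *\<^sub>R S t g) \<le> norm (S t f - S s f - (t - s) *\<^sub>R S s g) + norm ((t - s) *\<^sub>R (S s g - S t g))"
        by (metis norm_triangle_ineq4 norm_minus_cancel)
      also have "norm (S t f - S s f - (t - s) *\<^sub>R S s g) \<le> e / 2 * (t - s)"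
        using step[of s "t - s"] s t 3 by simp
      also have "norm ((t - s) *\<^sub>R (S s g - S t g)) \<le> (t - s) * (e / 2)"
        using d2(2)[of s] s 3 by (auto simp: dist_norm intro!: mult_left_mono)
      finally show ?thesis using 3 by (simp add: algebra_simps)
    qed simp
  qed (use d1 d2 in auto)
qed

section \<open>Decay of orbits from a resolvent estimate\<close>

text \<open>The indices start at 1 because each node of the implicit Euler scheme is compared with
  its predecessor.\<close>

definition dft :: "nat \<Rightarrow> (nat \<Rightarrow> l2_torus) \<Rightarrow> nat \<Rightarrow> l2_torus" where
  "dft N X m = (\<Sum>n\<in>{1..N}. cscale (cis (- (2 * pi * real m * real n / real N))) (X n))"

lemma sum_roots_of_unity:
  assumes n: "n \<in> {1..N}" and n': "n' \<in> {1..N}"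
  shows "(\<Sum>m<N. cis (- (2 * pi * real m * real n / real N)) * cnj (cis (- (2 * pi * real m * real n' / real N))))
    = (if n = n' then of_nat N else 0)"
proof -
  define \<theta> where "\<theta> = 2 * pi * (real n' - real n) / real N"
  have N: "N > 0" using n by auto
  have t: "cis (- (2 * pi * real m * real n / real N)) * cnj (cis (- (2 * pi * real m * real n' / real N))) = cis \<theta> ^ m" for m
  proof -
    have "- (2 * pi * real m * real n / real N) + 2 * pi * real m * real n' / real N = real m * \<theta>"
      using N by (simp add: \<theta>_def field_simps)
    then have "cis (- (2 * pi * real m * real n / real N)) * cnj (cis (- (2 * pi * real m * real n' / real N))) = cis (real m * \<theta>)"
      by (simp add: cis_cnj cis_mult)
    then show ?thesis by (simp only: Complex.DeMoivre)
  qed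
  show ?thesis
  proof (cases "n = n'")
    case True
    then show ?thesis unfolding t by (simp add: \<theta>_def)
  next
    case False
    have ne: "cis \<theta> \<noteq> 1"
    proof
      assume "cis \<theta> = 1"
      then have "cos \<theta> = 1" by (metis Re_complex_of_real cis.simps(1) one_complex.simps(1))
      then obtain i :: int where "\<theta> = of_int i * 2 * pi" using cos_one_2pi_int by auto
      then have "(2 * pi) * (real n' - real n) = (2 * pi) * (of_int i * real N)"
        using N by (simp add: \<theta>_def divide_eq_eq mult_ac)
      then have "real n' - real n = of_int i * real N" by (subst (asm) mult_left_cancel) auto
      then have eq: "int n' - int n = i * int N" by (metis of_int_diff of_int_eq_iff of_int_mult of_int_of_nat_eq)
      \<comment> \<open>Two indices from 1 to \<open>N\<close> differ by less than \<open>N\<close>,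
        so the only multiple of \<open>N\<close> available is 0.\<close>
      have "\<bar>int n' - int n\<bar> < int N" using n n' by auto
      then have "\<bar>i\<bar> * int N < 1 * int N" unfolding eq abs_mult by simp
      then have "\<bar>i\<bar> < 1" by (rule mult_right_less_imp_less) simp
      then have "i = 0" by simp
      then show False using eq False by simp
    qed
    have "cis \<theta> ^ N = 1"
    proof -
      have "real N * \<theta> = 2 * pi * of_int (int n' - int n)" using N by (simp add: \<theta>_def)
      then show ?thesis unfolding Complex.DeMoivre by (simp only: cis_multiple_2pi Ints_of_int)
    qed
    then show ?thesis unfolding t using False by (simp add: geometric_sum[OF ne])
  qed
qed

lemma dft_Parseval: "(\<Sum>m<N. (norm (dft N X m))\<^sup>2) = real N * (\<Sum>n\<in>{1..N}. (norm (X n))\<^sup>2)"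
proof -
  let ?w = "\<lambda>m n. cis (- (2 * pi * real m * real n / real N))"
  have "complex_of_real (\<Sum>m<N. (norm (dft N X m))\<^sup>2) = (\<Sum>m<N. herm (dft N X m) (dft N X m))"
    by (simp add: herm_self)
  also have "\<dots> = (\<Sum>m<N. \<Sum>n'\<in>{1..N}. \<Sum>n\<in>{1..N}. (?w m n * cnj (?w m n')) * herm (X n) (X n'))"
    unfolding dft_def herm_linear_simps by (simp add: mult_ac sum_distrib_left)
  also have "\<dots> = (\<Sum>n'\<in>{1..N}. \<Sum>n\<in>{1..N}. (\<Sum>m<N. ?w m n * cnj (?w m n')) * herm (X n) (X n'))"
    unfolding sum_distrib_right by (subst sum.swap, rule sum.cong[OF refl], rule sum.swap)
  also have "\<dots> = (\<Sum>n'\<in>{1..N}. \<Sum>n\<in>{1..N}. if n = n' then of_nat N * herm (X n) (X n') else 0)"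
    by (intro sum.cong refl) (simp add: sum_roots_of_unity)
  also have "\<dots> = (\<Sum>n'\<in>{1..N}. of_nat N * herm (X n') (X n'))"
    by (intro sum.cong refl) (simp add: sum.delta)
  also have "\<dots> = complex_of_real (real N * (\<Sum>n\<in>{1..N}. (norm (X n))\<^sup>2))"
    by (simp add: herm_self sum_distrib_left)
  finally show ?thesis unfolding of_real_eq_iff .
qed

text \<open>The shift becomes cyclic because \<open>X\<close> vanishes at both ends: the term at
  \<open>N\<close> may be added and the one at 0 dropped.\<close>

lemma dft_shift:
  assumes N: "N > 0" and X: "X 0 = 0" "X N = 0"
  shows "dft N (\<lambda>n. X (n - 1)) m = cscale (cis (- (2 * pi * real m / real N))) (dft N X m)"
proof -
  let ?w = "\<lambda>n. cis (- (2 * pi * real m * real n / real N))"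
  have w: "?w (Suc n) = cis (- (2 * pi * real m / real N)) * ?w n" for n
    by (simp add: cis_mult) (simp add: field_simps add_divide_distrib)
  have "dft N (\<lambda>n. X (n - 1)) m = (\<Sum>n<N. cscale (?w (Suc n)) (X n))"
    unfolding dft_def by (rule sum.reindex_bij_witness[of _ Suc "\<lambda>n. n - 1"]) auto
  also have "\<dots> = (\<Sum>n\<le>N. cscale (?w (Suc n)) (X n))"
    using X by (simp add: lessThan_Suc_atMost[symmetric])
  also have "\<dots> = (\<Sum>n\<in>{1..N}. cscale (?w (Suc n)) (X n))"
    by (rule sum.mono_neutral_right) (use X in \<open>auto simp: not_less_eq_eq\<close>)
  also have "\<dots> = cscale (cis (- (2 * pi * real m / real N))) (dft N X m)"
    unfolding dft_def linear_sum[OF bounded_linear.linear[OF bounded_linear_cscale]] w by simp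
  finally show ?thesis .
qed

text \<open>The graph of an operator as a relation. Only finite sums are transformed, so linearity
  does the work for which continuous time would use closedness. The instances are the
  drift-diffusion graph and its projection to one mode.\<close>

locale complex_linear_relation =
  fixes D :: "(l2_torus \<times> l2_torus) set"
  assumes zero: "(0, 0) \<in> D"
    and add: "(x, y) \<in> D \<Longrightarrow> (x', y') \<in> D \<Longrightarrow> (x + x', y + y') \<in> D"
    and scale: "(x, y) \<in> D \<Longrightarrow> (cscale c x, cscale c y) \<in> D"
begin

lemma sum:
  assumes "finite A" "\<And>i. i \<in> A \<Longrightarrow> (X i, Y i) \<in> D"
  shows "((\<Sum>i\<in>A. X i), (\<Sum>i\<in>A. Y i)) \<in> D"
  using assms by (induction A rule: finite_induct) (auto intro: zero add)

lemma dft: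
  assumes "\<And>n. n \<in> {1..N} \<Longrightarrow> (X n, Y n) \<in> D"
  shows "(dft N X m, dft N Y m) \<in> D"
  unfolding dft_def by (rule sum, simp, rule scale, rule assms)

text \<open>
  Since the symbol \<open>(1 - \<omega>) / h\<close> of the backward difference quotient has nonnegative real part,
  the resolvent bound on the closed half plane applies to every discrete frequency.
\<close>

lemma discrete_resolvent_estimate:
  fixes X Y :: "nat \<Rightarrow> l2_torus"
  assumes res: "\<And>x y z. (x, y) \<in> D \<Longrightarrow> Re z \<ge> 0 \<Longrightarrow> \<Psi> * norm x \<le> norm (cscale z x - y)"
    and \<Psi>: "\<Psi> \<ge> 0" and N: "N > 0" and h: "h > 0" and X: "X 0 = 0" "X N = 0"
    and XY: "\<And>n. n \<in> {1..N} \<Longrightarrow> (X n, Y n) \<in> D"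
  shows "\<Psi>\<^sup>2 * (\<Sum>n\<in>{1..N}. (norm (X n))\<^sup>2) \<le> (\<Sum>n\<in>{1..N}. (norm ((X n - X (n - 1)) /\<^sub>R h - Y n))\<^sup>2)"
proof -
  define G where "G n = (X n - X (n - 1)) /\<^sub>R h - Y n" for n
  have lin: "linear (cscale c)" for c by (rule bounded_linear.linear[OF bounded_linear_cscale])
  have m: "\<Psi> * norm (dft N X m) \<le> norm (dft N G m)" for m
  proof -
    define w where "w = cis (- (2 * pi * real m / real N))"
    define z where "z = (1 - w) / of_real h"
    have "dft N G m = inverse h *\<^sub>R (dft N X m - dft N (\<lambda>n. X (n - 1)) m) - dft N Y m"
      unfolding dft_def G_def
      by (simp add: linear_diff[OF lin] linear_cmul[OF lin] sum_subtractf scaleR_diff_right scaleR_sum_right)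
    also have "inverse h *\<^sub>R (dft N X m - dft N (\<lambda>n. X (n - 1)) m) = cscale z (dft N X m)"
    proof -
      have e: "dft N X m = cscale (1 - w) (dft N X m) + cscale w (dft N X m)"
        using cscale_add_left[of "1 - w" w "dft N X m"] by simp
      have "dft N X m - cscale w (dft N X m) = cscale (1 - w) (dft N X m)"
        unfolding diff_eq_eq by (rule e)
      moreover have "dft N (\<lambda>n. X (n - 1)) m = cscale w (dft N X m)"
        unfolding w_def by (rule dft_shift[OF N X])
      ultimately show ?thesis
        by (simp add: cscale_of_real[symmetric] z_def divide_inverse mult.commute)
    qed
    finally have "dft N G m = cscale z (dft N X m) - dft N Y m" .
    moreover have "Re z \<ge> 0" using h by (simp add: z_def w_def Re_divide_of_real)
    ultimately show ?thesis using res[OF dft[OF XY, where m = m]] by simp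
  qed
  have "\<Psi>\<^sup>2 * (real N * (\<Sum>n\<in>{1..N}. (norm (X n))\<^sup>2)) = (\<Sum>m<N. (\<Psi> * norm (dft N X m))\<^sup>2)"
    by (simp only: power_mult_distrib sum_distrib_left[symmetric] dft_Parseval)
  also have "\<dots> \<le> (\<Sum>m<N. (norm (dft N G m))\<^sup>2)"
    using \<Psi> by (intro sum_mono power_mono m) auto
  also have "\<dots> = real N * (\<Sum>n\<in>{1..N}. (norm (G n))\<^sup>2)" by (rule dft_Parseval)
  finally show ?thesis using N by (simp add: G_def mult.left_commute)
qed

text \<open>The cut-off \<open>\<xi> t = min t (T - t)\<close> vanishes at both ends, is 1-Lipschitz
  and at least \<open>T / 4\<close> on the middle half. There monotonicity keeps the cut-off orbit
  above \<open>T / 4 * norm (g T)\<close>, while the defect it leaves in the equation is at most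
  \<open>norm (g 0)\<close> up to discretisation. Comparing mean squares gives the factor
  \<open>sqrt 32\<close>, rounded up to 6.\<close>

lemma orbit_decay:
  fixes g g' :: "real \<Rightarrow> l2_torus"
  assumes res: "\<And>x y z. (x, y) \<in> D \<Longrightarrow> Re z \<ge> 0 \<Longrightarrow> \<Psi> * norm x \<le> norm (cscale z x - y)"
    and \<Psi>: "\<Psi> \<ge> 0" and T: "T > 0"
    and gD: "\<And>t. t \<in> {0..T} \<Longrightarrow> (g t, g' t) \<in> D"
    and d: "\<And>t. t \<in> {0..T} \<Longrightarrow> (g has_vector_derivative g' t) (at t within {0..T})"
    and c: "continuous_on {0..T} g'"
    and mono: "\<And>t. t \<in> {0..T} \<Longrightarrow> norm (g T) \<le> norm (g t) \<and> norm (g t) \<le> norm (g 0)"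
  shows "\<Psi> * T * norm (g T) \<le> 6 * norm (g 0)"
proof -
  have main: "\<Psi> * T * norm (g T) \<le> 6 * (T * \<eta> + norm (g 0))" if \<eta>: "\<eta> > 0" for \<eta>
  proof -
    have "uniformly_continuous_on {0..T} g'" using c by (rule compact_uniformly_continuous) simp
    then obtain \<delta> where \<delta>: "\<delta> > 0" "\<And>s t. s \<in> {0..T} \<Longrightarrow> t \<in> {0..T} \<Longrightarrow> dist s t < \<delta> \<Longrightarrow> dist (g' s) (g' t) < \<eta>"
      unfolding uniformly_continuous_on_def using \<eta> by meson
    obtain M0 :: nat where "T / \<delta> < real M0" using reals_Archimedean2 by blast
    define M where "M = Suc M0"
    \<comment> \<open>A multiple of 4, so that the nodes \<open>M + 1\<close> to
      \<open>3 * M\<close>, half of all nodes, lie in the middle half of the interval.\<close>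
    define N where "N = 4 * M"
    define h where "h = T / real N"
    have M: "M > 0" and N: "N > 0" by (simp_all add: M_def N_def)
    have h: "h > 0" using T N by (simp add: h_def)
    have Nh: "real N * h = T" using N by (simp add: h_def)
    have h\<delta>: "h < \<delta>"
    proof -
      have "T < real M0 * \<delta>" using \<open>T / \<delta> < real M0\<close> \<delta>(1) by (simp add: pos_divide_less_eq)
      also have "\<dots> \<le> real N * \<delta>" using \<delta>(1) by (intro mult_right_mono) (auto simp: N_def M_def)
      finally show ?thesis using N by (simp add: h_def pos_divide_less_eq mult.commute)
    qed
    define \<tau> where "\<tau> n = real n * h" for n
    have \<tau>: "\<tau> n \<in> {0..T}" if "n \<le> N" for n
      using that h mult_right_mono[of "real n" "real N" h] Nh by (auto simp: \<tau>_def)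
    define \<xi> where "\<xi> t = min t (T - t)" for t
    define X where "X n = \<xi> (\<tau> n) *\<^sub>R g (\<tau> n)" for n
    define Y where "Y n = \<xi> (\<tau> n) *\<^sub>R g' (\<tau> n)" for n
    have X0: "X 0 = 0" "X N = 0" using T Nh by (simp_all add: X_def \<xi>_def \<tau>_def)
    have XY: "(X n, Y n) \<in> D" if "n \<in> {1..N}" for n
      unfolding X_def Y_def cscale_of_real[symmetric] by (intro scale gD \<tau>) (use that in auto)
    have G: "norm ((X n - X (n - 1)) /\<^sub>R h - Y n) \<le> T * \<eta> + norm (g 0)" if n: "n \<in> {1..N}" for n
    proof -
      define s t where "s = \<tau> (n - 1)" and "t = \<tau> n"
      have st: "t = s + h" using n by (simp add: s_def t_def \<tau>_def of_nat_diff algebra_simps)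
      have sT: "s \<in> {0..T}" and tT: "t \<in> {0..T}" unfolding s_def t_def using n by (intro \<tau>; auto)+
      \<comment> \<open>The defect of the implicit Euler step, with the derivative taken at the
        right end \<open>t\<close>; it is small by uniform continuity of \<open>g'\<close>, since
        \<open>h < \<delta>\<close>.\<close>
      have lin: "norm (g t - g s - h *\<^sub>R g' t) \<le> h * \<eta>"
      proof -
        have "norm (g t - g s - (t - s) *\<^sub>R g' t) \<le> norm (t - s) * \<eta>"
        proof (rule vector_differentiable_bound_linearization[where S = "{s..t}"])
          show "(g has_vector_derivative g' r) (at r within {s..t})" if "r \<in> {s..t}" for r
            by (rule has_vector_derivative_within_subset[OF d]) (use that sT tT in auto)
          show "closed_segment s t \<subseteq> {s..t}" using st h by (simp add: closed_segment_eq_real_ivl)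
          show "norm (g' r - g' t) \<le> \<eta>" if "r \<in> {s..t}" for r
            using \<delta>(2)[of r t] that sT tT st h\<delta> by (auto simp: dist_norm less_imp_le)
        qed (use st h in auto)
        then show ?thesis using st h by simp
      qed
      \<comment> \<open>Discrete product rule: the Euler defect of \<open>g\<close>, weighted by the
        cut-off, plus the increment of the cut-off.\<close>
      have "(X n - X (n - 1)) /\<^sub>R h - Y n = inverse h *\<^sub>R (\<xi> t *\<^sub>R (g t - g s - h *\<^sub>R g' t) + (\<xi> t - \<xi> s) *\<^sub>R g s)"
      proof -
        have XY': "X n = \<xi> t *\<^sub>R g t" "X (n - 1) = \<xi> s *\<^sub>R g s" "Y n = \<xi> t *\<^sub>R g' t"
          by (simp_all only: X_def Y_def s_def t_def)
        show ?thesis unfolding XY' using h by (simp add: algebra_simps)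
      qed
      also have "norm \<dots> \<le> inverse h * (\<bar>\<xi> t\<bar> * norm (g t - g s - h *\<^sub>R g' t) + \<bar>\<xi> t - \<xi> s\<bar> * norm (g s))"
        using h norm_triangle_ineq[of "\<xi> t *\<^sub>R (g t - g s - h *\<^sub>R g' t)" "(\<xi> t - \<xi> s) *\<^sub>R g s"] by simp
      also have "\<dots> \<le> inverse h * (T * (h * \<eta>) + h * norm (g 0))"
      proof -
        have "\<bar>\<xi> t\<bar> \<le> T" "\<bar>\<xi> t - \<xi> s\<bar> \<le> h" using tT st h by (auto simp: \<xi>_def)
        moreover have "norm (g s) \<le> norm (g 0)" using mono[OF sT] by simp
        ultimately show ?thesis using h lin T by (intro mult_left_mono add_mono mult_mono) auto
      qed
      also have "\<dots> = T * \<eta> + norm (g 0)" using h by (simp add: field_simps)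
      finally show ?thesis .
    qed
    have low: "real (2 * M) * (T / 4 * norm (g T))\<^sup>2 \<le> (\<Sum>n\<in>{1..N}. (norm (X n))\<^sup>2)"
    proof -
      have "real (2 * M) * (T / 4 * norm (g T))\<^sup>2 = (\<Sum>n\<in>{M+1..3*M}. (T / 4 * norm (g T))\<^sup>2)" by simp
      also have "\<dots> \<le> (\<Sum>n\<in>{M+1..3*M}. (norm (X n))\<^sup>2)"
      proof (intro sum_mono power_mono)
        fix n assume n: "n \<in> {M+1..3*M}"
        have nN: "n \<le> N" using n by (simp add: N_def)
        have Mh: "real M * h = T / 4" using Nh by (simp add: N_def)
        have "real M * h \<le> real n * h" "real n * h \<le> real (3 * M) * h" using n h by (intro mult_right_mono; simp)+
        then have "T / 4 \<le> \<xi> (\<tau> n)" using Mh by (simp add: \<xi>_def \<tau>_def)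
        then have "T / 4 \<le> \<bar>\<xi> (\<tau> n)\<bar>" by simp
        moreover have "norm (g T) \<le> norm (g (\<tau> n))" using mono[OF \<tau>[OF nN]] by simp
        ultimately have "T / 4 * norm (g T) \<le> \<bar>\<xi> (\<tau> n)\<bar> * norm (g (\<tau> n))" by (intro mult_mono) auto
        then show "T / 4 * norm (g T) \<le> norm (X n)" by (simp add: X_def)
      qed (use T in auto)
      also have "\<dots> \<le> (\<Sum>n\<in>{1..N}. (norm (X n))\<^sup>2)" by (rule sum_mono2) (auto simp: N_def)
      finally show ?thesis .
    qed
    have "\<Psi>\<^sup>2 * (real (2 * M) * (T / 4 * norm (g T))\<^sup>2) \<le> \<Psi>\<^sup>2 * (\<Sum>n\<in>{1..N}. (norm (X n))\<^sup>2)"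
      by (intro mult_left_mono low) simp
    also have "\<dots> \<le> (\<Sum>n\<in>{1..N}. (norm ((X n - X (n - 1)) /\<^sub>R h - Y n))\<^sup>2)"
      by (rule discrete_resolvent_estimate[OF res \<Psi> N h X0 XY])
    also have "\<dots> \<le> (\<Sum>n\<in>{1..N}. (T * \<eta> + norm (g 0))\<^sup>2)" by (intro sum_mono power_mono G) auto
    also have "\<dots> = real (4 * M) * (T * \<eta> + norm (g 0))\<^sup>2" by (simp add: N_def)
    finally have "real M * (2 * (\<Psi>\<^sup>2 * (T / 4 * norm (g T))\<^sup>2)) \<le> real M * (4 * (T * \<eta> + norm (g 0))\<^sup>2)"
      by (simp add: mult_ac)
    then have "2 * (\<Psi>\<^sup>2 * (T / 4 * norm (g T))\<^sup>2) \<le> 4 * (T * \<eta> + norm (g 0))\<^sup>2"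
      by (rule mult_left_le_imp_le) (use M in simp)
    moreover have "(\<Psi> * T * norm (g T))\<^sup>2 = 16 * (\<Psi>\<^sup>2 * (T / 4 * norm (g T))\<^sup>2)"
      by (simp add: power_mult_distrib power_divide)
    moreover have "(6 * (T * \<eta> + norm (g 0)))\<^sup>2 = 36 * (T * \<eta> + norm (g 0))\<^sup>2"
      by (simp only: power_mult_distrib) simp
    moreover have "(T * \<eta> + norm (g 0))\<^sup>2 \<ge> 0" by simp
    ultimately have "(\<Psi> * T * norm (g T))\<^sup>2 \<le> (6 * (T * \<eta> + norm (g 0)))\<^sup>2" by linarith
    moreover have "0 \<le> 6 * (T * \<eta> + norm (g 0))" using T \<eta> by simp
    ultimately show ?thesis by (rule power2_le_imp_le)
  qed
  show ?thesis
  \<comment> \<open>The grid has served its purpose and disappears as \<open>\<eta>\<close> tends to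
    0.\<close>
  proof (rule field_le_epsilon)
    fix e :: real assume "e > 0"
    then show "\<Psi> * T * norm (g T) \<le> 6 * norm (g 0) + e"
      using main[of "e / (6 * T)"] T by (simp add: field_simps)
  qed
qed

end

section \<open>Decay of Fourier modes\<close>

lemma torus_integral_eq_herm:
  assumes "sq_integrable X"
  shows "(\<integral>z. rep_l2_torus F z * X z \<partial>torus_measure) = herm F (abs_l2_torus (\<lambda>z. cnj (X z)))"
  using herm_abs_right[OF sq_integrable_cnj[OF assms], of F] by simp

text \<open>Every test function imposes one condition on the pair; expressed through
  \<open>herm\<close> it is complex linear in both components.\<close>

lemma complex_linear_relation_drift_diffusion:
  assumes u: "continuous_on UNIV u"
  shows "complex_linear_relation (drift_diffusion a b u)"
proof -
  let ?X = "\<lambda>\<phi> z. of_real a * partial_x (partial_x \<phi>) z + of_real b * partial_y (partial_y \<phi>) z + of_real (u (snd z)) * partial_x \<phi> z"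
  have sq: "sq_integrable \<phi> \<and> sq_integrable (?X \<phi>)" if "torus_test_function \<phi>" for \<phi>
  proof -
    have "Ck (Suc (Suc 0)) \<phi>" using that unfolding torus_test_function_def by blast
    then have c: "continuous_on UNIV \<phi>" "continuous_on UNIV (partial_x \<phi>)"
        "continuous_on UNIV (partial_x (partial_x \<phi>))" "continuous_on UNIV (partial_y (partial_y \<phi>))"
      unfolding Ck.simps by auto
    have cu: "continuous_on UNIV (\<lambda>z::real\<times>real. complex_of_real (u (snd z)))"
      by (intro continuous_on_of_real continuous_on_compose2[OF u] continuous_intros) auto
    show ?thesis by (intro conjI sq_integrable_continuous continuous_intros c cu)
  qed
  have iff: "(F, G) \<in> drift_diffusion a b u \<longleftrightarrow> (\<forall>\<phi>. torus_test_function \<phi> \<longrightarrow>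
      herm G (abs_l2_torus (\<lambda>z. cnj (\<phi> z))) = herm F (abs_l2_torus (\<lambda>z. cnj (?X \<phi> z))))" for F G
    unfolding drift_diffusion_def mem_Collect_eq prod.case using sq by (simp add: torus_integral_eq_herm)
  show ?thesis
    by standard (auto simp only: iff herm_add_left herm_cscale_left herm_linear_simps)
qed

text \<open>Treats both semigroups of the theorem together: \<open>b = \<nu>\<close>, with
  \<open>a = \<nu>\<close> for \<open>S\<close> and \<open>a = 0\<close> for
  \<open>R\<close>.\<close>

locale mode_semigroup =
  fixes u :: "real \<Rightarrow> real" and a b :: real and S :: "real \<Rightarrow> l2_torus \<Rightarrow> l2_torus"
  assumes u: "continuous_on UNIV u" "\<And>y. u (y + 2 * pi) = u y"
    and ab: "a \<ge> 0" "b \<ge> 0"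
    and S: "C0_semigroup S" and gen: "generator S = drift_diffusion a b u"
begin

sublocale complex_linear_relation "drift_diffusion a b u"
  by (rule complex_linear_relation_drift_diffusion[OF u(1)])

lemma mode_derivative:
  assumes "(f, g) \<in> generator S" "t \<in> {0..T}"
  shows "((\<lambda>t. fourier_proj j (S t f)) has_vector_derivative fourier_proj j (S t g)) (at t within {0..T})"
  by (rule bounded_linear.has_vector_derivative[OF bounded_linear_fourier_proj C0_semigroup_has_vector_derivative[OF S assms]])

lemma mode_continuous: "continuous_on {0..T} (\<lambda>t. fourier_proj j (S t f))"
  by (rule continuous_on_compose2[OF linear_continuous_on[OF bounded_linear_fourier_proj, of UNIV]
      C0_semigroup_continuous_on[OF S]]) simp

text \<open>The squared norm has derivative twice the inner product that
  \<open>drift_diffusion_mode_dissipative\<close> makes nonpositive. Working with one mode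
  \<open>j\<close> at a time is what later separates the modes.\<close>

lemma norm_mode_decreasing:
  assumes fg: "(f, g) \<in> generator S" and st: "0 \<le> s" "s \<le> t"
  shows "norm (fourier_proj j (S t f)) \<le> norm (fourier_proj j (S s f))"
proof -
  let ?v = "\<lambda>t. fourier_proj j (S t f)"
  have "?v t \<bullet> ?v t \<le> ?v s \<bullet> ?v s"
  proof (rule DERIV_nonpos_imp_decreasing_open[OF st(2), of "\<lambda>t. ?v t \<bullet> ?v t"])
    fix r assume r: "s < r" "r < t"
    let ?w = "fourier_proj j (S r g)"
    have "(?v has_vector_derivative ?w) (at r within {0..t})"
      by (rule mode_derivative[OF fg]) (use r st in auto)
    moreover have "at r within {0..t} = at r"
      by (rule at_within_interior) (use r st in simp)
    ultimately have d: "(?v has_vector_derivative ?w) (at r)" by simp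
    have "((\<lambda>t. ?v t \<bullet> ?v t) has_vector_derivative (?v r \<bullet> ?w + ?w \<bullet> ?v r)) (at r)"
      by (rule bounded_bilinear.has_vector_derivative[OF bounded_bilinear_inner d d])
    moreover have "?v r \<bullet> ?w \<le> 0"
    proof (rule drift_diffusion_mode_dissipative[OF u _ ab])
      show "(S r f, S r g) \<in> drift_diffusion a b u"
        using generator_invariant[OF S fg, of r] r st gen by simp
    qed
    ultimately show "\<exists>y. ((\<lambda>t. ?v t \<bullet> ?v t) has_real_derivative y) (at r) \<and> y \<le> 0"
      unfolding has_real_derivative_iff_has_vector_derivative
      by (intro exI[of _ "?v r \<bullet> ?w + ?w \<bullet> ?v r"]) (simp add: inner_commute)
  next
    have "continuous_on {s..t} ?v"
      by (rule continuous_on_subset[OF mode_continuous[of t]]) (use st in auto)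
    then show "continuous_on {s..t} (\<lambda>t. ?v t \<bullet> ?v t)" by (intro continuous_intros)
  qed
  then show ?thesis by (simp add: power2_norm_eq_inner[symmetric] power2_le_iff_abs_le)
qed

text \<open>A mode that vanishes initially vanishes forever, because its norm cannot grow.\<close>

lemma mode_invariant:
  assumes fg: "(f, g) \<in> generator S" and f: "fourier_proj k f = f" and t: "t \<ge> 0"
  shows "fourier_proj k (S t f) = S t f"
proof (rule fourier_proj_complete)
  fix j assume "j \<noteq> k"
  then have "fourier_proj j f = 0" using fourier_proj_fourier_proj[of j k f] f by simp
  then show "fourier_proj j (S t f) = 0"
    using norm_mode_decreasing[OF fg order_refl t, of j] S by (simp add: C0_semigroup_def)
qed

lemma mode_sum_in_domain: "\<exists>G. (mode_sum k N F, G) \<in> generator S"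
proof -
  have "\<exists>G. (cscale (fcoef F k m) (emode k m), G) \<in> drift_diffusion a b u" for m
    by (rule emode_in_drift_diffusion[OF u])
  then obtain G where "\<And>m. (cscale (fcoef F k m) (emode k m), G m) \<in> drift_diffusion a b u" by metis
  then have "(mode_sum k N F, (\<Sum>m\<in>{- int N..int N}. G m)) \<in> drift_diffusion a b u"
    unfolding mode_sum_def by (intro sum) auto
  then show ?thesis by (auto simp: gen)
qed

lemma fourier_proj_mode_sum: "fourier_proj k (mode_sum k N F) = mode_sum k N F"
  by (rule l2_torus_eqI) (simp add: fcoef_fourier_proj fcoef_mode_sum)

context
  fixes k :: int and \<Psi> :: real
  assumes \<Psi>: "\<Psi> > 0"
    and res: "\<And>F G z. (F, G) \<in> drift_diffusion a b u \<Longrightarrow> Re z \<ge> 0 \<Longrightarrow>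
      \<Psi> * norm (fourier_proj k F) \<le> norm (cscale z (fourier_proj k F) - fourier_proj k G)"
begin

lemma mode_halving:
  assumes fg: "(f, g) \<in> generator S" and s: "s \<ge> 0"
  shows "norm (fourier_proj k (S (s + 12 / \<Psi>) f)) \<le> norm (fourier_proj k (S s f)) / 2"
proof -
  \<comment> \<open>\<open>orbit_decay\<close> contracts by the factor
    \<open>6 / (\<Psi> * T)\<close>, which is one half for this \<open>T\<close>.\<close>
  define T where "T = 12 / \<Psi>"
  \<comment> \<open>The hypothesis \<open>res\<close> controls the \<open>k\<close>-th component
    only, so \<open>orbit_decay\<close> is applied to the projected graph.\<close>
  define D where "D = {(fourier_proj k F, fourier_proj k G) | F G. (F, G) \<in> drift_diffusion a b u}"
  have T: "T > 0" using \<Psi> by (simp add: T_def)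
  have lin: "linear (fourier_proj k)" by (rule bounded_linear.linear[OF bounded_linear_fourier_proj])
  interpret D: complex_linear_relation D
  proof
    have D: "(fourier_proj k F, fourier_proj k G) \<in> D" if "(F, G) \<in> drift_diffusion a b u" for F G
      using that unfolding D_def by blast
    show "(0, 0) \<in> D" using D[OF zero] by (simp add: linear_0[OF lin])
    show "(x + x', y + y') \<in> D" if xy: "(x, y) \<in> D" "(x', y') \<in> D" for x y x' y'
    proof -
      obtain F G F' G' where "x = fourier_proj k F" "y = fourier_proj k G" "(F, G) \<in> drift_diffusion a b u"
        "x' = fourier_proj k F'" "y' = fourier_proj k G'" "(F', G') \<in> drift_diffusion a b u"
        using xy unfolding D_def by blast
      then show ?thesis using D[OF add, of F G F' G'] by (simp add: linear_add[OF lin])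
    qed
    show "(cscale c x, cscale c y) \<in> D" if xy: "(x, y) \<in> D" for x y c
    proof -
      obtain F G where "x = fourier_proj k F" "y = fourier_proj k G" "(F, G) \<in> drift_diffusion a b u"
        using xy unfolding D_def by blast
      then show ?thesis using D[OF scale, of F G c] by (simp add: fourier_proj_cscale)
    qed
  qed
  define f' g' where "f' = S s f" and "g' = S s g"
  have fg': "(f', g') \<in> generator S" unfolding f'_def g'_def by (rule generator_invariant[OF S fg s])
  have "\<Psi> * T * norm (fourier_proj k (S T f')) \<le> 6 * norm (fourier_proj k (S 0 f'))"
  proof (rule D.orbit_decay[where g = "\<lambda>t. fourier_proj k (S t f')" and g' = "\<lambda>t. fourier_proj k (S t g')"])
    show "\<Psi> * norm x \<le> norm (cscale z x - y)" if "(x, y) \<in> D" "0 \<le> Re z" for x y z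
      using that res by (auto simp: D_def)
    show "(fourier_proj k (S t f'), fourier_proj k (S t g')) \<in> D" if "t \<in> {0..T}" for t
      using generator_invariant[OF S fg', of t] that by (auto simp: D_def gen)
    show "((\<lambda>t. fourier_proj k (S t f')) has_vector_derivative fourier_proj k (S t g')) (at t within {0..T})" if "t \<in> {0..T}" for t
      by (rule mode_derivative[OF fg' that])
    show "continuous_on {0..T} (\<lambda>t. fourier_proj k (S t g'))"
      by (rule mode_continuous)
    show "norm (fourier_proj k (S T f')) \<le> norm (fourier_proj k (S t f')) \<and> norm (fourier_proj k (S t f')) \<le> norm (fourier_proj k (S 0 f'))"
      if "t \<in> {0..T}" for t
      using that by (auto intro!: norm_mode_decreasing[OF fg'])
  qed (use \<Psi> T in auto)
  moreover have "S T f' = S (s + T) f" "S 0 f' = S s f"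
    using S s T unfolding f'_def C0_semigroup_def by (metis add.commute comp_apply less_imp_le) (simp add: S[unfolded C0_semigroup_def])
  ultimately show ?thesis using \<Psi> by (simp add: T_def)
qed

text \<open>Iterated halving over steps of length \<open>T = 12 / \<Psi>\<close> gives the rate
  \<open>ln 2 / T\<close>; the factor 2 pays for rounding \<open>t / T\<close> down.\<close>

lemma mode_decay:
  assumes fg: "(f, g) \<in> generator S" and t: "t \<ge> 0"
  shows "norm (fourier_proj k (S t f)) \<le> 2 * exp (- (ln 2 / 12 * \<Psi> * t)) * norm (fourier_proj k f)"
proof -
  define T where "T = 12 / \<Psi>"
  have T: "T > 0" using \<Psi> by (simp add: T_def)
  have S0: "S 0 f = f" using S by (simp add: C0_semigroup_def)
  have iter: "norm (fourier_proj k (S (real n * T) f)) \<le> (1 / 2) ^ n * norm (fourier_proj k f)" for n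
  proof (induction n)
    case (Suc n)
    have "norm (fourier_proj k (S (real (Suc n) * T) f)) \<le> norm (fourier_proj k (S (real n * T) f)) / 2"
      using mode_halving[OF fg, of "real n * T"] T by (simp add: T_def[symmetric] distrib_right add.commute)
    then show ?case using Suc by simp
  qed (simp add: S0)
  define n where "n = nat \<lfloor>t / T\<rfloor>"
  have "t / T \<ge> 0" using t T by simp
  then have n: "real n \<le> t / T" "t / T < real n + 1" unfolding n_def by linarith+
  have "norm (fourier_proj k (S t f)) \<le> norm (fourier_proj k (S (real n * T) f))"
    by (rule norm_mode_decreasing[OF fg]) (use T n in \<open>auto simp: pos_le_divide_eq\<close>)
  also have "\<dots> \<le> (1 / 2) ^ n * norm (fourier_proj k f)" by (rule iter)
  also have "(1 / 2 :: real) ^ n \<le> 2 * exp (- (ln 2 / 12 * \<Psi> * t))"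
  proof -
    have "(1 / 2 :: real) ^ n = exp (- (ln 2 * real n))"
      by (simp add: exp_minus exp_of_nat2_mult power_one_over inverse_eq_divide)
    also have "\<dots> \<le> exp (ln 2 - ln 2 * (t / T))"
    proof -
      have "ln 2 * (t / T) \<le> ln (2::real) * (real n + 1)" using n(2) by (intro mult_left_mono) auto
      then show ?thesis by (simp add: distrib_left)
    qed
    also have "\<dots> = 2 * exp (- (ln 2 * (t / T)))" by (simp add: exp_diff exp_minus divide_inverse)
    also have "ln 2 * (t / T) = ln 2 / 12 * \<Psi> * t" by (simp add: T_def)
    finally show ?thesis .
  qed
  finally show ?thesis by (simp add: mult_right_mono)
qed

lemma onorm_mode_decay:
  assumes t: "t \<ge> 0"
  shows "onorm (S t \<circ> fourier_proj k) \<le> 2 * exp (- (ln 2 / 12 * \<Psi> * t))"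
proof (rule onorm_bound)
  fix F
  let ?c = "2 * exp (- (ln 2 / 12 * \<Psi> * t))"
  have bl: "bounded_linear (S t)" using S t by (simp add: C0_semigroup_def)
  have N: "norm (S t (mode_sum k N F)) \<le> ?c * norm (mode_sum k N F)" for N
  proof -
    obtain G where G: "(mode_sum k N F, G) \<in> generator S" using mode_sum_in_domain by blast
    show ?thesis
      using mode_decay[OF G t] mode_invariant[OF G fourier_proj_mode_sum t] by (simp add: fourier_proj_mode_sum)
  qed
  have "norm (S t (fourier_proj k F)) \<le> ?c * norm (fourier_proj k F)"
    by (rule LIMSEQ_le[OF tendsto_norm[OF bounded_linear.tendsto[OF bl mode_sum_tendsto]]
        tendsto_mult[OF tendsto_const tendsto_norm[OF mode_sum_tendsto]]]) (use N in blast)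
  also have "\<dots> \<le> ?c * norm F" by (intro mult_left_mono norm_fourier_proj_le) auto
  finally show "norm ((S t \<circ> fourier_proj k) F) \<le> ?c * norm F" by simp
qed simp

end

end

theorem theorem5p1:
  fixes u :: "real \<Rightarrow> real" and \<alpha> C\<^sub>1 :: real
    and S R :: "real \<Rightarrow> real \<Rightarrow> l2_torus \<Rightarrow> l2_torus"
  assumes "\<alpha> > 0"
    and "continuous_on UNIV u" and "\<And>y. u (y + 2 * pi) = u y"
    and "C\<^sub>1 > 0"
    and "\<And>\<delta>. 0 < \<delta> \<Longrightarrow> \<delta> < 1 \<Longrightarrow> omega1 \<delta> u \<ge> C\<^sub>1 * \<delta> powr (2 * \<alpha> + 3)"
    and "\<And>\<nu>. \<nu> > 0 \<Longrightarrow> full_diffusion_semigroup \<nu> u (S \<nu>)"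
    and "\<And>\<nu>. \<nu> > 0 \<Longrightarrow> y_diffusion_semigroup \<nu> u (R \<nu>)"
  shows "\<exists>\<epsilon> > 0. \<exists>C > 0. \<forall>\<nu> > 0. \<forall>k :: int. k \<noteq> 0 \<longrightarrow> \<nu> / \<bar>real_of_int k\<bar> \<le> 1 / 2 \<longrightarrow>
    (let lam = \<nu> powr (\<alpha> / (\<alpha> + 2)) * \<bar>real_of_int k\<bar> powr (2 / (\<alpha> + 2)) in
      \<forall>t \<ge> 0. onorm (S \<nu> t \<circ> fourier_proj k) \<le> C * exp (- \<epsilon> * lam * t) \<and>
              onorm (R \<nu> t \<circ> fourier_proj k) \<le> C * exp (- \<epsilon> * lam * t))"
proof -
  have "\<exists>\<epsilon>>0. \<forall>\<nu> \<kappa>. \<nu> > 0 \<longrightarrow> \<kappa> \<noteq> 0 \<longrightarrow> \<nu> / \<bar>\<kappa>\<bar> \<le> 1 / 2 \<longrightarrow>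
      resolvent_bound u \<kappa> \<nu> (\<epsilon> * decay_rate \<alpha> \<nu> \<kappa>)"
    by (rule resolvent_estimate[OF assms(1-4)]) (rule assms(5); assumption)
  then obtain \<epsilon> where \<epsilon>: "\<epsilon> > 0" and est: "\<And>\<nu> \<kappa>. \<nu> > 0 \<Longrightarrow> \<kappa> \<noteq> 0 \<Longrightarrow> \<nu> / \<bar>\<kappa>\<bar> \<le> 1 / 2 \<Longrightarrow>
      resolvent_bound u \<kappa> \<nu> (\<epsilon> * decay_rate \<alpha> \<nu> \<kappa>)"
    by blast
  show ?thesis
  \<comment> \<open>These witnesses are the constants of \<open>onorm_mode_decay\<close> for
    \<open>\<Psi> = \<epsilon> * lam\<close>.\<close>
  proof (rule exI[of _ "ln 2 / 12 * \<epsilon>"], rule conjI[rotated], rule exI[of _ 2], intro conjI allI impI)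
    fix \<nu> :: real and k :: int
    assume \<nu>: "\<nu> > 0" and k: "k \<noteq> 0" and \<nu>k: "\<nu> / \<bar>real_of_int k\<bar> \<le> 1 / 2"
    define lam where "lam = decay_rate \<alpha> \<nu> (real_of_int k)"
    have lam: "lam > 0" using \<nu> k by (simp add: lam_def)
    have decay: "onorm (Q t \<circ> fourier_proj k) \<le> 2 * exp (- (ln 2 / 12 * (\<epsilon> * lam) * t))"
      if Q: "C0_semigroup Q" "generator Q = drift_diffusion a \<nu> u" and a: "a \<ge> 0" and t: "t \<ge> 0" for Q a t
    proof -
      interpret mode_semigroup u a \<nu> Q
        by standard (use assms Q a \<nu> in auto)
      show ?thesis
      proof (rule onorm_mode_decay[OF _ _ t])
        show "\<epsilon> * lam > 0" using \<epsilon> lam by simp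
        show "\<epsilon> * lam * norm (fourier_proj k F) \<le> norm (cscale z (fourier_proj k F) - fourier_proj k G)"
          if "(F, G) \<in> drift_diffusion a \<nu> u" "0 \<le> Re z" for F G z
        proof (rule drift_diffusion_mode_resolvent[OF assms(2,3) that(1) a that(2)])
          show "0 \<le> \<epsilon> * lam" using \<epsilon> lam by simp
          show "resolvent_bound u (of_int k) \<nu> (\<epsilon> * lam)"
            unfolding lam_def by (rule est) (use \<nu> k \<nu>k in auto)
        qed
      qed
    qed
    show "let lam = \<nu> powr (\<alpha> / (\<alpha> + 2)) * \<bar>real_of_int k\<bar> powr (2 / (\<alpha> + 2)) in
      \<forall>t \<ge> 0. onorm (S \<nu> t \<circ> fourier_proj k) \<le> 2 * exp (- (ln 2 / 12 * \<epsilon>) * lam * t) \<and>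
              onorm (R \<nu> t \<circ> fourier_proj k) \<le> 2 * exp (- (ln 2 / 12 * \<epsilon>) * lam * t)"
      unfolding Let_def lam_def[symmetric]
      using assms(6)[OF \<nu>] assms(7)[OF \<nu>] decay[of "S \<nu>" \<nu>] decay[of "R \<nu>" 0] \<nu>
      by (simp add: full_diffusion_semigroup_def y_diffusion_semigroup_def mult.assoc)
  qed (use \<epsilon> in auto)
qed

end
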